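(* Let $\lambda\in\mathbb{C}^\times$ and $\alpha,\beta,a,b\in\mathbb{C}$, and let $M_{\alpha,\beta}^{\lambda,a,b}$ be the $\mathfrak{g}$-module defined in the context. Then: (i) $M_{\alpha,\beta}^{\lambda,a,b}$ is a simple $\mathfrak{g}$-module if and only if either $\beta^2+a\neq 0$, or $\beta^2+a=0$ and $(\alpha_k+2s)\beta+b\neq 0$ for all $k\in\mathbb{Z}$ and $s\in\mathbb{N}$. (ii) If $M_{\alpha,\beta}^{\lambda,a,b}$ is not simple, then $M_{k,s}:=U(\mathfrak{g})\eta_{\alpha_k,\beta}$ is the (opposite) Verma module with the lowest weight (vector) $\eta_{\alpha_k,\beta}$, where $k\in\mathbb{Z}$ is such that $(\alpha_k+2s)\beta+b=0$ for some $s\in\mathbb{N}$. Moreover, $M_{\alpha,\beta}^{\lambda,a,b}/M_{k,s}\cong N_{k,s}$, where $N_{k,s}$ is a generalized weight $U(\mathfrak{g})$-module with infinite dimensional weight spaces. (iii) For any $\alpha,\beta,a,b\in\mathbb{C}$ and $\lambda,\lambda'\in\mathbb{C}^\times$, we have $M_{\alpha,\beta}^{\lambda,a,b}\cong M_{\alpha,\beta}^{\lambda',a,b}$. (iv) For any $\alpha,\beta,\alpha',\beta',a,b,a',b'\in\mathbb{C}$ and $\lambda,\lambda'\in\mathbb{C}^\times$, we have $M_{\alpha,\beta}^{\lambda,a,b}\cong M_{\alpha',\beta'}^{\lambda',a',b'}$ if and only if $\alpha-\alpha'\in 2\mathbb{Z}$, $\beta=\beta'$, $a=a'$ and $b=b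'$.
   Context: All vector spaces and algebras are over $\mathbb{C}$; $\mathbb{C}^\times=\mathbb{C}\setminus\{0\}$, $\mathbb{N}=\{1,2,\dots\}$. $\mathfrak{g}=\mathfrak{sl}_2\otimes_{\mathbb{C}}\mathbb{C}[t]/(t^2)$ is the Takiff Lie algebra for $\mathfrak{sl}_2$, with $[x\otimes t^i,y\otimes t^j]=[x,y]\otimes t^{i+j}$. With the standard basis $e,h,f$ of $\mathfrak{sl}_2$ ($[e,f]=h$, $[h,e]=2e$, $[h,f]=-2f$), identify $x$ with $x\otimes 1$ and put $\overline{x}=x\otimes t$ for $x\in\{e,h,f\}$. Triangular decomposition: $\overline{\mathfrak{n}}_+=\mathrm{span}(e,\overline{e})$, $\overline{\mathfrak{h}}=\mathrm{span}(h,\overline{h})$, $\overline{\mathfrak{n}}_-=\mathrm{span}(f,\overline{f})$. Write $\overline{\partial}=\partial/\partial\overline{h}$. $\Gamma(\lambda,a,b)$ is the $\mathfrak{g}$-module with underlying space $\mathbb{C}[h,\overline{h}]$, with $h,\overline{h}$ acting by multiplication and, for $\gamma=\gamma(h,\overline{h})$, $e\cdot\gamma=-2\lambda\,\overline{\partial}(\gamma(h-2,\overline{h}))$, $\overline{e}\cdot\gamma=\lambda\gamma(h-2,\overline{h})$, $\overline{f}\cdot\gamma=-\frac{1}{4\lambda}(\overline{h}^2+a)\gamma(h+2,\overline{h})$, $f\cdot\gamma=-\frac{1}{2\lambda}((h+2)\overline{h}+b)\gamma(h+2,\overline{h})-\frac{1}{2\lambda}(\overline{h}^2+a)\overline{\partial}(\gamma(h+2,\overline{h}))$.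 For a $\mathfrak{g}$-module $M$, the dual space $M^*$ is a $\mathfrak{g}$-module via $(y\cdot\varphi)(v)=-\varphi(y\cdot v)$ for $y\in\mathfrak{g}$. Put $\alpha_k=\alpha+2k$. For $k\in\mathbb{Z}$, $s\in\mathbb{N}$, $\eta_{\alpha_k,\beta^s}:\mathbb{C}[h,\overline{h}]\to\mathbb{C}$ is the linear functional with $\eta_{\alpha_k,\beta^s}\big((h-\alpha_k)^i(\overline{h}-\beta)^j\big)=\delta_{i,0}\delta_{j,s-1}(s-1)!$ for all $i,j\ge 0$ (the superscript in $\beta^s$ is only an index: the functional depends on the triple $(k,\beta,s)$); $\eta_{\alpha_k,\beta}$ denotes the case $s=1$. $M_{\alpha,\beta}^{\lambda,a,b}$ is the submodule of $\Gamma(\lambda,a,b)^*$ with basis $\{\eta_{\alpha_k,\beta^s}: k\in\mathbb{Z},\,s\in\mathbb{N}\}$. A $\mathfrak{g}$-module $M$ is a generalized weight module if it is the sum of the generalized weight spaces $M^\mu=\{v\in M: (h-\mu(h))^kv=0,\ (\overline{h}-\mu(\overline{h}))^sv=0\text{ for some }k,s\in\mathbb{N}\}$, $\mu\in\overline{\mathfrak{h}}^*$. The opposite Verma module with lowest weight $\mu\in\overline{\mathfrak{h}}^*$ is $U(\mathfrak{g})\otimes_{U(\overline{\mathfrak{h}}\oplus\overline{\mathfrak{n}}_-)}\mathbb{C}_\mu$, where $\overline{\mathfrak{n}}_-$ acts on $\mathbb{C}_\mu$ by $0$ and $\overline{\mathfrak{h}}$ by $\mu$; its canonical generator is the lowest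 weight vector.
   Formalization: In (ii), for s≥2 and β≠0 the vector η_{α_k,β} is not killed by f, so it is not a lowest weight vector; there M_{k,s} is shown to be an opposite Verma module with lowest weight vector η_{α_{k+j},β} for some 0≤j<s. The literal claim is kept when s=1 or β=0. *)

theory Defs
  imports
    "HOL-Analysis.Determinants"
    "HOL-Computational_Algebra.Polynomial"
    "HOL-Library.Poly_Mapping"
    "HOL-Algebra.Module"
    "HOL-Algebra.QuotRing"
    "HOL-Algebra.Generated_Groups"
    "HOL-Algebra.Free_Abelian_Groups"
begin

section \<open>The Takiff Lie algebra of \<open>sl\<^sub>2\<close>\<close>

text \<open>The pair \<open>(A, B)\<close> stands for \<open>A \<otimes> 1 + B \<otimes> t\<close> in \<open>sl\<^sub>2 \<otimes> \<complex>[t]/(t\<^sup>2)\<close>.\<close>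

type_synonym takiff_elt = "(complex^2^2) \<times> (complex^2^2)"

definition takiff :: "takiff_elt set" where
  "takiff = {(A, B). trace A = 0 \<and> trace B = 0}"

definition takiff_scale :: "complex \<Rightarrow> takiff_elt \<Rightarrow> takiff_elt" where
  "takiff_scale c x = ((\<chi> i j. c * fst x $ i $ j), (\<chi> i j. c * snd x $ i $ j))"

definition comm_bracket :: "complex^2^2 \<Rightarrow> complex^2^2 \<Rightarrow> complex^2^2" where
  "comm_bracket A B = A ** B - B ** A"

definition takiff_bracket :: "takiff_elt \<Rightarrow> takiff_elt \<Rightarrow> takiff_elt" where
  "takiff_bracket x y =
     (comm_bracket (fst x) (fst y),
      comm_bracket (fst x) (snd y) + comm_bracket (snd x) (fst y))"

definition mat_e :: "complex^2^2" where "mat_e = vector [vector [0, 1], vector [0, 0]]"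
definition mat_h :: "complex^2^2" where "mat_h = vector [vector [1, 0], vector [0, -1]]"
definition mat_f :: "complex^2^2" where "mat_f = vector [vector [0, 0], vector [1, 0]]"

definition tk_h :: takiff_elt where "tk_h = (mat_h, 0)"
definition tk_hbar :: takiff_elt where "tk_hbar = (0, mat_h)"

text \<open>The subalgebra spanned by \<open>h, hbar, f, fbar\<close>.\<close>

definition borel_minus :: "takiff_elt set" where
  "borel_minus = {x \<in> takiff. fst x $ 1 $ 2 = 0 \<and> snd x $ 1 $ 2 = 0}"


section \<open>Modules over the Takiff Lie algebra\<close>

definition complex_field :: "complex ring" where
  "complex_field =
     \<lparr>carrier = UNIV, monoid.mult = (*), one = 1, ring.zero = 0, add = (+)\<rparr>"

text \<open>The fields \<open>mult\<close> and \<open>one\<close>, inherited from the library's record of modules,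
  play no role for modules; they are \<open>undefined\<close> below.\<close>

record 'v rep = "(complex, 'v) module" +
  act :: "takiff_elt \<Rightarrow> 'v \<Rightarrow> 'v"

locale takiff_module = Module.module complex_field M for M :: "('v, 'm) rep_scheme" (structure) +
  assumes act_closed: "\<lbrakk>x \<in> takiff; v \<in> carrier M\<rbrakk> \<Longrightarrow> act M x v \<in> carrier M"
    and act_add_left: "\<lbrakk>x \<in> takiff; y \<in> takiff; v \<in> carrier M\<rbrakk> \<Longrightarrow>
      act M (x + y) v = act M x v \<oplus>\<^bsub>M\<^esub> act M y v"
    and act_scale_left: "\<lbrakk>x \<in> takiff; v \<in> carrier M\<rbrakk> \<Longrightarrow>
      act M (takiff_scale c x) v = c \<odot>\<^bsub>M\<^esub> act M x v"
    and act_add_right: "\<lbrakk>x \<in> takiff; v \<in> carrier M; w \<in> carrier M\<rbrakk> \<Longrightarrow>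
      act M x (v \<oplus>\<^bsub>M\<^esub> w) = act M x v \<oplus>\<^bsub>M\<^esub> act M x w"
    and act_scale_right: "\<lbrakk>x \<in> takiff; v \<in> carrier M\<rbrakk> \<Longrightarrow>
      act M x (c \<odot>\<^bsub>M\<^esub> v) = c \<odot>\<^bsub>M\<^esub> act M x v"
    and act_bracket: "\<lbrakk>x \<in> takiff; y \<in> takiff; v \<in> carrier M\<rbrakk> \<Longrightarrow>
      act M (takiff_bracket x y) v = act M x (act M y v) \<ominus>\<^bsub>M\<^esub> act M y (act M x v)"

definition lin_span :: "('v, 'm) rep_scheme \<Rightarrow> 'v set \<Rightarrow> 'v set" where
  "lin_span M S = \<Inter>{H. submodule H complex_field M \<and> S \<subseteq> H}"

definition finite_dim :: "('v, 'm) rep_scheme \<Rightarrow> 'v set \<Rightarrow> bool" where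
  "finite_dim M W \<longleftrightarrow> (\<exists>S. finite S \<and> S \<subseteq> W \<and> W \<subseteq> lin_span M S)"

definition takiff_submodule :: "'v set \<Rightarrow> ('v, 'm) rep_scheme \<Rightarrow> bool" where
  "takiff_submodule H M \<longleftrightarrow>
     submodule H complex_field M \<and> (\<forall>x\<in>takiff. \<forall>v\<in>H. act M x v \<in> H)"

definition simple_module :: "('v, 'm) rep_scheme \<Rightarrow> bool" where
  "simple_module M \<longleftrightarrow> takiff_module M \<and> carrier M \<noteq> {\<zero>\<^bsub>M\<^esub>} \<and>
     (\<forall>H. takiff_submodule H M \<longrightarrow> H = {\<zero>\<^bsub>M\<^esub>} \<or> H = carrier M)"

definition rep_iso :: "('v \<Rightarrow> 'w) \<Rightarrow> ('v, 'm) rep_scheme \<Rightarrow> ('w, 'n) rep_scheme \<Rightarrow> bool" where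
  "rep_iso \<phi> M N \<longleftrightarrow> bij_betw \<phi> (carrier M) (carrier N) \<and>
     (\<forall>v\<in>carrier M. \<forall>w\<in>carrier M. \<phi> (v \<oplus>\<^bsub>M\<^esub> w) = \<phi> v \<oplus>\<^bsub>N\<^esub> \<phi> w) \<and>
     (\<forall>c. \<forall>v\<in>carrier M. \<phi> (c \<odot>\<^bsub>M\<^esub> v) = c \<odot>\<^bsub>N\<^esub> \<phi> v) \<and>
     (\<forall>x\<in>takiff. \<forall>v\<in>carrier M. \<phi> (act M x v) = act N x (\<phi> v))"

definition rep_isomorphic :: "('v, 'm) rep_scheme \<Rightarrow> ('w, 'n) rep_scheme \<Rightarrow> bool" where
  "rep_isomorphic M N \<longleftrightarrow> (\<exists>\<phi>. rep_iso \<phi> M N)"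

definition restrict_rep :: "'v rep \<Rightarrow> 'v set \<Rightarrow> 'v rep" where
  "restrict_rep M H = M\<lparr>carrier := H\<rparr>"

text \<open>The operations are those induced on representatives: when \<open>H\<close> is a submodule, all
  members of the indexed unions coincide.\<close>

definition quotient_rep :: "'v rep \<Rightarrow> 'v set \<Rightarrow> 'v set rep" where
  "quotient_rep M H =
     \<lparr>carrier = a_rcosets\<^bsub>M\<^esub> H, monoid.mult = undefined, one = undefined,
      ring.zero = H, add = set_add M,
      module.smult = (\<lambda>c K. \<Union>v\<in>K. H +>\<^bsub>M\<^esub> (c \<odot>\<^bsub>M\<^esub> v)),
      act = (\<lambda>x K. \<Union>v\<in>K. H +>\<^bsub>M\<^esub> act M x v)\<rparr>"

definition dual_rep :: "'v rep \<Rightarrow> ('v \<Rightarrow> complex) rep" where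
  "dual_rep M =
     \<lparr>carrier = {\<phi> \<in> extensional (carrier M).
        (\<forall>v\<in>carrier M. \<forall>w\<in>carrier M. \<phi> (v \<oplus>\<^bsub>M\<^esub> w) = \<phi> v + \<phi> w) \<and>
        (\<forall>c. \<forall>v\<in>carrier M. \<phi> (c \<odot>\<^bsub>M\<^esub> v) = c * \<phi> v)},
      monoid.mult = undefined, one = undefined,
      ring.zero = (\<lambda>v\<in>carrier M. 0),
      add = (\<lambda>\<phi> \<psi>. \<lambda>v\<in>carrier M. \<phi> v + \<psi> v),
      module.smult = (\<lambda>c \<phi>. \<lambda>v\<in>carrier M. c * \<phi> v),
      act = (\<lambda>x \<phi>. \<lambda>v\<in>carrier M. - \<phi> (act M x v))\<rparr>"

text \<open>A weight \<open>\<mu>\<close> is encoded as the pair \<open>(\<mu>(h), \<mu>(hbar))\<close>.\<close>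

definition gen_weight_space :: "('v, 'm) rep_scheme \<Rightarrow> complex \<times> complex \<Rightarrow> 'v set" where
  "gen_weight_space M \<mu> = {v \<in> carrier M. \<exists>k\<ge>1. \<exists>s\<ge>1.
     ((\<lambda>u. act M tk_h u \<ominus>\<^bsub>M\<^esub> fst \<mu> \<odot>\<^bsub>M\<^esub> u) ^^ k) v = \<zero>\<^bsub>M\<^esub> \<and>
     ((\<lambda>u. act M tk_hbar u \<ominus>\<^bsub>M\<^esub> snd \<mu> \<odot>\<^bsub>M\<^esub> u) ^^ s) v = \<zero>\<^bsub>M\<^esub>}"

definition gen_weight_module :: "('v, 'm) rep_scheme \<Rightarrow> bool" where
  "gen_weight_module M \<longleftrightarrow>
     takiff_module M \<and> lin_span M (\<Union>\<mu>. gen_weight_space M \<mu>) = carrier M"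

text \<open>As usual, a weight space means a nonzero one; at least one is required to exist, so that
  the zero module does not qualify.\<close>

definition inf_dim_weight_spaces :: "('v, 'm) rep_scheme \<Rightarrow> bool" where
  "inf_dim_weight_spaces M \<longleftrightarrow>
     (\<exists>\<mu>. gen_weight_space M \<mu> \<noteq> {\<zero>\<^bsub>M\<^esub>}) \<and>
     (\<forall>\<mu>. gen_weight_space M \<mu> \<noteq> {\<zero>\<^bsub>M\<^esub>} \<longrightarrow> \<not> finite_dim M (gen_weight_space M \<mu>))"


section \<open>The universal enveloping algebra\<close>

text \<open>Lists under concatenation form the free monoid, so \<open>'a list \<Rightarrow>\<^sub>0 complex\<close> is the free
  associative algebra on the set of all elements of \<open>'a\<close>.\<close>

instantiation list :: (type) monoid_add
begin

definition plus_list :: "'a list \<Rightarrow> 'a list \<Rightarrow> 'a list" where "plus_list xs ys = xs @ ys"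
definition zero_list :: "'a list" where "zero_list = []"

instance by standard (simp_all add: plus_list_def zero_list_def)

end

type_synonym free_elt = "takiff_elt list \<Rightarrow>\<^sub>0 complex"

definition free_alg :: "takiff_elt set \<Rightarrow> free_elt ring" where
  "free_alg X = \<lparr>carrier = {p. Poly_Mapping.keys p \<subseteq> lists X},
     monoid.mult = (*), one = 1, ring.zero = 0, add = (+)\<rparr>"

definition letter :: "takiff_elt \<Rightarrow> free_elt" where
  "letter x = Poly_Mapping.single [x] 1"

definition scalar :: "complex \<Rightarrow> free_elt" where
  "scalar c = Poly_Mapping.single [] c"

text \<open>The letters are all elements of the Lie algebra, so the linear relations are imposed
  along with the commutator relations.\<close>

definition env_ideal :: "free_elt set" where
  "env_ideal = genideal (free_alg takiff)
    ({letter (x + y) - letter x - letter y | x y. x \<in> takiff \<and> y \<in> takiff} \<union>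
     {letter (takiff_scale c x) - scalar c * letter x | c x. x \<in> takiff} \<union>
     {letter x * letter y - letter y * letter x - letter (takiff_bracket x y)
        | x y. x \<in> takiff \<and> y \<in> takiff})"

definition env_alg :: "free_elt set ring" where
  "env_alg = free_alg takiff Quot env_ideal"

definition env_class :: "free_elt \<Rightarrow> free_elt set" where
  "env_class p = env_ideal +>\<^bsub>free_alg takiff\<^esub> p"

text \<open>The action on \<open>v\<close> of the element of the enveloping algebra represented by \<open>p\<close>.\<close>

definition env_act :: "('v, 'm) rep_scheme \<Rightarrow> free_elt \<Rightarrow> 'v \<Rightarrow> 'v" where
  "env_act M p v =
     (\<Oplus>\<^bsub>M\<^esub>w\<in>Poly_Mapping.keys p. Poly_Mapping.lookup p w \<odot>\<^bsub>M\<^esub> foldr (act M) w v)"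

text \<open>The cyclic submodule \<open>U(g)v\<close>.\<close>

definition env_orbit :: "('v, 'm) rep_scheme \<Rightarrow> 'v \<Rightarrow> 'v set" where
  "env_orbit M v = {env_act M p v | p. p \<in> carrier (free_alg takiff)}"


section \<open>Opposite Verma modules\<close>

text \<open>The one-dimensional module \<open>\<complex>\<^sub>\<mu>\<close>; the action is meaningful for elements of
  \<^const>\<open>borel_minus\<close>, where the (1,1) entries are the coefficients of \<open>h\<close> and \<open>hbar\<close>.\<close>

definition one_dim_rep :: "complex \<times> complex \<Rightarrow> complex rep" where
  "one_dim_rep \<mu> =
     \<lparr>carrier = UNIV, monoid.mult = undefined, one = undefined,
      ring.zero = 0, add = (+), module.smult = (*),
      act = (\<lambda>x z. (fst x $ 1 $ 1 * fst \<mu> + snd x $ 1 $ 1 * snd \<mu>) * z)\<rparr>"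

text \<open>The tensor product of the right \<open>U(b)\<close>-module \<open>U(g)\<close> and the left \<open>U(b)\<close>-module \<open>\<complex>\<^sub>\<mu>\<close>,
  \<open>b\<close> being \<^const>\<open>borel_minus\<close>, is the free abelian group on pairs modulo the biadditivity and
  balancing relations. The elements of \<open>U(b)\<close> are represented by words in \<open>b\<close>.\<close>

type_synonym tensor_elt = "(free_elt set \<times> complex) \<Rightarrow>\<^sub>0 int"

definition tensor_rels :: "complex \<times> complex \<Rightarrow> tensor_elt set" where
  "tensor_rels \<mu> =
     {frag_of (u \<oplus>\<^bsub>env_alg\<^esub> u', z) - frag_of (u, z) - frag_of (u', z)
        | u u' z. u \<in> carrier env_alg \<and> u' \<in> carrier env_alg} \<union>
     {frag_of (u, z + z') - frag_of (u, z) - frag_of (u, z')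
        | u z z'. u \<in> carrier env_alg} \<union>
     {frag_of (u \<otimes>\<^bsub>env_alg\<^esub> env_class p, z) - frag_of (u, env_act (one_dim_rep \<mu>) p z)
        | u p z. u \<in> carrier env_alg \<and> p \<in> carrier (free_alg borel_minus)}"

definition pair_group :: "tensor_elt monoid" where
  "pair_group = free_Abelian_group (carrier env_alg \<times> UNIV)"

definition tensor_null :: "complex \<times> complex \<Rightarrow> tensor_elt set" where
  "tensor_null \<mu> = generate pair_group (tensor_rels \<mu>)"

definition tensor_class :: "complex \<times> complex \<Rightarrow> tensor_elt \<Rightarrow> tensor_elt set" where
  "tensor_class \<mu> F = tensor_null \<mu> #>\<^bsub>pair_group\<^esub> F"

text \<open>Left multiplication by \<open>q\<close> in \<open>U(g)\<close>, induced by \<open>(u, z) \<mapsto> (q u, z)\<close>; all members of the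
  indexed union coincide.\<close>

definition tensor_lmult ::
    "complex \<times> complex \<Rightarrow> free_elt set \<Rightarrow> tensor_elt set \<Rightarrow> tensor_elt set" where
  "tensor_lmult \<mu> q K =
     (\<Union>F\<in>K. tensor_class \<mu> (frag_extend (\<lambda>(u, z). frag_of (q \<otimes>\<^bsub>env_alg\<^esub> u, z)) F))"

definition opp_verma :: "complex \<times> complex \<Rightarrow> tensor_elt set rep" where
  "opp_verma \<mu> =
     \<lparr>carrier = carrier (pair_group Mod tensor_null \<mu>),
      monoid.mult = undefined, one = undefined,
      ring.zero = tensor_null \<mu>,
      add = monoid.mult (pair_group Mod tensor_null \<mu>),
      module.smult = (\<lambda>c. tensor_lmult \<mu> (env_class (scalar c))),
      act = (\<lambda>x. tensor_lmult \<mu> (env_class (letter x)))\<rparr>"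

definition opp_verma_gen :: "complex \<times> complex \<Rightarrow> tensor_elt set" where
  "opp_verma_gen \<mu> = tensor_class \<mu> (frag_of (\<one>\<^bsub>env_alg\<^esub>, 1))"

definition is_opp_verma :: "'v rep \<Rightarrow> 'v \<Rightarrow> bool" where
  "is_opp_verma N v \<longleftrightarrow>
     (\<exists>\<mu> \<phi>. rep_iso \<phi> (opp_verma \<mu>) N \<and> \<phi> (opp_verma_gen \<mu>) = v)"


section \<open>The modules \<open>\<Gamma>(\<lambda>, a, b)\<close> and \<open>M\<close>\<close>

text \<open>\<open>\<complex>[h, hbar]\<close> is rendered as \<open>\<complex>[hbar][h]\<close>: the outer variable is \<open>h\<close>.\<close>

type_synonym bipoly = "complex poly poly"

definition bp_const :: "complex \<Rightarrow> bipoly" where "bp_const c = [:[:c:]:]"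
definition bp_h :: bipoly where "bp_h = [:0, 1:]"
definition bp_hbar :: bipoly where "bp_hbar = [:[:0, 1:]:]"

text \<open>\<open>bp_shift c \<gamma> = \<gamma>(h + c, hbar)\<close>, and \<open>bp_dbar\<close> is the derivative with respect to
  \<open>hbar\<close>.\<close>

definition bp_shift :: "complex \<Rightarrow> bipoly \<Rightarrow> bipoly" where
  "bp_shift c \<gamma> = pcompose \<gamma> (bp_h + bp_const c)"

definition bp_dbar :: "bipoly \<Rightarrow> bipoly" where
  "bp_dbar \<gamma> = map_poly pderiv \<gamma>"

definition Gam_e :: "complex \<Rightarrow> bipoly \<Rightarrow> bipoly" where
  "Gam_e l \<gamma> = bp_const (- 2 * l) * bp_dbar (bp_shift (-2) \<gamma>)"

definition Gam_ebar :: "complex \<Rightarrow> bipoly \<Rightarrow> bipoly" where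
  "Gam_ebar l \<gamma> = bp_const l * bp_shift (-2) \<gamma>"

definition Gam_fbar :: "complex \<Rightarrow> complex \<Rightarrow> bipoly \<Rightarrow> bipoly" where
  "Gam_fbar l a \<gamma> = bp_const (- 1 / (4 * l)) * (bp_hbar ^ 2 + bp_const a) * bp_shift 2 \<gamma>"

definition Gam_f :: "complex \<Rightarrow> complex \<Rightarrow> complex \<Rightarrow> bipoly \<Rightarrow> bipoly" where
  "Gam_f l a b \<gamma> =
     bp_const (- 1 / (2 * l)) * ((bp_h + bp_const 2) * bp_hbar + bp_const b) * bp_shift 2 \<gamma>
     + bp_const (- 1 / (2 * l)) * (bp_hbar ^ 2 + bp_const a) * bp_dbar (bp_shift 2 \<gamma>)"

text \<open>Linear extension from the basis: a traceless matrix \<open>A\<close> is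
  \<open>A\<^sub>1\<^sub>2 e + A\<^sub>1\<^sub>1 h + A\<^sub>2\<^sub>1 f\<close>.\<close>

definition Gam :: "complex \<Rightarrow> complex \<Rightarrow> complex \<Rightarrow> bipoly rep" where
  "Gam l a b =
     \<lparr>carrier = UNIV, monoid.mult = undefined, one = undefined,
      ring.zero = 0, add = (+), module.smult = (\<lambda>c \<gamma>. bp_const c * \<gamma>),
      act = (\<lambda>x \<gamma>.
          bp_const (fst x $ 1 $ 2) * Gam_e l \<gamma>
        + bp_const (fst x $ 1 $ 1) * (bp_h * \<gamma>)
        + bp_const (fst x $ 2 $ 1) * Gam_f l a b \<gamma>
        + bp_const (snd x $ 1 $ 2) * Gam_ebar l \<gamma>
        + bp_const (snd x $ 1 $ 1) * (bp_hbar * \<gamma>)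
        + bp_const (snd x $ 2 $ 1) * Gam_fbar l a \<gamma>)\<rparr>"

definition alpha_at :: "complex \<Rightarrow> int \<Rightarrow> complex" where
  "alpha_at \<alpha> k = \<alpha> + 2 * of_int k"

text \<open>The products \<open>(h - \<alpha>\<^sub>k)\<^sup>i (hbar - \<beta>)\<^sup>j\<close> form a basis, so \<open>eta \<alpha> \<beta> k s\<close> is well defined;
  it is meant for \<open>s \<ge> 1\<close>.\<close>

definition eta :: "complex \<Rightarrow> complex \<Rightarrow> int \<Rightarrow> nat \<Rightarrow> bipoly \<Rightarrow> complex" where
  "eta \<alpha> \<beta> k s = (THE \<phi>.
     (\<forall>p q. \<phi> (p + q) = \<phi> p + \<phi> q) \<and> (\<forall>c p. \<phi> (bp_const c * p) = c * \<phi> p) \<and>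
     (\<forall>i j. \<phi> ((bp_h - bp_const (alpha_at \<alpha> k)) ^ i * (bp_hbar - bp_const \<beta>) ^ j) =
        (if i = 0 \<and> j = s - 1 then fact (s - 1) else 0)))"

definition M_rep ::
    "complex \<Rightarrow> complex \<Rightarrow> complex \<Rightarrow> complex \<Rightarrow> complex \<Rightarrow> (bipoly \<Rightarrow> complex) rep" where
  "M_rep l \<alpha> \<beta> a b =
     restrict_rep (dual_rep (Gam l a b))
       (lin_span (dual_rep (Gam l a b)) {eta \<alpha> \<beta> k s | k s. s \<ge> 1})"

end

theory Submission
  imports Defs
begin

text \<open>
  The functional \<open>\<eta>\<close> with indices \<open>k\<close> and \<open>s\<close> takes the derivative of order \<open>i = s - 1\<close> in \<open>hbar\<close>
  at the point \<open>(\<alpha>\<^sub>k, \<beta>)\<close>; below it is called \<open>V k i\<close>. Transposing the formulas for \<open>\<Gamma>\<close>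
  (\<open>act_V\<close>) shows that, up to nonzero scalars, \<open>ebar\<close> sends \<open>V k i\<close> to \<open>V (k - 1) i\<close> and \<open>e\<close> sends
  it to \<open>V (k - 1) (i + 1)\<close>, that \<open>h + \<alpha>\<^sub>k\<close> kills it, and that \<open>hbar + \<beta>\<close> sends it to \<open>V k (i - 1)\<close>,
  or to 0 if \<open>i = 0\<close>.

  \<^bold>\<open>Simplicity.\<close> The operators \<open>h - \<mu>\<close> and \<open>hbar - \<mu>\<close> bring any nonzero vector of a submodule down
  to some \<open>V k 0\<close> (\<open>lowest_coordinate\<close>, which also gives the linear independence of the \<open>V k i\<close>).
  From there \<open>e\<close> and \<open>ebar\<close> reach every \<open>V j i\<close> with \<open>j + i \<le> k\<close>, so the submodule is everything as
  soon as one can climb from \<open>V k 0\<close> to \<open>V (k + 1) 0\<close> for all \<open>k\<close>. Now \<open>fbar\<close> climbs with coefficient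
  \<open>\<beta>\<^sup>2 + a\<close> and, when this vanishes, \<open>f\<close> climbs with coefficient \<open>(\<alpha>\<^sub>k + 2) \<beta> + b\<close>. If both vanish for
  \<open>k = K\<close>, the \<open>V j i\<close> with \<open>j + i \<le> K\<close> span a proper submodule \<open>W K\<close>.

  \<^bold>\<open>Verma modules.\<close> The vector \<open>V K 0\<close> is then a lowest weight vector generating \<open>W K\<close>, and
  \<open>e\<^sup>i ebar\<^sup>j\<close> takes it to a nonzero multiple of \<open>V (K - i - j) i\<close>. These images are linearly
  independent, whereas in the opposite Verma module the vectors \<open>e\<^sup>i ebar\<^sup>j \<otimes> 1\<close> span (\<open>all_spanned\<close>).
  Hence the canonical surjection from the Verma module is injective (\<open>is_opp_vermaI\<close>). Only the
  spanning half of the Poincare-Birkhoff-Witt theorem enters; independence is seen in \<open>W K\<close>.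
  In the weight space of index \<open>k\<close>, \<open>W K\<close> contains only the \<open>V k i\<close> with \<open>i \<le> K - k\<close>, which leaves
  infinitely many of them in the quotient.

  \<^bold>\<open>Isomorphisms.\<close> Multiplying \<open>V k i\<close> by \<open>(l / l')\<^sup>k\<close> changes the parameter \<open>l\<close> into \<open>l'\<close>
  (\<open>M_rep_scaling\<close>). Conversely, the eigenvalues of \<open>h\<close> and \<open>hbar\<close> determine \<open>\<alpha>\<close> modulo \<open>2\<int>\<close> and
  \<open>\<beta>\<close>, and two quadratic central elements act by \<open>- a\<close> and \<open>- b / 2\<close> (\<open>casimirs_D\<close>).
\<close>

section \<open>Words in the Lie algebra acting on modules\<close>

abbreviation keys :: "('a \<Rightarrow>\<^sub>0 'b::zero) \<Rightarrow> 'a set" where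
  "keys \<equiv> Poly_Mapping.keys"

abbreviation lookup :: "('a \<Rightarrow>\<^sub>0 'b::zero) \<Rightarrow> 'a \<Rightarrow> 'b" where
  "lookup \<equiv> Poly_Mapping.lookup"

text \<open>Membership in \<open>lists X\<close> is kept atomic: unfolding it to a statement about the letters, which
  are pairs of matrices, blocks the lemmas about words.\<close>

declare in_lists_conv_set [simp del] in_listsD [rule del] in_listsI [rule del]

lemma complex_field_simps [simp]:
  "carrier complex_field = UNIV" "x \<otimes>\<^bsub>complex_field\<^esub> y = x * y" "\<one>\<^bsub>complex_field\<^esub> = 1"
  "\<zero>\<^bsub>complex_field\<^esub> = 0" "x \<oplus>\<^bsub>complex_field\<^esub> y = x + y"
  by (simp_all add: complex_field_def)

lemma cring_complex_field: "cring complex_field"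
proof (intro cringI abelian_groupI comm_monoidI)
  fix x :: complex
  show "\<exists>y\<in>carrier complex_field. y \<oplus>\<^bsub>complex_field\<^esub> x = \<zero>\<^bsub>complex_field\<^esub>"
    by (rule bexI[of _ "- x"]) auto
qed (auto simp: algebra_simps)

lemma free_alg_simps [simp]:
  "p \<in> carrier (free_alg X) \<longleftrightarrow> keys p \<subseteq> lists X" "x \<otimes>\<^bsub>free_alg X\<^esub> y = x * y"
  "\<one>\<^bsub>free_alg X\<^esub> = 1" "\<zero>\<^bsub>free_alg X\<^esub> = 0" "x \<oplus>\<^bsub>free_alg X\<^esub> y = x + y"
  by (simp_all add: free_alg_def)

lemma free_elt_induct [consumes 1, case_names zero single add]:
  assumes "keys p \<subseteq> W"
    and zero: "P 0" and single: "\<And>w c. w \<in> W \<Longrightarrow> P (Poly_Mapping.single w c)"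
    and add: "\<And>p q. keys p \<subseteq> W \<Longrightarrow> keys q \<subseteq> W \<Longrightarrow> P p \<Longrightarrow> P q \<Longrightarrow> P (p + q)"
  shows "P (p :: 'a \<Rightarrow>\<^sub>0 complex)"
  using assms(1)
proof (induction "card (keys p)" arbitrary: p)
  case 0
  then show ?case using zero by simp
next
  case (Suc n)
  then obtain w where w: "w \<in> keys p" by fastforce
  define q where "q = p - Poly_Mapping.single w (lookup p w)"
  have k: "keys q = keys p - {w}"
    by (auto simp: q_def in_keys_iff lookup_minus lookup_single when_def split: if_splits)
  have "n = card (keys q)" "keys q \<subseteq> W"
    using Suc.hyps(2) Suc.prems k w by auto
  then have "P q" by (rule Suc.hyps(1))
  then have "P (q + Poly_Mapping.single w (lookup p w))"
    using Suc.prems w k by (intro add single) auto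
  then show ?case by (simp add: q_def)
qed

lemma keys_mult_subset_lists:
  assumes "keys p \<subseteq> lists X" "keys q \<subseteq> lists X"
  shows "keys (p * q :: free_elt) \<subseteq> lists X"
proof -
  have "keys (p * q) \<subseteq> {a + b | a b. a \<in> keys p \<and> b \<in> keys q}"
    by (rule keys_mult)
  also have "\<dots> \<subseteq> lists X" using assms by (auto simp: plus_list_def dest: subsetD)
  finally show ?thesis .
qed

lemma keys_add_subset:
  "keys p \<subseteq> W \<Longrightarrow> keys q \<subseteq> W \<Longrightarrow> keys (p + q :: 'a \<Rightarrow>\<^sub>0 complex) \<subseteq> W"
  by (meson Un_least keys_add order_trans)

lemma keys_diff_subset:
  "keys p \<subseteq> W \<Longrightarrow> keys q \<subseteq> W \<Longrightarrow> keys (p - q :: 'a \<Rightarrow>\<^sub>0 complex) \<subseteq> W"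
  by (meson Un_least keys_diff order_trans)

lemma keys_letter [simp]: "keys (letter x) = {[x]}"
  by (simp add: letter_def)

lemma keys_scalar_subset: "keys (scalar c) \<subseteq> lists X"
  by (simp add: scalar_def)

lemma one_eq_word: "(1 :: free_elt) = Poly_Mapping.single [] 1"
  by (metis single_one zero_list_def)

lemma keys_one_subset: "keys (1 :: free_elt) \<subseteq> lists X"
  by (simp add: one_eq_word)

lemmas keys_intros = keys_mult_subset_lists keys_add_subset keys_diff_subset keys_scalar_subset keys_one_subset

lemma single_mult_word: "Poly_Mapping.single w c * Poly_Mapping.single w' c' = (Poly_Mapping.single (w @ w') (c * c') :: free_elt)"
  by (simp add: mult_single plus_list_def)

lemma letter_mult_word: "letter x * Poly_Mapping.single w c = Poly_Mapping.single (x # w) c"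
  by (simp add: letter_def single_mult_word)

lemma scalar_mult_word: "scalar c * Poly_Mapping.single w d = Poly_Mapping.single w (c * d)"
  by (simp add: scalar_def single_mult_word)

lemma scalar_commute: "scalar c * p = p * scalar c"
proof -
  have "keys p \<subseteq> UNIV" by simp
  then show ?thesis
    by (induction p rule: free_elt_induct) (auto simp: scalar_def single_mult_word algebra_simps)
qed

lemma ring_free_alg: "ring (free_alg X)"
proof (intro ringI abelian_groupI monoidI)
  fix x assume "x \<in> carrier (free_alg X)"
  then show "\<exists>y\<in>carrier (free_alg X). y \<oplus>\<^bsub>free_alg X\<^esub> x = \<zero>\<^bsub>free_alg X\<^esub>"
    by (intro bexI[of _ "- x"]) auto
qed (simp_all only: free_alg_simps keys_intros keys_zero empty_subsetI algebra_simps mult_1_left mult_1_right add_0_left add_0_right)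

lemma free_alg_minus:
  assumes "p \<in> carrier (free_alg X)"
  shows "\<ominus>\<^bsub>free_alg X\<^esub> p = - p"
proof -
  interpret ring "free_alg X" by (rule ring_free_alg)
  show ?thesis using assms by (intro minus_equality) auto
qed

lemma takiff_scale_closed [simp]: "x \<in> takiff \<Longrightarrow> takiff_scale c x \<in> takiff"
  by (auto simp: takiff_def takiff_scale_def trace_def sum_distrib_left[symmetric] split_beta)

lemma takiff_add_closed [simp]: "x \<in> takiff \<Longrightarrow> y \<in> takiff \<Longrightarrow> x + y \<in> takiff"
  by (auto simp: takiff_def trace_add plus_prod_def)

lemma takiff_bracket_closed [simp]: "x \<in> takiff \<Longrightarrow> y \<in> takiff \<Longrightarrow> takiff_bracket x y \<in> takiff"
  by (simp add: takiff_def takiff_bracket_def comm_bracket_def trace_add trace_sub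
      trace_mul_sym[of "fst x"] trace_mul_sym[of "snd x"] split_beta)

context takiff_module
begin

lemma word_closed: "w \<in> lists takiff \<Longrightarrow> v \<in> carrier M \<Longrightarrow> foldr (act M) w v \<in> carrier M"
  by (induction w) (auto simp: act_closed)

lemma word_add: "w \<in> lists takiff \<Longrightarrow> v \<in> carrier M \<Longrightarrow> u \<in> carrier M \<Longrightarrow>
    foldr (act M) w (v \<oplus>\<^bsub>M\<^esub> u) = foldr (act M) w v \<oplus>\<^bsub>M\<^esub> foldr (act M) w u"
  by (induction w) (auto simp: act_add_right word_closed)

lemma word_scale: "w \<in> lists takiff \<Longrightarrow> v \<in> carrier M \<Longrightarrow>
    foldr (act M) w (c \<odot>\<^bsub>M\<^esub> v) = c \<odot>\<^bsub>M\<^esub> foldr (act M) w v"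
  by (induction w) (auto simp: act_scale_right word_closed)

lemma smult_closed' [simp]: "v \<in> carrier M \<Longrightarrow> c \<odot>\<^bsub>M\<^esub> v \<in> carrier M"
  by (rule smult_closed) auto

lemma smult_one' [simp]: "v \<in> carrier M \<Longrightarrow> 1 \<odot>\<^bsub>M\<^esub> v = v"
  using smult_one by simp

lemma smult_zero' [simp]: "v \<in> carrier M \<Longrightarrow> 0 \<odot>\<^bsub>M\<^esub> v = \<zero>\<^bsub>M\<^esub>"
  using smult_l_null by simp

lemma smult_assoc' : "v \<in> carrier M \<Longrightarrow> (c * d) \<odot>\<^bsub>M\<^esub> v = c \<odot>\<^bsub>M\<^esub> (d \<odot>\<^bsub>M\<^esub> v)"
  using smult_assoc1[of c d v] by simp

lemma smult_add': "v \<in> carrier M \<Longrightarrow> (c + d) \<odot>\<^bsub>M\<^esub> v = c \<odot>\<^bsub>M\<^esub> v \<oplus>\<^bsub>M\<^esub> d \<odot>\<^bsub>M\<^esub> v"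
  using smult_l_distr[of c d v] by simp

lemma smult_minus_one: "v \<in> carrier M \<Longrightarrow> (-1) \<odot>\<^bsub>M\<^esub> v = \<ominus>\<^bsub>M\<^esub> v"
  using smult_add'[of v "-1" 1] by (intro M.minus_equality[symmetric]) auto

lemma sum_minus_summands:
  assumes "u \<in> carrier M" "w \<in> carrier M"
  shows "(u \<oplus>\<^bsub>M\<^esub> w) \<ominus>\<^bsub>M\<^esub> u \<ominus>\<^bsub>M\<^esub> w = \<zero>\<^bsub>M\<^esub>"
proof -
  have "(u \<oplus>\<^bsub>M\<^esub> w) \<ominus>\<^bsub>M\<^esub> u \<ominus>\<^bsub>M\<^esub> w = (u \<oplus>\<^bsub>M\<^esub> w) \<oplus>\<^bsub>M\<^esub> (\<ominus>\<^bsub>M\<^esub> u \<oplus>\<^bsub>M\<^esub> \<ominus>\<^bsub>M\<^esub> w)"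
    using assms by (simp add: M.minus_eq M.a_assoc)
  then show ?thesis using assms by (simp add: M.r_neg flip: M.minus_add)
qed

lemma env_act_superset:
  assumes "finite A" "keys p \<subseteq> A" "A \<subseteq> lists takiff" "v \<in> carrier M"
  shows "env_act M p v = (\<Oplus>\<^bsub>M\<^esub>w\<in>A. lookup p w \<odot>\<^bsub>M\<^esub> foldr (act M) w v)"
  unfolding env_act_def using assms
  by (intro M.add.finprod_mono_neutral_cong_left) (auto simp: subsetD word_closed in_keys_iff)

lemma env_act_add:
  assumes "keys p \<subseteq> lists takiff" "keys q \<subseteq> lists takiff" "v \<in> carrier M"
  shows "env_act M (p + q) v = env_act M p v \<oplus>\<^bsub>M\<^esub> env_act M q v"
proof -
  let ?A = "keys p \<union> keys q"
  have A: "finite ?A" "?A \<subseteq> lists takiff" using assms by auto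
  have 1: "env_act M r v = (\<Oplus>\<^bsub>M\<^esub>w\<in>?A. lookup r w \<odot>\<^bsub>M\<^esub> foldr (act M) w v)"
    if "r \<in> {p, q, p + q}" for r
    using that A assms keys_add[of p q] by (intro env_act_superset) auto
  have "env_act M (p + q) v = (\<Oplus>\<^bsub>M\<^esub>w\<in>?A. lookup p w \<odot>\<^bsub>M\<^esub> foldr (act M) w v \<oplus>\<^bsub>M\<^esub> lookup q w \<odot>\<^bsub>M\<^esub> foldr (act M) w v)"
    unfolding 1[of "p + q", simplified] using A assms
    by (intro M.finsum_cong') (auto simp: subsetD word_closed lookup_add smult_add')
  also have "\<dots> = env_act M p v \<oplus>\<^bsub>M\<^esub> env_act M q v"
    unfolding 1[of p, simplified] 1[of q, simplified] using A assms
    by (intro M.finsum_addf) (auto simp: subsetD word_closed)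
  finally show ?thesis .
qed

lemma env_act_single [simp]:
  assumes "w \<in> lists takiff" "v \<in> carrier M"
  shows "env_act M (Poly_Mapping.single w c) v = c \<odot>\<^bsub>M\<^esub> foldr (act M) w v"
  using env_act_superset[of "{w}" "Poly_Mapping.single w c" v] assms
  by (simp add: word_closed)

lemma env_act_zero [simp]: "env_act M 0 v = \<zero>\<^bsub>M\<^esub>"
  by (simp add: env_act_def)

lemma env_act_closed:
  assumes "keys p \<subseteq> lists takiff" "v \<in> carrier M"
  shows "env_act M p v \<in> carrier M"
  unfolding env_act_def using assms by (intro M.finsum_closed) (auto simp: subsetD word_closed)

lemma env_act_add_right:
  assumes "keys p \<subseteq> lists takiff" "v \<in> carrier M" "u \<in> carrier M"
  shows "env_act M p (v \<oplus>\<^bsub>M\<^esub> u) = env_act M p v \<oplus>\<^bsub>M\<^esub> env_act M p u"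
proof -
  have "env_act M p (v \<oplus>\<^bsub>M\<^esub> u) = (\<Oplus>\<^bsub>M\<^esub>w\<in>keys p. lookup p w \<odot>\<^bsub>M\<^esub> foldr (act M) w v
      \<oplus>\<^bsub>M\<^esub> lookup p w \<odot>\<^bsub>M\<^esub> foldr (act M) w u)"
    unfolding env_act_def using assms
    by (intro M.finsum_cong') (auto simp: subsetD word_closed word_add smult_r_distr)
  also have "\<dots> = env_act M p v \<oplus>\<^bsub>M\<^esub> env_act M p u"
    unfolding env_act_def using assms
    by (intro M.finsum_addf) (auto simp: subsetD word_closed)
  finally show ?thesis .
qed

lemma env_act_mult:
  assumes "keys p \<subseteq> lists takiff" "keys q \<subseteq> lists takiff" "v \<in> carrier M"
  shows "env_act M (p * q) v = env_act M p (env_act M q v)"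
  using assms(1)
proof (induction p rule: free_elt_induct)
  case (single w c)
  show ?case using assms(2)
  proof (induction q rule: free_elt_induct)
    case (single w' c')
    then show ?case using \<open>w \<in> lists takiff\<close> assms(3)
      by (simp add: single_mult_word word_closed word_scale smult_assoc')
  next
    case zero
    have "foldr (act M) w (0 \<odot>\<^bsub>M\<^esub> \<zero>\<^bsub>M\<^esub>) = 0 \<odot>\<^bsub>M\<^esub> foldr (act M) w \<zero>\<^bsub>M\<^esub>"
      using \<open>w \<in> lists takiff\<close> by (intro word_scale) auto
    then have "foldr (act M) w \<zero>\<^bsub>M\<^esub> = \<zero>\<^bsub>M\<^esub>"
      using \<open>w \<in> lists takiff\<close> by (simp add: word_closed)
    then show ?case using \<open>w \<in> lists takiff\<close> assms(3) smult_r_null by simp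
  next
    case (add p q)
    then show ?case using \<open>w \<in> lists takiff\<close> assms(3)
      by (subst distrib_left, subst env_act_add)
         (auto simp: keys_intros env_act_add env_act_closed word_add word_closed smult_r_distr
           intro!: keys_mult_subset_lists)
  qed
next
  case zero
  then show ?case by simp
next
  case (add p p')
  then show ?case using assms
    by (simp add: distrib_right env_act_add keys_intros env_act_closed)
qed

lemma env_act_letter [simp]: "x \<in> takiff \<Longrightarrow> v \<in> carrier M \<Longrightarrow> env_act M (letter x) v = act M x v"
  by (simp add: letter_def act_closed)

lemma env_act_scalar [simp]: "v \<in> carrier M \<Longrightarrow> env_act M (scalar c) v = c \<odot>\<^bsub>M\<^esub> v"
  by (simp add: scalar_def)

lemma env_act_diff:
  assumes "keys p \<subseteq> lists takiff" "keys q \<subseteq> lists takiff" "v \<in> carrier M"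
  shows "env_act M (p - q) v = env_act M p v \<ominus>\<^bsub>M\<^esub> env_act M q v"
proof -
  have "env_act M (p - q) v \<oplus>\<^bsub>M\<^esub> env_act M q v = env_act M p v"
    using env_act_add[of "p - q" q v] assms by (simp add: keys_intros)
  then show ?thesis using assms
    by (metis M.add.inv_solve_right M.minus_eq env_act_closed keys_diff_subset)
qed

lemma submodule_env_act_closed:
  assumes "takiff_submodule H M" "keys p \<subseteq> lists takiff" "v \<in> H"
  shows "env_act M p v \<in> H"
proof -
  have H: "submodule H complex_field M" using assms by (simp add: takiff_submodule_def)
  note HE = submoduleE[OF H]
  have "foldr (act M) w v \<in> H" if "w \<in> lists takiff" for w
    using that assms by (induction w) (auto simp: takiff_submodule_def)
  then have s: "c \<odot>\<^bsub>M\<^esub> foldr (act M) w v \<in> H" if "w \<in> lists takiff" for c w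
    using HE(4)[of c] that by simp
  have v: "v \<in> carrier M" using HE(1) assms by auto
  show ?thesis using assms(2)
  proof (induction p rule: free_elt_induct)
    case zero
    have "0 \<odot>\<^bsub>M\<^esub> v \<in> H" using s[of "[]" 0] by simp
    then show ?case using v by simp
  next
    case (single w c) then show ?case using s v by simp
  next
    case (add p q) then show ?case using v HE(5) by (simp add: env_act_add)
  qed
qed

text \<open>This and the next lemma make computations in the enveloping algebra unnecessary: to identify
  \<open>U(g)v\<close>, exhibit a submodule containing \<open>v\<close> and reach a spanning set of it from \<open>v\<close>.\<close>

lemma env_orbit_least:
  assumes "takiff_submodule H M" "v \<in> H"
  shows "env_orbit M v \<subseteq> H"
  using submodule_env_act_closed[OF assms(1)] assms(2) by (auto simp: env_orbit_def)

lemma env_orbit_submodule: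
  assumes v: "v \<in> carrier M"
  shows "takiff_submodule (env_orbit M v) M" "v \<in> env_orbit M v"
proof -
  have I: "u \<in> env_orbit M v" if "u = env_act M p v" "keys p \<subseteq> lists takiff" for u p
    using that by (auto simp: env_orbit_def)
  show "v \<in> env_orbit M v"
    using v by (intro I[of _ 1]) (auto simp: one_eq_word simp del: single_one)
  have sc: "c \<odot>\<^bsub>M\<^esub> u \<in> env_orbit M v" if u: "u \<in> env_orbit M v" for c u
  proof -
    obtain p where p: "u = env_act M p v" "keys p \<subseteq> lists takiff"
      using u by (auto simp: env_orbit_def)
    show ?thesis using p v
      by (intro I[of _ "scalar c * p"]) (auto simp: env_act_mult env_act_closed keys_intros)
  qed
  have sub: "env_orbit M v \<subseteq> carrier M" using v by (auto simp: env_orbit_def env_act_closed)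
  have "submodule (env_orbit M v) complex_field M"
  proof (rule submoduleI)
    show "\<zero>\<^bsub>M\<^esub> \<in> env_orbit M v" by (intro I[of _ 0]) auto
    show "\<ominus>\<^bsub>M\<^esub> u \<in> env_orbit M v" if "u \<in> env_orbit M v" for u
      using sc[OF that, of "-1"] sub that by (auto simp: smult_minus_one)
    fix u u' assume "u \<in> env_orbit M v" "u' \<in> env_orbit M v"
    then obtain p p' where "u = env_act M p v" "keys p \<subseteq> lists takiff"
      "u' = env_act M p' v" "keys p' \<subseteq> lists takiff" by (auto simp: env_orbit_def)
    then show "u \<oplus>\<^bsub>M\<^esub> u' \<in> env_orbit M v"
      using v by (intro I[of _ "p + p'"]) (simp_all add: env_act_add keys_add_subset)
  qed (use sub sc in auto)
  moreover have "act M x u \<in> env_orbit M v" if x: "x \<in> takiff" and u: "u \<in> env_orbit M v" for x u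
  proof -
    obtain p where p: "u = env_act M p v" "keys p \<subseteq> lists takiff"
      using u by (auto simp: env_orbit_def)
    have "keys (letter x) \<subseteq> lists takiff" using x by simp
    then show ?thesis using p v x
      by (intro I[of _ "letter x * p"])
         (simp_all add: env_act_mult env_act_closed keys_mult_subset_lists del: keys_letter)
  qed
  ultimately show "takiff_submodule (env_orbit M v) M" by (auto simp: takiff_submodule_def)
qed

text \<open>Being two-sided, the annihilator contains the ideal defining \<open>U(g)\<close> as soon as it
  contains the defining relations; so an element of \<open>U(g)\<close> may act through any representative.\<close>

lemma ideal_annihilator:
  "ideal {p. keys p \<subseteq> lists takiff \<and> (\<forall>v\<in>carrier M. env_act M p v = \<zero>\<^bsub>M\<^esub>)} (free_alg takiff)"
  (is "ideal ?J _")
proof (rule idealI)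
  interpret F: ring "free_alg takiff" by (rule ring_free_alg)
  show "ring (free_alg takiff)" by (rule ring_free_alg)
  show "subgroup ?J (add_monoid (free_alg takiff))"
  proof (rule F.add.subgroupI)
    show "?J \<noteq> {}" by (auto intro!: exI[of _ 0])
    fix p assume p: "p \<in> ?J"
    have "env_act M (- p) v = \<zero>\<^bsub>M\<^esub>" if "v \<in> carrier M" for v
      using env_act_diff[of 0 p v] p that by (simp add: M.minus_eq)
    then show "\<ominus>\<^bsub>free_alg takiff\<^esub> p \<in> ?J" using p by (simp add: free_alg_minus)
  qed (auto simp: env_act_add keys_intros intro: subsetD[OF keys_add_subset])
  fix p x assume p: "p \<in> ?J" and x: "x \<in> carrier (free_alg takiff)"
  have z: "env_act M x \<zero>\<^bsub>M\<^esub> = \<zero>\<^bsub>M\<^esub>"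
    using env_act_add_right[of x "\<zero>\<^bsub>M\<^esub>" "\<zero>\<^bsub>M\<^esub>"] x env_act_closed[of x "\<zero>\<^bsub>M\<^esub>"] by simp
  show "x \<otimes>\<^bsub>free_alg takiff\<^esub> p \<in> ?J" "p \<otimes>\<^bsub>free_alg takiff\<^esub> x \<in> ?J"
    using p x z by (auto simp: env_act_mult env_act_closed keys_mult_subset_lists simp del: free_alg_simps(1)
       dest: subsetD[OF keys_mult_subset_lists]) (auto simp: env_act_mult env_act_closed  dest: subsetD[OF keys_mult_subset_lists])
qed

end

abbreviation env_rels :: "free_elt set" where
  "env_rels \<equiv> {letter (x + y) - letter x - letter y | x y. x \<in> takiff \<and> y \<in> takiff} \<union>
     {letter (takiff_scale c x) - scalar c * letter x | c x. x \<in> takiff} \<union>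
     {letter x * letter y - letter y * letter x - letter (takiff_bracket x y)
        | x y. x \<in> takiff \<and> y \<in> takiff}"

lemma keys_letter_subset: "x \<in> takiff \<Longrightarrow> keys (letter x) \<subseteq> lists takiff"
  by simp

lemma env_rels_subset: "env_rels \<subseteq> carrier (free_alg takiff)"
  unfolding Un_subset_iff
  by (intro conjI subsetI; elim CollectE exE conjE)
     (simp_all del: keys_letter add: keys_intros keys_letter_subset)

lemma env_ideal_ideal: "ideal env_ideal (free_alg takiff)"
proof -
  interpret F: ring "free_alg takiff" by (rule ring_free_alg)
  show ?thesis unfolding env_ideal_def by (rule F.genideal_ideal[OF env_rels_subset])
qed

lemma env_ideal_rels: "env_rels \<subseteq> env_ideal"
proof -
  interpret F: ring "free_alg takiff" by (rule ring_free_alg)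
  show ?thesis unfolding env_ideal_def by (rule F.genideal_self[OF env_rels_subset])
qed

lemma (in takiff_module) env_act_ideal:
  assumes "p \<in> env_ideal" "v \<in> carrier M"
  shows "env_act M p v = \<zero>\<^bsub>M\<^esub>"
proof -
  interpret F: ring "free_alg takiff" by (rule ring_free_alg)
  have "env_ideal \<subseteq> {p. keys p \<subseteq> lists takiff \<and> (\<forall>v\<in>carrier M. env_act M p v = \<zero>\<^bsub>M\<^esub>)}"
    unfolding env_ideal_def
  proof (rule F.genideal_minimal[OF ideal_annihilator], rule subsetI)
    fix p assume p: "p \<in> env_rels"
    have "keys p \<subseteq> lists takiff"
      using subsetD[OF env_rels_subset p] by (simp only: free_alg_simps)
    moreover have "env_act M p v = \<zero>\<^bsub>M\<^esub>" if v: "v \<in> carrier M" for v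
      using p
    proof (elim UnE CollectE exE conjE)
      fix x y assume x: "p = letter (x + y) - letter x - letter y" "x \<in> takiff" "y \<in> takiff"
      show ?thesis unfolding x(1) using x(2,3) v
        by (simp del: keys_letter add: keys_intros keys_letter_subset env_act_diff act_add_left
            act_closed sum_minus_summands)
    next
      fix c x assume x: "p = letter (takiff_scale c x) - scalar c * letter x" "x \<in> takiff"
      show ?thesis unfolding x(1) using x(2) v
        by (simp del: keys_letter add: keys_intros keys_letter_subset env_act_diff env_act_mult
            act_scale_left act_closed M.minus_eq M.r_neg)
    next
      fix x y assume x: "p = letter x * letter y - letter y * letter x - letter (takiff_bracket x y)"
         "x \<in> takiff" "y \<in> takiff"
      show ?thesis unfolding x(1) using x(2,3) v
        by (simp del: keys_letter add: keys_intros keys_letter_subset env_act_diff env_act_mult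
            act_bracket act_closed M.minus_eq M.r_neg)
    qed
    ultimately show "p \<in> {p. keys p \<subseteq> lists takiff \<and> (\<forall>v\<in>carrier M. env_act M p v = \<zero>\<^bsub>M\<^esub>)}"
      by simp
  qed
  then show ?thesis using assms by auto
qed

section \<open>Submodules and quotients\<close>

context takiff_module
begin

lemma takiff_submoduleI:
  assumes "H \<subseteq> carrier M" "\<zero>\<^bsub>M\<^esub> \<in> H"
    and "\<And>u v. u \<in> H \<Longrightarrow> v \<in> H \<Longrightarrow> u \<oplus>\<^bsub>M\<^esub> v \<in> H"
    and smult: "\<And>c v. v \<in> H \<Longrightarrow> c \<odot>\<^bsub>M\<^esub> v \<in> H"
    and "\<And>x v. x \<in> takiff \<Longrightarrow> v \<in> H \<Longrightarrow> act M x v \<in> H"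
  shows "takiff_submodule H M"
proof -
  have "\<ominus>\<^bsub>M\<^esub> v \<in> H" if "v \<in> H" for v
    using smult[OF that, of "-1"] that assms(1) by (auto simp: smult_minus_one)
  then show ?thesis using assms unfolding takiff_submodule_def by (auto intro!: submoduleI)
qed

lemma takiff_submoduleD:
  assumes "takiff_submodule H M"
  shows "H \<subseteq> carrier M" "\<zero>\<^bsub>M\<^esub> \<in> H" "u \<in> H \<Longrightarrow> v \<in> H \<Longrightarrow> u \<oplus>\<^bsub>M\<^esub> v \<in> H"
    "u \<in> H \<Longrightarrow> c \<odot>\<^bsub>M\<^esub> u \<in> H" "u \<in> H \<Longrightarrow> \<ominus>\<^bsub>M\<^esub> u \<in> H"
    "x \<in> takiff \<Longrightarrow> u \<in> H \<Longrightarrow> act M x u \<in> H"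
proof -
  have H: "submodule H complex_field M" using assms by (simp add: takiff_submodule_def)
  interpret S: submodule H complex_field M by (rule H)
  note HE = submoduleE[OF H]
  show "H \<subseteq> carrier M" by (rule HE(1))
  show "\<zero>\<^bsub>M\<^esub> \<in> H" using S.one_closed by simp
  show "u \<in> H \<Longrightarrow> v \<in> H \<Longrightarrow> u \<oplus>\<^bsub>M\<^esub> v \<in> H" by (rule HE(5))
  show "u \<in> H \<Longrightarrow> c \<odot>\<^bsub>M\<^esub> u \<in> H" by (rule HE(4)) simp_all
  show "u \<in> H \<Longrightarrow> \<ominus>\<^bsub>M\<^esub> u \<in> H" by (rule HE(3))
  show "x \<in> takiff \<Longrightarrow> u \<in> H \<Longrightarrow> act M x u \<in> H" using assms by (simp add: takiff_submodule_def)
qed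

lemma subgroup_of_takiff_submodule:
  "takiff_submodule H M \<Longrightarrow> subgroup H (add_monoid M)"
  by (simp add: takiff_submodule_def submodule_def)

end

lemma restrict_rep_simps [simp]:
  "carrier (restrict_rep M H) = H" "u \<oplus>\<^bsub>restrict_rep M H\<^esub> v = u \<oplus>\<^bsub>M\<^esub> v"
  "c \<odot>\<^bsub>restrict_rep M H\<^esub> v = c \<odot>\<^bsub>M\<^esub> v" "\<zero>\<^bsub>restrict_rep M H\<^esub> = \<zero>\<^bsub>M\<^esub>" "act (restrict_rep M H) = act M"
  by (simp_all add: restrict_rep_def)

lemma quotient_rep_simps [simp]:
  "carrier (quotient_rep M H) = a_rcosets\<^bsub>M\<^esub> H" "K \<oplus>\<^bsub>quotient_rep M H\<^esub> L = K <+>\<^bsub>M\<^esub> L"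
  "\<zero>\<^bsub>quotient_rep M H\<^esub> = H"
  by (simp_all add: quotient_rep_def)

lemma module_restrict:
  assumes "takiff_module M" "takiff_submodule H M"
  shows "module complex_field (restrict_rep M H)"
proof -
  interpret takiff_module M by fact
  interpret S: submodule H complex_field M using assms by (simp add: takiff_submodule_def)
  have "module complex_field (M\<lparr>carrier := H\<rparr>)"
    by (rule S.submodule_is_module) (rule module_axioms)
  then show ?thesis by (simp add: restrict_rep_def)
qed

lemma a_minus_restrict:
  assumes "takiff_module M" "takiff_submodule H M" "u \<in> H" "v \<in> H"
  shows "u \<ominus>\<^bsub>restrict_rep M H\<^esub> v = u \<ominus>\<^bsub>M\<^esub> v"
proof -
  interpret takiff_module M by fact
  interpret R: module complex_field "restrict_rep M H" by (rule module_restrict[OF assms(1,2)])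
  note HD = takiff_submoduleD[OF assms(2)]
  have "\<ominus>\<^bsub>restrict_rep M H\<^esub> v = \<ominus>\<^bsub>M\<^esub> v"
    using HD assms(4) by (intro R.minus_equality) (auto intro!: M.l_neg)
  then show ?thesis by (simp add: a_minus_def)
qed

lemma takiff_module_restrict:
  assumes M: "takiff_module M" and H: "takiff_submodule H M"
  shows "takiff_module (restrict_rep M H)"
proof -
  interpret takiff_module M by fact
  note HD = takiff_submoduleD[OF H]
  have c: "u \<in> H \<Longrightarrow> u \<in> carrier M" for u using HD(1) by auto
  have "takiff_module_axioms (restrict_rep M H)"
    unfolding takiff_module_axioms_def
    using HD c a_minus_restrict[OF M H]
    by (simp add: act_add_left act_scale_left act_add_right act_scale_right act_bracket)
  with module_restrict[OF assms] show ?thesis by (rule takiff_module.intro)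
qed

locale takiff_quotient = takiff_module M for M :: "'v rep" (structure) +
  fixes H assumes H: "takiff_submodule H M"
begin

sublocale Q: abelian_subgroup H M
  by (rule abelian_subgroupI3[OF additive_subgroupI[OF subgroup_of_takiff_submodule[OF H]]])
    (rule M.abelian_group_axioms)

lemma coset_eq_iff:
  assumes "u \<in> carrier M" "v \<in> carrier M"
  shows "H +> u = H +> v \<longleftrightarrow> u \<ominus> v \<in> H"
proof
  assume "H +> u = H +> v"
  then have "u \<in> H +> v" using Q.a_rcos_self[OF assms(1)] by simp
  then obtain h where "h \<in> H" "u = h \<oplus> v" by (auto simp: a_r_coset_def')
  then show "u \<ominus> v \<in> H" using assms Q.a_Hcarr
    by (simp add: M.minus_eq M.a_assoc M.r_neg)
next
  assume h: "u \<ominus> v \<in> H"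
  have "(u \<ominus> v) \<oplus> v \<in> H +> v" using h assms by (intro M.a_rcosI) (auto intro: Q.a_Hcarr)
  then have "u \<in> H +> v" using assms by (simp add: M.minus_eq M.a_assoc M.l_neg)
  then show "H +> u = H +> v"
    using M.a_repr_independence[of u H v] assms Q.a_subgroup by simp
qed

text \<open>With this the indexed unions in the definition of the quotient collapse to single cosets.\<close>

lemma induced_on_cosets:
  assumes "v \<in> carrier M" "\<And>u. u \<in> carrier M \<Longrightarrow> g u \<in> carrier M" "\<And>u. u \<in> H \<Longrightarrow> g u \<in> H"
    and "\<And>u w. u \<in> carrier M \<Longrightarrow> w \<in> carrier M \<Longrightarrow> g (u \<oplus> w) = g u \<oplus> g w"
  shows "(\<Union>u\<in>H +> v. H +> g u) = H +> g v"
proof -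
  have "H +> g u = H +> g v" if u: "u \<in> H +> v" for u
  proof -
    obtain h where h: "h \<in> H" "u = h \<oplus> v" using u by (auto simp: a_r_coset_def')
    have hc: "h \<in> carrier M" using h Q.a_Hcarr by blast
    have "g u \<ominus> g v = g h" using h hc assms by (simp add: M.minus_eq M.a_assoc M.r_neg)
    then show ?thesis using h hc assms by (subst coset_eq_iff) simp_all
  qed
  moreover have "v \<in> H +> v" by (rule Q.a_rcos_self[OF assms(1)])
  ultimately show ?thesis by blast
qed

lemma quotient_smult:
  "v \<in> carrier M \<Longrightarrow> c \<odot>\<^bsub>quotient_rep M H\<^esub> (H +> v) = H +> (c \<odot> v)"
  using takiff_submoduleD[OF H] smult_r_distr
  by (simp add: quotient_rep_def induced_on_cosets)

lemma quotient_act: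
  "v \<in> carrier M \<Longrightarrow> x \<in> takiff \<Longrightarrow> act (quotient_rep M H) x (H +> v) = H +> act M x v"
  using takiff_submoduleD[OF H]
  by (simp add: quotient_rep_def induced_on_cosets act_closed act_add_right)

lemma quotient_add:
  "v \<in> carrier M \<Longrightarrow> u \<in> carrier M \<Longrightarrow> (H +> u) \<oplus>\<^bsub>quotient_rep M H\<^esub> (H +> v) = H +> (u \<oplus> v)"
  by (simp add: Q.a_rcos_sum)

lemma quotient_carrier: "K \<in> carrier (quotient_rep M H) \<longleftrightarrow> (\<exists>v\<in>carrier M. K = H +> v)"
  by (auto simp: A_RCOSETS_def')

lemma quotient_carrierI: "v \<in> carrier M \<Longrightarrow> H +> v \<in> carrier (quotient_rep M H)"
  using quotient_carrier by blast

lemma quotient_cases [consumes 1, case_names coset]: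
  assumes "K \<in> carrier (quotient_rep M H)"
  obtains v where "v \<in> carrier M" "K = H +> v"
  using assms quotient_carrier by blast

lemma quotient_zero: "\<zero>\<^bsub>quotient_rep M H\<^esub> = H +> \<zero>"
  using takiff_submoduleD(1)[OF H] by simp

lemma abelian_group_quotient: "abelian_group (quotient_rep M H)"
proof (rule abelian_groupI)
  note [simp del] = quotient_rep_simps
  fix K assume "K \<in> carrier (quotient_rep M H)"
  then show "\<exists>L\<in>carrier (quotient_rep M H). L \<oplus>\<^bsub>quotient_rep M H\<^esub> K = \<zero>\<^bsub>quotient_rep M H\<^esub>"
  proof (cases rule: quotient_cases)
    case (coset v)
    then show ?thesis
      by (intro bexI[of _ "H +> (\<ominus> v)"])
         (simp_all add: quotient_add quotient_zero quotient_carrierI M.l_neg)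
  qed
qed (auto elim!: quotient_cases simp: quotient_add quotient_zero quotient_carrierI M.add.m_ac
       simp del: quotient_rep_simps)

lemma quotient_minus:
  assumes "v \<in> carrier M" "u \<in> carrier M"
  shows "(H +> u) \<ominus>\<^bsub>quotient_rep M H\<^esub> (H +> v) = H +> (u \<ominus> v)"
proof -
  interpret A: abelian_group "quotient_rep M H" by (rule abelian_group_quotient)
  have "(H +> (\<ominus> v)) \<oplus>\<^bsub>quotient_rep M H\<^esub> (H +> v) = \<zero>\<^bsub>quotient_rep M H\<^esub>"
    using assms by (simp add: quotient_add quotient_zero M.l_neg del: quotient_rep_simps)
  then have "\<ominus>\<^bsub>quotient_rep M H\<^esub> (H +> v) = H +> (\<ominus> v)"
    using assms by (intro A.minus_equality quotient_carrierI) (simp_all del: quotient_rep_simps)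
  then show ?thesis using assms
    by (simp add: A.minus_eq M.minus_eq quotient_add del: quotient_rep_simps)
qed

lemma takiff_module_quotient: "takiff_module (quotient_rep M H)"
proof (rule takiff_module.intro)
  note q = quotient_smult quotient_act quotient_add quotient_minus quotient_carrierI
  note [simp del] = quotient_rep_simps
  show "module complex_field (quotient_rep M H)"
    using smult_r_distr
    by (intro moduleI cring_complex_field abelian_group_quotient)
       (auto simp: q smult_assoc' smult_add' elim!: quotient_cases)
  show "takiff_module_axioms (quotient_rep M H)"
    unfolding takiff_module_axioms_def
    by (intro conjI allI impI; elim quotient_cases)
       (simp_all only: q act_closed act_add_left act_scale_left act_add_right
         act_scale_right act_bracket takiff_add_closed takiff_scale_closed
         takiff_bracket_closed M.add.m_closed smult_closed' M.minus_closed)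
qed

end

section \<open>Lowest weight vectors and opposite Verma modules\<close>

definition tk_e :: takiff_elt where "tk_e = (mat_e, 0)"
definition tk_f :: takiff_elt where "tk_f = (mat_f, 0)"
definition tk_ebar :: takiff_elt where "tk_ebar = (0, mat_e)"
definition tk_fbar :: takiff_elt where "tk_fbar = (0, mat_f)"

lemma mat_basis_entries [simp]:
  "mat_e $ 1 $ 1 = 0" "mat_e $ 1 $ 2 = 1" "mat_e $ 2 $ 1 = 0" "mat_e $ 2 $ 2 = 0"
  "mat_h $ 1 $ 1 = 1" "mat_h $ 1 $ 2 = 0" "mat_h $ 2 $ 1 = 0" "mat_h $ 2 $ 2 = -1"
  "mat_f $ 1 $ 1 = 0" "mat_f $ 1 $ 2 = 0" "mat_f $ 2 $ 1 = 1" "mat_f $ 2 $ 2 = 0"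
  by (simp_all add: mat_e_def mat_h_def mat_f_def vector_2)

lemma tk_in_takiff [simp]:
  "tk_e \<in> takiff" "tk_f \<in> takiff" "tk_h \<in> takiff"
  "tk_ebar \<in> takiff" "tk_fbar \<in> takiff" "tk_hbar \<in> takiff"
  by (simp_all add: takiff_def tk_e_def tk_f_def tk_h_def tk_ebar_def tk_fbar_def tk_hbar_def
      trace_def UNIV_2)

lemma borel_minus_subset: "borel_minus \<subseteq> takiff"
  by (auto simp: borel_minus_def)

definition borel_weight :: "complex \<times> complex \<Rightarrow> takiff_elt \<Rightarrow> complex" where
  "borel_weight \<mu> x = fst x $ 1 $ 1 * fst \<mu> + snd x $ 1 $ 1 * snd \<mu>"

lemma takiff_decompose:
  assumes "x \<in> takiff"
  obtains y c d where "y \<in> borel_minus" "x = y + (takiff_scale c tk_e + takiff_scale d tk_ebar)"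
proof
  let ?y = "x + (takiff_scale (- fst x $ 1 $ 2) tk_e + takiff_scale (- snd x $ 1 $ 2) tk_ebar)"
  show "x = ?y + (takiff_scale (fst x $ 1 $ 2) tk_e + takiff_scale (snd x $ 1 $ 2) tk_ebar)"
    by (simp add: prod_eq_iff vec_eq_iff takiff_scale_def tk_e_def tk_ebar_def)
  show "?y \<in> borel_minus"
    using assms by (simp add: borel_minus_def)
       (simp add: takiff_scale_def tk_e_def tk_ebar_def)
qed

lemma bracket_ebar_e: "takiff_bracket tk_ebar tk_e = 0"
  by (simp add: takiff_bracket_def comm_bracket_def tk_e_def tk_ebar_def zero_prod_def)

definition normal_words :: "takiff_elt list set" where
  "normal_words = {replicate i tk_e @ replicate j tk_ebar | i j. True}"

lemma normal_wordsI: "replicate i tk_e @ replicate j tk_ebar \<in> normal_words"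
  by (auto simp: normal_words_def)

lemma normal_words_subset: "normal_words \<subseteq> lists takiff"
  by (auto simp: normal_words_def replicate_in_lists)

text \<open>An abstract stand-in for the left ideal of all \<open>p\<close> with \<open>p \<otimes> 1 = 0\<close> in the opposite Verma
  module. Its closure properties allow the reduction to the words \<open>e\<^sup>i ebar\<^sup>j\<close> to be carried out in
  the free algebra instead of a quotient.\<close>

locale lowest_weight_ideal =
  fixes \<mu> :: "complex \<times> complex" and L :: "free_elt set"
  assumes L_sub: "p \<in> L \<Longrightarrow> keys p \<subseteq> lists takiff"
    and L_add: "p \<in> L \<Longrightarrow> q \<in> L \<Longrightarrow> p + q \<in> L"
    and L_left: "p \<in> L \<Longrightarrow> keys q \<subseteq> lists takiff \<Longrightarrow> q * p \<in> L"
    and L_env: "env_ideal \<subseteq> L"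
    and L_weight: "x \<in> borel_minus \<Longrightarrow> letter x - scalar (borel_weight \<mu> x) \<in> L"
begin

definition spanned :: "free_elt set" where
  "spanned = {p. \<exists>n. keys n \<subseteq> normal_words \<and> p - n \<in> L}"

lemma zero_in_L: "0 \<in> L"
proof -
  interpret ideal env_ideal "free_alg takiff" by (rule env_ideal_ideal)
  show ?thesis using L_env additive_subgroup.zero_closed[OF is_additive_subgroup] by auto
qed

lemma env_rel_mult:
  assumes "r \<in> env_rels" "keys p \<subseteq> lists takiff"
  shows "r * p \<in> L"
proof -
  interpret ideal env_ideal "free_alg takiff" by (rule env_ideal_ideal)
  have "r * p \<in> env_ideal"
    using I_r_closed[OF subsetD[OF env_ideal_rels assms(1)], of p] assms(2) by simp
  then show ?thesis using L_env by auto
qed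

lemma spanned_add: "p \<in> spanned \<Longrightarrow> q \<in> spanned \<Longrightarrow> p + q \<in> spanned"
proof -
  assume "p \<in> spanned" "q \<in> spanned"
  then obtain n m where *: "keys n \<subseteq> normal_words" "p - n \<in> L"
      "keys m \<subseteq> normal_words" "q - m \<in> L"
    by (auto simp: spanned_def)
  have "p + q - (n + m) \<in> L" using L_add[OF *(2,4)] by (simp add: algebra_simps)
  then show "p + q \<in> spanned"
    using keys_add_subset[OF *(1,3)] unfolding spanned_def by blast
qed

lemma spanned_cong: "p \<in> spanned \<Longrightarrow> q - p \<in> L \<Longrightarrow> q \<in> spanned"
  using L_add[of "q - p"] by (fastforce simp: spanned_def)

lemma spanned_normal: "keys n \<subseteq> normal_words \<Longrightarrow> n \<in> spanned"
  using zero_in_L by (auto simp: spanned_def intro!: exI[of _ n])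

lemma spanned_L: "p \<in> L \<Longrightarrow> p \<in> spanned"
  by (auto simp: spanned_def intro!: exI[of _ 0])

lemma spanned_mult:
  assumes q: "keys q \<subseteq> lists takiff"
    and w: "\<And>w c. w \<in> normal_words \<Longrightarrow> q * Poly_Mapping.single w c \<in> spanned"
    and p: "p \<in> spanned"
  shows "q * p \<in> spanned"
proof -
  obtain n where n: "keys n \<subseteq> normal_words" "p - n \<in> L"
    using p by (auto simp: spanned_def)
  have "q * n \<in> spanned" using n(1)
  proof (induction n rule: free_elt_induct)
    case zero show ?case by (simp add: spanned_L zero_in_L)
  next
    case (add p q) then show ?case by (simp add: distrib_left spanned_add)
  qed (rule w)
  moreover have "q * p - q * n \<in> L" using L_left[OF n(2) q] by (simp add: algebra_simps)
  ultimately show ?thesis by (rule spanned_cong)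
qed

lemma spanned_scalar: "p \<in> spanned \<Longrightarrow> scalar c * p \<in> spanned"
  by (rule spanned_mult)
    (auto simp: keys_scalar_subset scalar_mult_word intro!: spanned_normal split: if_splits)

lemma letter_zero: "keys p \<subseteq> lists takiff \<Longrightarrow> letter 0 * p \<in> L"
proof -
  assume p: "keys p \<subseteq> lists takiff"
  have z: "takiff_scale 0 tk_e = 0" "scalar 0 = 0"
    by (simp_all add: takiff_scale_def zero_prod_def scalar_def prod_eq_iff vec_eq_iff)
  have "letter (takiff_scale 0 tk_e) - scalar 0 * letter tk_e \<in> env_rels"
    using tk_in_takiff(1) by blast
  from env_rel_mult[OF this p] show ?thesis by (simp add: z)
qed

lemma commutator_mult:
  assumes "x \<in> takiff" "y \<in> takiff" "keys p \<subseteq> lists takiff"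
  shows "letter x * (letter y * p) - (letter y * (letter x * p) + letter (takiff_bracket x y) * p) \<in> L"
proof -
  have "letter x * letter y - letter y * letter x - letter (takiff_bracket x y) \<in> env_rels"
    using assms(1,2) by blast
  from env_rel_mult[OF this assms(3)] show ?thesis by (simp add: algebra_simps)
qed

lemma spanned_e: "p \<in> spanned \<Longrightarrow> letter tk_e * p \<in> spanned"
proof (rule spanned_mult)
  fix w c assume "w \<in> normal_words"
  then obtain i j where w: "w = replicate i tk_e @ replicate j tk_ebar" by (auto simp: normal_words_def)
  show "letter tk_e * Poly_Mapping.single w c \<in> spanned"
    using normal_wordsI[of "Suc i" j] by (intro spanned_normal) (simp add: w letter_mult_word)
qed auto

text \<open>The bracket of \<open>e\<close> and \<open>ebar\<close> is zero, so \<open>ebar\<close> can be moved to the right past the letters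
  \<open>e\<close> of a normal word.\<close>

lemma spanned_ebar: "p \<in> spanned \<Longrightarrow> letter tk_ebar * p \<in> spanned"
proof (rule spanned_mult)
  fix w c assume "w \<in> normal_words"
  then obtain i j where w: "w = replicate i tk_e @ replicate j tk_ebar" by (auto simp: normal_words_def)
  have "letter tk_ebar * Poly_Mapping.single (replicate i tk_e @ replicate j tk_ebar) c \<in> spanned"
  proof (induction i)
    case 0
    show ?case using normal_wordsI[of 0 "Suc j"] by (intro spanned_normal) (simp add: letter_mult_word)
  next
    case (Suc i)
    let ?p = "Poly_Mapping.single (replicate i tk_e @ replicate j tk_ebar) c"
    have p: "keys ?p \<subseteq> lists takiff"
      using normal_words_subset normal_wordsI[of i j] by auto
    have "letter 0 * ?p \<in> spanned" by (rule spanned_L[OF letter_zero[OF p]])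
    then have "letter tk_e * (letter tk_ebar * ?p) + letter 0 * ?p \<in> spanned"
      by (rule spanned_add[OF spanned_e[OF Suc]])
    then have "letter tk_ebar * (letter tk_e * ?p) \<in> spanned"
      by (rule spanned_cong) (use commutator_mult[of tk_ebar tk_e, OF _ _ p] in \<open>simp add: bracket_ebar_e\<close>)
    then show ?case by (simp add: letter_mult_word)
  qed
  then show "letter tk_ebar * Poly_Mapping.single w c \<in> spanned" by (simp add: w)
qed auto

lemma one_spanned: "1 \<in> spanned"
  using normal_wordsI[of 0 0] by (intro spanned_normal) (simp add: one_eq_word del: single_one)

lemma letter_spanned:
  assumes "x \<in> takiff"
  shows "letter x \<in> spanned"
proof -
  obtain y c d where y: "y \<in> borel_minus" "x = y + (takiff_scale c tk_e + takiff_scale d tk_ebar)"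
    using takiff_decompose[OF assms] .
  have lin: "letter (u + v) \<in> spanned" if "u \<in> takiff" "v \<in> takiff" "letter u \<in> spanned" "letter v \<in> spanned" for u v
  proof (rule spanned_cong[OF spanned_add[OF that(3,4)]])
    have "letter (u + v) - letter u - letter v \<in> env_rels" using that by blast
    from env_rel_mult[OF this keys_one_subset] show "letter (u + v) - (letter u + letter v) \<in> L"
      by (simp add: algebra_simps)
  qed
  have sc: "letter (takiff_scale c u) \<in> spanned" if "u \<in> takiff" "letter u \<in> spanned" for u c
  proof (rule spanned_cong[OF spanned_scalar[OF that(2)]])
    have "letter (takiff_scale c u) - scalar c * letter u \<in> env_rels" using that by blast
    from env_rel_mult[OF this keys_one_subset] show "letter (takiff_scale c u) - scalar c * letter u \<in> L"
      by simp
  qed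
  have "letter y \<in> spanned"
    using spanned_cong[OF spanned_scalar[OF one_spanned] ] L_weight[OF y(1)] by simp
  moreover have "letter tk_e \<in> spanned" "letter tk_ebar \<in> spanned"
    using spanned_e[OF one_spanned] spanned_ebar[OF one_spanned] by simp_all
  ultimately show ?thesis
    using y borel_minus_subset by (auto intro!: lin sc)
qed

text \<open>Induction on the word \<open>y # w\<close>: modulo \<open>L\<close>, \<open>x y w\<close> equals \<open>y x w + [x, y] w\<close>. The induction
  hypothesis covers \<open>x w\<close> and \<open>[x, y] w\<close>, and the span is stable under \<open>y\<close>, which is \<open>e\<close> or
  \<open>ebar\<close>. The induction starts at the empty word, where the Borel part of \<open>x\<close> acts by its weight.\<close>

lemma letter_mult_normal:
  "w \<in> lists {tk_e, tk_ebar} \<Longrightarrow> x \<in> takiff \<Longrightarrow> letter x * Poly_Mapping.single w c \<in> spanned"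
proof (induction w arbitrary: x)
  case Nil
  then show ?case using spanned_scalar[OF letter_spanned[OF Nil(2)], of c]
    by (simp add: scalar_commute flip: scalar_def)
next
  case (Cons y w)
  have y: "y = tk_e \<or> y = tk_ebar" "y \<in> takiff" using Cons.prems by auto
  have w: "w \<in> lists {tk_e, tk_ebar}" using Cons.prems by auto
  have "w \<in> lists takiff" using w lists_mono[of "{tk_e, tk_ebar}" takiff] by auto
  then have k: "keys (Poly_Mapping.single w c) \<subseteq> lists takiff" by simp
  have "letter y * (letter x * Poly_Mapping.single w c) \<in> spanned"
    using y(1) spanned_e spanned_ebar Cons.IH[OF w Cons.prems(2)] by auto
  then have "letter y * (letter x * Poly_Mapping.single w c)
      + letter (takiff_bracket x y) * Poly_Mapping.single w c \<in> spanned"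
    using Cons.IH[OF w, of "takiff_bracket x y"] Cons.prems(2) y(2) by (intro spanned_add) auto
  then have "letter x * (letter y * Poly_Mapping.single w c) \<in> spanned"
    by (rule spanned_cong) (rule commutator_mult[OF Cons.prems(2) y(2) k])
  then show ?case by (simp add: letter_mult_word)
qed

text \<open>The spanning half of the Poincare-Birkhoff-Witt theorem for the Verma module.\<close>

lemma all_spanned:
  assumes "keys p \<subseteq> lists takiff"
  shows "p \<in> spanned"
proof -
  have "Poly_Mapping.single w 1 \<in> spanned" if "w \<in> lists takiff" for w
    using that
  proof (induction w)
    case Nil then show ?case using one_spanned by (simp add: one_eq_word del: single_one)
  next
    case (Cons x w)
    have "letter x * Poly_Mapping.single w 1 \<in> spanned"
    proof (rule spanned_mult)
      fix w' c assume "w' \<in> normal_words"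
      then have "w' \<in> lists {tk_e, tk_ebar}" by (auto simp: normal_words_def replicate_in_lists)
      then show "letter x * Poly_Mapping.single w' c \<in> spanned"
        using Cons by (intro letter_mult_normal) auto
    qed (use Cons in auto)
    then show ?case by (simp add: letter_mult_word)
  qed
  then have *: "Poly_Mapping.single w c \<in> spanned" if "w \<in> lists takiff" for w c
    using spanned_scalar[of "Poly_Mapping.single w 1" c] that by (simp add: scalar_mult_word)
  show ?thesis using assms
  proof (induction p rule: free_elt_induct)
    case zero show ?case by (rule spanned_L[OF zero_in_L])
  qed (auto intro: spanned_add *)
qed

end

section \<open>The tensor product\<close>

lemma env_class_eqI:
  assumes "keys p \<subseteq> lists takiff" "keys q \<subseteq> lists takiff"
  shows "env_class p = env_class q \<longleftrightarrow> p - q \<in> env_ideal"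
proof -
  interpret ideal env_ideal "free_alg takiff" by (rule env_ideal_ideal)
  have m: "p \<ominus>\<^bsub>free_alg takiff\<^esub> q = p - q" using assms by (simp add: a_minus_def free_alg_minus)
  show ?thesis unfolding env_class_def m[symmetric]
    using assms quotient_eq_iff_same_a_r_cos[OF ideal_axioms, of p q] by simp
qed

lemma env_alg_simps:
  assumes "keys p \<subseteq> lists takiff" "keys q \<subseteq> lists takiff"
  shows "env_class p \<oplus>\<^bsub>env_alg\<^esub> env_class q = env_class (p + q)"
    "env_class p \<otimes>\<^bsub>env_alg\<^esub> env_class q = env_class (p * q)"
proof -
  interpret ideal env_ideal "free_alg takiff" by (rule env_ideal_ideal)
  show "env_class p \<oplus>\<^bsub>env_alg\<^esub> env_class q = env_class (p + q)"
    using a_rcos_sum[of p q] assms by (simp add: env_class_def env_alg_def FactRing_def)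
  show "env_class p \<otimes>\<^bsub>env_alg\<^esub> env_class q = env_class (p * q)"
    using rcoset_mult_add[of p q] assms by (simp add: env_class_def env_alg_def FactRing_def)
qed

lemma one_env_alg: "\<one>\<^bsub>env_alg\<^esub> = env_class 1"
  by (simp add: env_alg_def FactRing_def env_class_def)

lemma carrier_env_alg: "carrier env_alg = env_class ` {p. keys p \<subseteq> lists takiff}"
  by (auto simp: env_alg_def FactRing_def A_RCOSETS_def' env_class_def)

lemma env_class_carrier: "keys p \<subseteq> lists takiff \<Longrightarrow> env_class p \<in> carrier env_alg"
  by (simp add: carrier_env_alg)

lemma carrier_pair_group:
  "F \<in> carrier pair_group \<longleftrightarrow> keys F \<subseteq> carrier env_alg \<times> UNIV"
  by (simp add: pair_group_def)

lemma pair_group_simps [simp]: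
  "F \<otimes>\<^bsub>pair_group\<^esub> G = F + G" "\<one>\<^bsub>pair_group\<^esub> = 0"
  by (simp_all add: pair_group_def)

lemma comm_group_pair_group: "comm_group pair_group"
  by (simp add: pair_group_def abelian_free_Abelian_group)

lemma keys_frag_of_pair: "frag_of (u, z) \<in> carrier pair_group \<longleftrightarrow> u \<in> carrier env_alg"
  by (simp add: carrier_pair_group)

lemma pair_group_closed:
  "F \<in> carrier pair_group \<Longrightarrow> G \<in> carrier pair_group \<Longrightarrow> F + G \<in> carrier pair_group"
  "F \<in> carrier pair_group \<Longrightarrow> G \<in> carrier pair_group \<Longrightarrow> F - G \<in> carrier pair_group"
  "F \<in> carrier pair_group \<Longrightarrow> - F \<in> carrier pair_group"
  "0 \<in> carrier pair_group"
  unfolding carrier_pair_group using keys_add[of F G] keys_diff[of F G] by auto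

lemma inv_pair_group: "F \<in> carrier pair_group \<Longrightarrow> inv\<^bsub>pair_group\<^esub> F = - F"
  by (simp add: pair_group_def)

lemma pair_group_induct [consumes 1, case_names zero frag diff]:
  assumes "F \<in> carrier pair_group" "P 0"
    and "\<And>p z. keys p \<subseteq> lists takiff \<Longrightarrow> P (frag_of (env_class p, z))"
    and "\<And>F G. F \<in> carrier pair_group \<Longrightarrow> G \<in> carrier pair_group \<Longrightarrow> P F \<Longrightarrow> P G \<Longrightarrow> P (F - G)"
  shows "P F"
proof (rule free_Abelian_group_induct[where P = P])
  show "keys F \<subseteq> carrier env_alg \<times> UNIV" using assms(1) by (simp add: carrier_pair_group)
next
  fix a :: "free_elt set \<times> complex" assume "a \<in> carrier env_alg \<times> UNIV"
  then show "P (frag_of a)" using assms(3) by (auto simp: carrier_env_alg)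
qed (use assms(2,4) in \<open>auto simp: carrier_pair_group\<close>)

lemma one_dim_rep_simps [simp]:
  "carrier (one_dim_rep \<mu>) = UNIV" "y \<oplus>\<^bsub>one_dim_rep \<mu>\<^esub> z = y + z" "\<zero>\<^bsub>one_dim_rep \<mu>\<^esub> = 0"
  "c \<odot>\<^bsub>one_dim_rep \<mu>\<^esub> z = c * z" "act (one_dim_rep \<mu>) x z = borel_weight \<mu> x * z"
  by (simp_all add: one_dim_rep_def borel_weight_def)

text \<open>As \<open>\<complex>\<^sub>\<mu>\<close> is a module over the Borel subalgebra only, the general lemmas on modules over the
  whole algebra do not apply to it.\<close>

lemma env_act_one_dim:
  "env_act (one_dim_rep \<mu>) p z =
    (\<Sum>w\<in>keys p. lookup p w * foldr (act (one_dim_rep \<mu>)) w z)"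
proof -
  interpret abelian_monoid "one_dim_rep \<mu>"
    by (intro abelian_monoidI) (auto simp: algebra_simps)
  have "finsum (one_dim_rep \<mu>) f A = sum f A" if "finite A" for f and A :: "takiff_elt list set"
    using that by (induction A) (simp_all add: Pi_def)
  then show ?thesis by (simp add: env_act_def)
qed

lemma tensor_rels_subset: "tensor_rels \<mu> \<subseteq> carrier pair_group"
proof -
  interpret E: ring env_alg
    unfolding env_alg_def by (rule ideal.quotient_is_ring[OF env_ideal_ideal])
  have "env_class p \<in> carrier env_alg" if "keys p \<subseteq> lists borel_minus" for p
    using that lists_mono[OF borel_minus_subset] by (intro env_class_carrier) auto
  then show ?thesis
    unfolding tensor_rels_def by (auto intro!: pair_group_closed simp: keys_frag_of_pair)
qed

lemma subgroup_tensor_null: "subgroup (tensor_null \<mu>) pair_group"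
proof -
  interpret comm_group pair_group by (rule comm_group_pair_group)
  show ?thesis unfolding tensor_null_def by (rule generate_is_subgroup[OF tensor_rels_subset])
qed

lemma tensor_null_closed:
  "F \<in> tensor_null \<mu> \<Longrightarrow> F \<in> carrier pair_group"
  "F \<in> tensor_null \<mu> \<Longrightarrow> G \<in> tensor_null \<mu> \<Longrightarrow> F + G \<in> tensor_null \<mu>"
  "F \<in> tensor_null \<mu> \<Longrightarrow> - F \<in> tensor_null \<mu>"
  "F \<in> tensor_null \<mu> \<Longrightarrow> G \<in> tensor_null \<mu> \<Longrightarrow> F - G \<in> tensor_null \<mu>"
  "0 \<in> tensor_null \<mu>"
proof -
  interpret subgroup "tensor_null \<mu>" pair_group by (rule subgroup_tensor_null)
  show c: "F \<in> tensor_null \<mu> \<Longrightarrow> F \<in> carrier pair_group" for F using subset by auto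
  show a: "F \<in> tensor_null \<mu> \<Longrightarrow> G \<in> tensor_null \<mu> \<Longrightarrow> F + G \<in> tensor_null \<mu>" for F G
    using m_closed by simp
  show m: "F \<in> tensor_null \<mu> \<Longrightarrow> - F \<in> tensor_null \<mu>" for F
    using m_inv_closed inv_pair_group c by metis
  show "F \<in> tensor_null \<mu> \<Longrightarrow> G \<in> tensor_null \<mu> \<Longrightarrow> F - G \<in> tensor_null \<mu>"
    using a[of F "- G"] m[of G] by simp
  show "0 \<in> tensor_null \<mu>" using one_closed by simp
qed

lemma tensor_null_least:
  assumes "subgroup K pair_group" "tensor_rels \<mu> \<subseteq> K"
  shows "tensor_null \<mu> \<subseteq> K"
proof -
  interpret comm_group pair_group by (rule comm_group_pair_group)
  show ?thesis unfolding tensor_null_def using assms by (intro generate_subgroup_incl)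
qed

lemma tensor_null_rels:
  assumes "keys p \<subseteq> lists takiff" "keys q \<subseteq> lists takiff"
  shows "frag_of (env_class (p + q), z) - frag_of (env_class p, z) - frag_of (env_class q, z) \<in> tensor_null \<mu>"
    "frag_of (env_class p, z + z') - frag_of (env_class p, z) - frag_of (env_class p, z') \<in> tensor_null \<mu>"
    "keys b \<subseteq> lists borel_minus \<Longrightarrow>
      frag_of (env_class (p * b), z) - frag_of (env_class p, env_act (one_dim_rep \<mu>) b z) \<in> tensor_null \<mu>"
proof -
  have sub: "tensor_rels \<mu> \<subseteq> tensor_null \<mu>"
    unfolding tensor_null_def by (auto intro: generate.incl)
  note c = env_class_carrier[OF assms(1)] env_class_carrier[OF assms(2)]
  show "frag_of (env_class (p + q), z) - frag_of (env_class p, z) - frag_of (env_class q, z) \<in> tensor_null \<mu>"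
    unfolding env_alg_simps(1)[OF assms, symmetric]
    by (rule subsetD[OF sub]) (use c in \<open>unfold tensor_rels_def, blast\<close>)
  show "frag_of (env_class p, z + z') - frag_of (env_class p, z) - frag_of (env_class p, z') \<in> tensor_null \<mu>"
    by (rule subsetD[OF sub]) (use c in \<open>unfold tensor_rels_def, blast\<close>)
  assume b: "keys b \<subseteq> lists borel_minus"
  then have b': "keys b \<subseteq> lists takiff" using lists_mono[OF borel_minus_subset] by auto
  have "b \<in> carrier (free_alg borel_minus)" using b by simp
  then show "frag_of (env_class (p * b), z) - frag_of (env_class p, env_act (one_dim_rep \<mu>) b z) \<in> tensor_null \<mu>"
    unfolding env_alg_simps(2)[OF assms(1) b', symmetric]
    by (intro subsetD[OF sub]) (use c in \<open>unfold tensor_rels_def, blast\<close>)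
qed

lemma tensor_class_self: "F \<in> carrier pair_group \<Longrightarrow> F \<in> tensor_class \<mu> F"
  using tensor_null_closed(5) by (auto simp: tensor_class_def r_coset_def intro!: bexI[of _ 0])

lemma in_tensor_class: "G \<in> tensor_class \<mu> F \<longleftrightarrow> G - F \<in> tensor_null \<mu>"
  by (auto simp: tensor_class_def r_coset_def intro!: bexI[of _ "G - F"])

lemma tensor_class_eq_iff:
  "F \<in> carrier pair_group \<Longrightarrow> G \<in> carrier pair_group \<Longrightarrow>
    tensor_class \<mu> F = tensor_class \<mu> G \<longleftrightarrow> F - G \<in> tensor_null \<mu>"
proof
  assume "F \<in> carrier pair_group" "tensor_class \<mu> F = tensor_class \<mu> G"
  then show "F - G \<in> tensor_null \<mu>" using tensor_class_self in_tensor_class by blast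
next
  assume d: "F - G \<in> tensor_null \<mu>"
  have "X - F \<in> tensor_null \<mu> \<longleftrightarrow> X - G \<in> tensor_null \<mu>" for X
    using tensor_null_closed(2)[OF _ d, of "X - F"] tensor_null_closed(4)[OF _ d, of "X - G"]
    by (auto simp: algebra_simps)
  then show "tensor_class \<mu> F = tensor_class \<mu> G"
    by (simp add: in_tensor_class set_eq_iff)
qed

abbreviation lmult :: "free_elt \<Rightarrow> tensor_elt \<Rightarrow> tensor_elt" where
  "lmult p \<equiv> frag_extend (\<lambda>(u, z). frag_of (env_class p \<otimes>\<^bsub>env_alg\<^esub> u, z))"

lemma lmult_frag:
  "keys p \<subseteq> lists takiff \<Longrightarrow> keys q \<subseteq> lists takiff \<Longrightarrow>
    lmult p (frag_of (env_class q, z)) = frag_of (env_class (p * q), z)"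
  by (simp add: env_alg_simps)

lemma lmult_closed:
  assumes p: "keys p \<subseteq> lists takiff" and "F \<in> carrier pair_group"
  shows "lmult p F \<in> carrier pair_group"
  using assms(2)
  by (induction F rule: pair_group_induct)
     (simp_all add: lmult_frag[OF p] frag_extend_diff keys_frag_of_pair keys_mult_subset_lists p
       pair_group_closed env_class_carrier del: frag_extend_of)

text \<open>Left multiplication in \<open>U(g)\<close> is additive and commutes with right multiplication by elements of
  the Borel subalgebra, so it maps the relations of the tensor product to relations.\<close>

lemma lmult_null:
  assumes p: "keys p \<subseteq> lists takiff" and F: "F \<in> tensor_null \<mu>"
  shows "lmult p F \<in> tensor_null \<mu>"
proof -
  interpret comm_group pair_group by (rule comm_group_pair_group)
  let ?K = "{F \<in> carrier pair_group. lmult p F \<in> tensor_null \<mu>}"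
  have "subgroup ?K pair_group"
    by (rule subgroupI)
       (auto simp: inv_pair_group frag_extend_add frag_extend_minus pair_group_closed tensor_null_closed
         intro!: exI[of _ 0])
  moreover have "tensor_rels \<mu> \<subseteq> ?K"
  proof
    fix r assume r: "r \<in> tensor_rels \<mu>"
    have "lmult p r \<in> tensor_null \<mu>"
      using r unfolding tensor_rels_def
    proof (elim UnE CollectE exE conjE)
      fix u u' z assume u: "r = frag_of (u \<oplus>\<^bsub>env_alg\<^esub> u', z) - frag_of (u, z) - frag_of (u', z)"
        "u \<in> carrier env_alg" "u' \<in> carrier env_alg"
      then obtain q q' where q: "u = env_class q" "u' = env_class q'"
        "keys q \<subseteq> lists takiff" "keys q' \<subseteq> lists takiff"
        by (auto simp: carrier_env_alg)
      show ?thesis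
        using tensor_null_rels(1)[of "p * q" "p * q'"] p q
        by (simp add: u(1) q(1,2) env_alg_simps keys_intros frag_extend_diff lmult_frag distrib_left
              del: frag_extend_of)
    next
      fix u z z' assume u: "r = frag_of (u, z + z') - frag_of (u, z) - frag_of (u, z')" "u \<in> carrier env_alg"
      then obtain q where q: "u = env_class q" "keys q \<subseteq> lists takiff"
        by (auto simp: carrier_env_alg)
      show ?thesis
        using tensor_null_rels(2)[of "p * q" "p * q"] p q
        by (simp add: u(1) q(1) frag_extend_diff lmult_frag keys_intros del: frag_extend_of)
    next
      fix u b z
      assume u: "r = frag_of (u \<otimes>\<^bsub>env_alg\<^esub> env_class b, z) - frag_of (u, env_act (one_dim_rep \<mu>) b z)"
        "u \<in> carrier env_alg" "b \<in> carrier (free_alg borel_minus)"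
      then obtain q where q: "u = env_class q" "keys q \<subseteq> lists takiff"
        by (auto simp: carrier_env_alg)
      have b: "keys b \<subseteq> lists borel_minus" using u(3) by simp
      then have b': "keys b \<subseteq> lists takiff" using lists_mono[OF borel_minus_subset] by auto
      show ?thesis
        using tensor_null_rels(3)[of "p * q" "p * q" b] p q b b'
        by (simp add: u(1) q(1) env_alg_simps frag_extend_diff lmult_frag keys_intros mult.assoc del: frag_extend_of)
    qed
    then show "r \<in> ?K" using subsetD[OF tensor_rels_subset r] by simp
  qed
  ultimately have "tensor_null \<mu> \<subseteq> ?K" by (rule tensor_null_least)
  then show ?thesis using F by auto
qed

lemma tensor_lmult_class:
  assumes p: "keys p \<subseteq> lists takiff" and F: "F \<in> carrier pair_group"
  shows "tensor_lmult \<mu> (env_class p) (tensor_class \<mu> F) = tensor_class \<mu> (lmult p F)"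
proof -
  have "tensor_class \<mu> (lmult p G) = tensor_class \<mu> (lmult p F)" if "G \<in> tensor_class \<mu> F" for G
  proof -
    have n: "G - F \<in> tensor_null \<mu>" using that by (simp add: in_tensor_class)
    then have "G \<in> carrier pair_group"
      using pair_group_closed(1)[OF tensor_null_closed(1)[OF n] F] by simp
    then show ?thesis
      using lmult_null[OF p n] F p by (subst tensor_class_eq_iff) (auto simp: lmult_closed frag_extend_diff)
  qed
  then show ?thesis
    unfolding tensor_lmult_def using tensor_class_self[OF F] by blast
qed

lemma carrier_opp_verma: "carrier (opp_verma \<mu>) = tensor_class \<mu> ` carrier pair_group"
  by (auto simp: opp_verma_def FactGroup_def RCOSETS_def tensor_class_def)

lemma add_opp_verma:
  assumes "F \<in> carrier pair_group" "G \<in> carrier pair_group"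
  shows "tensor_class \<mu> F \<oplus>\<^bsub>opp_verma \<mu>\<^esub> tensor_class \<mu> G = tensor_class \<mu> (F + G)"
proof -
  interpret comm_group pair_group by (rule comm_group_pair_group)
  have "normal (tensor_null \<mu>) pair_group"
    by (rule subgroup_imp_normal[OF subgroup_tensor_null])
  from normal.rcos_sum[OF this assms] show ?thesis
    by (simp add: opp_verma_def tensor_class_def FactGroup_def)
qed

context takiff_module
begin

lemma env_act_zero_right: "keys p \<subseteq> lists takiff \<Longrightarrow> env_act M p \<zero>\<^bsub>M\<^esub> = \<zero>\<^bsub>M\<^esub>"
  using env_act_add_right[of p "\<zero>\<^bsub>M\<^esub>" "\<zero>\<^bsub>M\<^esub>"] env_act_closed[of p "\<zero>\<^bsub>M\<^esub>"] by simp

lemma eq_minusI: "x \<in> carrier M \<Longrightarrow> y \<in> carrier M \<Longrightarrow> z \<in> carrier M \<Longrightarrow> z \<oplus>\<^bsub>M\<^esub> y = x \<Longrightarrow> z = x \<ominus>\<^bsub>M\<^esub> y"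
  by (metis M.add.inv_solve_right M.minus_eq)

lemma env_act_diff_right:
  assumes "keys p \<subseteq> lists takiff" "u \<in> carrier M" "v \<in> carrier M"
  shows "env_act M p (u \<ominus>\<^bsub>M\<^esub> v) = env_act M p u \<ominus>\<^bsub>M\<^esub> env_act M p v"
proof (rule eq_minusI)
  have "(u \<ominus>\<^bsub>M\<^esub> v) \<oplus>\<^bsub>M\<^esub> v = u" using assms by (simp add: M.minus_eq M.a_assoc M.l_neg)
  then show "env_act M p (u \<ominus>\<^bsub>M\<^esub> v) \<oplus>\<^bsub>M\<^esub> env_act M p v = env_act M p u"
    using env_act_add_right[OF assms(1), of "u \<ominus>\<^bsub>M\<^esub> v" v] assms by simp
qed (use assms in \<open>auto simp: env_act_closed\<close>)

lemma finsum_scalars: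
  "finite A \<Longrightarrow> v \<in> carrier M \<Longrightarrow> (\<Oplus>\<^bsub>M\<^esub>w\<in>A. c w \<odot>\<^bsub>M\<^esub> v) = (\<Sum>w\<in>A. c w) \<odot>\<^bsub>M\<^esub> v"
  by (induction A rule: finite_induct) (auto simp: Pi_def smult_add')

lemma env_act_weight_vector:
  assumes v: "v \<in> carrier M" "\<And>x. x \<in> borel_minus \<Longrightarrow> act M x v = borel_weight \<mu> x \<odot>\<^bsub>M\<^esub> v"
    and b: "keys b \<subseteq> lists borel_minus"
  shows "env_act M b (z \<odot>\<^bsub>M\<^esub> v) = env_act (one_dim_rep \<mu>) b z \<odot>\<^bsub>M\<^esub> v"
proof -
  have w: "foldr (act M) w (z \<odot>\<^bsub>M\<^esub> v) = foldr (act (one_dim_rep \<mu>)) w z \<odot>\<^bsub>M\<^esub> v"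
    if "w \<in> lists borel_minus" for w
    using that borel_minus_subset
    by (induction w) (auto simp: v act_scale_right subsetD mult.commute simp flip: smult_assoc')
  have "env_act M b (z \<odot>\<^bsub>M\<^esub> v) = (\<Oplus>\<^bsub>M\<^esub>w\<in>keys b.
      (lookup b w * foldr (act (one_dim_rep \<mu>)) w z) \<odot>\<^bsub>M\<^esub> v)"
    unfolding env_act_def using b v
    by (intro M.finsum_cong') (auto simp: smult_assoc' w subsetD)
  also have "\<dots> = env_act (one_dim_rep \<mu>) b z \<odot>\<^bsub>M\<^esub> v"
    using v by (subst finsum_scalars) (auto simp: env_act_one_dim)
  finally show ?thesis .
qed

end

lemma env_act_one_dim_scalar: "env_act (one_dim_rep \<mu>) (scalar z) 1 = z"
  by (simp add: env_act_one_dim scalar_def)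

text \<open>A cyclic module on a lowest weight vector \<open>v\<close> is a quotient of the opposite Verma module. In
  the latter every element has the form \<open>p \<otimes> 1\<close>, and \<open>p\<close> can be taken in the span of the words
  \<open>e\<^sup>i ebar\<^sup>j\<close>; if their values at \<open>v\<close> are linearly independent, the kernel is zero.\<close>

lemma is_opp_vermaI:
  fixes N :: "'v rep" (structure)
  assumes N: "takiff_module N" and v: "v \<in> carrier N"
    and weight: "\<And>x. x \<in> borel_minus \<Longrightarrow> act N x v = borel_weight \<mu> x \<odot>\<^bsub>N\<^esub> v"
    and cyclic: "carrier N \<subseteq> env_orbit N v"
    and indep: "\<And>n. keys n \<subseteq> normal_words \<Longrightarrow> env_act N n v = \<zero>\<^bsub>N\<^esub> \<Longrightarrow> n = 0"
  shows "is_opp_verma N v"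
proof -
  interpret takiff_module N by (rule N)
  \<comment> \<open>the map \<open>(u, z) \<mapsto> z (u v)\<close>, computed with an arbitrary representative of \<open>u\<close>\<close>
  define f where "f = (\<lambda>(u, z). env_act N (SOME p. keys p \<subseteq> lists takiff \<and> env_class p = u) (z \<odot>\<^bsub>N\<^esub> v))"
  have f: "f (env_class p, z) = env_act N p (z \<odot>\<^bsub>N\<^esub> v)" if p: "keys p \<subseteq> lists takiff" for p z
  proof -
    define q where "q = (SOME q. keys q \<subseteq> lists takiff \<and> env_class q = env_class p)"
    have "keys q \<subseteq> lists takiff \<and> env_class q = env_class p"
      unfolding q_def by (rule someI[of _ p]) (use p in simp)
    then have q: "keys q \<subseteq> lists takiff" "q - p \<in> env_ideal"
      using env_class_eqI p by auto
    have "env_act N ((q - p) + p) (z \<odot>\<^bsub>N\<^esub> v) = env_act N (q - p) (z \<odot>\<^bsub>N\<^esub> v) \<oplus> env_act N p (z \<odot>\<^bsub>N\<^esub> v)"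
      using p q v by (intro env_act_add) (auto simp: keys_diff_subset)
    then have "env_act N q (z \<odot>\<^bsub>N\<^esub> v) = env_act N p (z \<odot>\<^bsub>N\<^esub> v)"
      using q(2) p v by (simp add: env_act_ideal env_act_closed)
    then show ?thesis by (simp add: f_def q_def)
  qed
  have "f ` (carrier env_alg \<times> UNIV) \<subseteq> carrier (add_monoid N)"
    using v by (auto simp: carrier_env_alg f env_act_closed)
  then obtain h where h: "h \<in> hom (free_Abelian_group (carrier env_alg \<times> UNIV)) (add_monoid N)"
    "\<And>x. x \<in> carrier env_alg \<times> UNIV \<Longrightarrow> h (frag_of x) = f x"
    using comm_group.free_Abelian_group_universal[OF M.a_comm_group] by metis
  have h_closed: "h F \<in> carrier N" if "F \<in> carrier pair_group" for F
    using h(1) that unfolding hom_def pair_group_def by auto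
  have h_add: "h (F + G) = h F \<oplus> h G" if "F \<in> carrier pair_group" "G \<in> carrier pair_group" for F G
    using h(1) that unfolding hom_def pair_group_def by auto
  have h_zero: "h 0 = \<zero>"
    using h_add[of 0 0] h_closed[of 0] by (simp add: pair_group_closed)
  have h_diff: "h (F - G) = h F \<ominus> h G" if "F \<in> carrier pair_group" "G \<in> carrier pair_group" for F G
    using h_add[of "F - G" G] that by (intro eq_minusI) (auto simp: h_closed pair_group_closed)
  have h_frag: "h (frag_of (env_class p, z)) = env_act N p (z \<odot>\<^bsub>N\<^esub> v)" if "keys p \<subseteq> lists takiff" for p z
    using that by (simp add: h(2) env_class_carrier f)
  have frag_closed: "frag_of (env_class p, z) \<in> carrier pair_group" if "keys p \<subseteq> lists takiff" for p z
    using that by (simp add: keys_frag_of_pair env_class_carrier)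
  have h_lmult: "h (lmult p F) = env_act N p (h F)"
    if p: "keys p \<subseteq> lists takiff" and F: "F \<in> carrier pair_group" for p F
    using F
  proof (induction F rule: pair_group_induct)
    case zero
    then show ?case using p by (simp add: h_zero env_act_zero_right)
  next
    case (frag q z)
    then show ?case using p v
      by (simp add: lmult_frag h_frag env_act_mult keys_mult_subset_lists del: frag_extend_of)
  next
    case (diff F G)
    then show ?case using p
      by (simp add: frag_extend_diff h_diff lmult_closed env_act_diff_right h_closed)
  qed

  have h_null: "h F = \<zero>" if "F \<in> tensor_null \<mu>" for F
  proof -
    interpret G: comm_group pair_group by (rule comm_group_pair_group)
    let ?K = "{F \<in> carrier pair_group. h F = \<zero>}"
    have "h (- F) = \<zero>" if "F \<in> ?K" for F
      using h_diff[of 0 F] that by (simp add: pair_group_closed h_zero M.minus_eq)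
    then have "subgroup ?K pair_group"
      by (intro G.subgroupI) (auto simp: inv_pair_group pair_group_closed h_add h_zero intro!: exI[of _ 0])
    moreover have "tensor_rels \<mu> \<subseteq> ?K"
    proof
      fix r assume r: "r \<in> tensor_rels \<mu>"
      have "h r = \<zero>"
        using r unfolding tensor_rels_def
      proof (elim UnE CollectE exE conjE)
        fix u u' z assume u: "r = frag_of (u \<oplus>\<^bsub>env_alg\<^esub> u', z) - frag_of (u, z) - frag_of (u', z)"
          "u \<in> carrier env_alg" "u' \<in> carrier env_alg"
        then obtain q q' where q: "u = env_class q" "u' = env_class q'"
          "keys q \<subseteq> lists takiff" "keys q' \<subseteq> lists takiff"
          by (auto simp: carrier_env_alg)
        show ?thesis
          using q v by (simp add: u(1) env_alg_simps h_diff h_frag frag_closed pair_group_closed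
              keys_add_subset env_act_add env_act_closed sum_minus_summands)
      next
        fix u z z' assume u: "r = frag_of (u, z + z') - frag_of (u, z) - frag_of (u, z')" "u \<in> carrier env_alg"
        then obtain q where q: "u = env_class q" "keys q \<subseteq> lists takiff"
          by (auto simp: carrier_env_alg)
        then show ?thesis
          using v by (simp add: u(1) h_diff h_frag frag_closed pair_group_closed smult_add'
              env_act_add_right env_act_closed sum_minus_summands)
      next
        fix u b z
        assume u: "r = frag_of (u \<otimes>\<^bsub>env_alg\<^esub> env_class b, z) - frag_of (u, env_act (one_dim_rep \<mu>) b z)"
          "u \<in> carrier env_alg" "b \<in> carrier (free_alg borel_minus)"
        then obtain q where q: "u = env_class q" "keys q \<subseteq> lists takiff"
          by (auto simp: carrier_env_alg)
        have b: "keys b \<subseteq> lists borel_minus" using u(3) by simp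
        then have b': "keys b \<subseteq> lists takiff" using lists_mono[OF borel_minus_subset] by auto
        show ?thesis
          using q v b b' env_act_weight_vector[OF v weight b]
          by (simp add: u(1) q(1) env_alg_simps h_diff h_frag frag_closed keys_mult_subset_lists env_act_mult
              env_act_closed M.minus_eq M.r_neg)
      qed
      then show "r \<in> ?K" using subsetD[OF tensor_rels_subset r] by simp
    qed
    ultimately have "tensor_null \<mu> \<subseteq> ?K" by (rule tensor_null_least)
    then show ?thesis using that by auto
  qed

  let ?X = "\<lambda>p. frag_of (env_class p, 1)"
  let ?L = "{p. keys p \<subseteq> lists takiff \<and> ?X p \<in> tensor_null \<mu>}"
  have X_diff: "?X (p - q) - (?X p - ?X q) \<in> tensor_null \<mu>"
    if "keys p \<subseteq> lists takiff" "keys q \<subseteq> lists takiff" for p q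
    using tensor_null_closed(3)[OF tensor_null_rels(1)[of "p - q" q 1 \<mu>]] that
    by (simp add: keys_diff_subset algebra_simps)
  have X_scalar: "?X (p * scalar z) - frag_of (env_class p, z) \<in> tensor_null \<mu>"
    if "keys p \<subseteq> lists takiff" for p z
    using tensor_null_rels(3)[OF that that keys_scalar_subset, of z 1 \<mu>]
    by (simp add: env_act_one_dim_scalar)
  interpret L: lowest_weight_ideal \<mu> ?L
  proof
    fix p q :: free_elt assume p: "p \<in> ?L"
    show "keys p \<subseteq> lists takiff" using p by simp
    {
      assume q: "q \<in> ?L"
      have "?X (p + q) - ?X p - ?X q \<in> tensor_null \<mu>" using tensor_null_rels(1) p q by simp
      then have "(?X (p + q) - ?X p - ?X q) + (?X p + ?X q) \<in> tensor_null \<mu>"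
        using p q by (intro tensor_null_closed(2)) auto
      then show "p + q \<in> ?L" using p q by (simp add: keys_add_subset)
    }
    assume q: "keys q \<subseteq> lists takiff"
    show "q * p \<in> ?L"
      using lmult_null[OF q, of "?X p" \<mu>] p q
      by (simp add: lmult_frag keys_mult_subset_lists del: frag_extend_of)
  next
    interpret I: ideal env_ideal "free_alg takiff" by (rule env_ideal_ideal)
    have "- ?X 0 \<in> tensor_null \<mu>" using tensor_null_rels(1)[of 0 0 1 \<mu>] by simp
    then have 0: "?X 0 \<in> tensor_null \<mu>" using tensor_null_closed(3) by fastforce
    have "p \<in> ?L" if p: "p \<in> env_ideal" for p
    proof -
      have k: "keys p \<subseteq> lists takiff" using I.a_Hcarr[OF p] by simp
      then have "env_class p = env_class 0" using p by (simp add: env_class_eqI)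
      then show ?thesis using 0 k by simp
    qed
    then show "env_ideal \<subseteq> ?L" by blast
  next
    fix x assume x: "x \<in> borel_minus"
    then have xt: "x \<in> takiff" using borel_minus_subset by auto
    let ?w = "borel_weight \<mu> x"
    have "?X (letter x) - frag_of (env_class 1, ?w) \<in> tensor_null \<mu>"
      using tensor_null_rels(3)[OF keys_one_subset keys_one_subset, of "letter x" 1 \<mu>] x
      by (simp add: env_act_one_dim letter_def)
    then have "(?X (letter x) - frag_of (env_class 1, ?w)) - (?X (1 * scalar ?w) - frag_of (env_class 1, ?w))
        \<in> tensor_null \<mu>"
      by (rule tensor_null_closed(4)) (rule X_scalar[OF keys_one_subset])
    then have "?X (letter x) - ?X (scalar ?w) \<in> tensor_null \<mu>" by simp
    then have "(?X (letter x - scalar ?w) - (?X (letter x) - ?X (scalar ?w))) + (?X (letter x) - ?X (scalar ?w))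
        \<in> tensor_null \<mu>"
      by (intro tensor_null_closed(2) X_diff keys_letter_subset keys_scalar_subset xt)
    then show "letter x - scalar ?w \<in> ?L"
      using xt by (simp add: keys_diff_subset keys_letter_subset keys_scalar_subset del: keys_letter)
  qed

  \<comment> \<open>scalars move to the first factor, so all tensors are pure\<close>
  have single_tensor: "\<exists>p. keys p \<subseteq> lists takiff \<and> F - ?X p \<in> tensor_null \<mu>"
    if "F \<in> carrier pair_group" for F
    using that
  proof (induction F rule: pair_group_induct)
    case zero
    have "0 - ?X 0 \<in> tensor_null \<mu>" using tensor_null_rels(1)[of 0 0 1 \<mu>] by simp
    then show ?case by (intro exI[of _ 0]) simp
  next
    case (frag p z)
    then show ?case using tensor_null_closed(3)[OF X_scalar[OF frag, of z]]
      by (intro exI[of _ "p * scalar z"]) (simp add: keys_intros)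
  next
    case (diff F G)
    then obtain p q where p: "keys p \<subseteq> lists takiff" "F - ?X p \<in> tensor_null \<mu>"
      and q: "keys q \<subseteq> lists takiff" "G - ?X q \<in> tensor_null \<mu>" by auto
    have "((F - ?X p) - (G - ?X q)) - (?X (p - q) - (?X p - ?X q)) \<in> tensor_null \<mu>"
      by (rule tensor_null_closed(4)[OF tensor_null_closed(4)[OF p(2) q(2)] X_diff[OF p(1) q(1)]])
    then show ?case using p q by (intro exI[of _ "p - q"]) (simp add: keys_diff_subset algebra_simps)
  qed
  have h_X: "h (?X p) = env_act N p v" if "keys p \<subseteq> lists takiff" for p
    using that v by (simp add: h_frag)
  have h_inj: "F \<in> tensor_null \<mu>" if F: "F \<in> carrier pair_group" and "h F = \<zero>" for F
  proof -
    obtain p where p: "keys p \<subseteq> lists takiff" "F - ?X p \<in> tensor_null \<mu>"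
      using single_tensor[OF F] by auto
    have pv: "env_act N p v = \<zero>"
      using h_null[OF p(2)] F p v that(2)
      by (simp add: h_diff frag_closed h_X M.minus_eq env_act_closed)
    obtain n where n: "keys n \<subseteq> normal_words" "p - n \<in> ?L"
      using L.all_spanned[OF p(1)] unfolding L.spanned_def by auto
    have n': "keys n \<subseteq> lists takiff" using n(1) normal_words_subset by auto
    have "h (?X (p - n)) = \<zero>" using n(2) h_null by auto
    then have "env_act N n v = \<zero>"
      using p n' v pv by (simp add: h_X keys_diff_subset env_act_diff M.minus_eq env_act_closed)
    then have "n = 0" by (rule indep[OF n(1)])
    then have "?X p \<in> tensor_null \<mu>" using n(2) by simp
    then have "(F - ?X p) + ?X p \<in> tensor_null \<mu>" by (rule tensor_null_closed(2)[OF p(2)])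
    then show ?thesis by simp
  qed

  define \<phi> where "\<phi> K = h (SOME F. F \<in> carrier pair_group \<and> tensor_class \<mu> F = K)" for K
  have \<phi>: "\<phi> (tensor_class \<mu> F) = h F" if F: "F \<in> carrier pair_group" for F
  proof -
    define G where "G = (SOME G. G \<in> carrier pair_group \<and> tensor_class \<mu> G = tensor_class \<mu> F)"
    have "G \<in> carrier pair_group \<and> tensor_class \<mu> G = tensor_class \<mu> F"
      unfolding G_def by (rule someI[of _ F]) (use F in simp)
    then have G: "G \<in> carrier pair_group" "G - F \<in> tensor_null \<mu>" using F by (auto simp: tensor_class_eq_iff)
    have "h ((G - F) + F) = h (G - F) \<oplus> h F" using F G by (intro h_add pair_group_closed)
    then have "h G = h F" using h_null[OF G(2)] F by (simp add: h_closed)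
    then show ?thesis by (simp add: \<phi>_def G_def)
  qed
  have "rep_iso \<phi> (opp_verma \<mu>) N"
    unfolding rep_iso_def
  proof (intro conjI ballI allI)
    show "bij_betw \<phi> (carrier (opp_verma \<mu>)) (carrier N)"
    proof (rule bij_betw_imageI)
      show "inj_on \<phi> (carrier (opp_verma \<mu>))"
      proof (rule inj_onI; unfold carrier_opp_verma; elim imageE; hypsubst)
        fix F G assume FG: "\<phi> (tensor_class \<mu> F) = \<phi> (tensor_class \<mu> G)"
          "F \<in> carrier pair_group" "G \<in> carrier pair_group"
        then have "h (F - G) = \<zero>" by (simp add: \<phi> h_diff M.minus_eq h_closed M.r_neg)
        then show "tensor_class \<mu> F = tensor_class \<mu> G"
          using FG by (simp add: tensor_class_eq_iff h_inj pair_group_closed)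
      qed
      show "\<phi> ` carrier (opp_verma \<mu>) = carrier N"
      proof
        show "\<phi> ` carrier (opp_verma \<mu>) \<subseteq> carrier N" by (auto simp: carrier_opp_verma \<phi> h_closed)
        show "carrier N \<subseteq> \<phi> ` carrier (opp_verma \<mu>)"
        proof
          fix u assume "u \<in> carrier N"
          then obtain p where p: "u = env_act N p v" "keys p \<subseteq> lists takiff"
            using cyclic by (auto simp: env_orbit_def)
          then have "u = \<phi> (tensor_class \<mu> (?X p))" by (simp add: \<phi> frag_closed h_X)
          then show "u \<in> \<phi> ` carrier (opp_verma \<mu>)"
            using p by (auto simp: carrier_opp_verma frag_closed)
        qed
      qed
    qed
  next
    fix K L assume "K \<in> carrier (opp_verma \<mu>)" "L \<in> carrier (opp_verma \<mu>)"
    then show "\<phi> (K \<oplus>\<^bsub>opp_verma \<mu>\<^esub> L) = \<phi> K \<oplus> \<phi> L"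
      by (auto simp: carrier_opp_verma add_opp_verma \<phi> pair_group_closed h_add)
  next
    fix c K assume "K \<in> carrier (opp_verma \<mu>)"
    then obtain F where F: "F \<in> carrier pair_group" "K = tensor_class \<mu> F" by (auto simp: carrier_opp_verma)
    then show "\<phi> (c \<odot>\<^bsub>opp_verma \<mu>\<^esub> K) = c \<odot>\<^bsub>N\<^esub> \<phi> K"
      by (simp add: opp_verma_def tensor_lmult_class keys_scalar_subset \<phi> lmult_closed h_lmult h_closed)
  next
    fix x K assume x: "x \<in> takiff" and "K \<in> carrier (opp_verma \<mu>)"
    then obtain F where F: "F \<in> carrier pair_group" "K = tensor_class \<mu> F" by (auto simp: carrier_opp_verma)
    then show "\<phi> (act (opp_verma \<mu>) x K) = act N x (\<phi> K)"
      using x by (simp add: opp_verma_def tensor_lmult_class keys_letter_subset \<phi> lmult_closed h_lmult h_closed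
          del: keys_letter)
  qed
  moreover have "env_act N 1 v = v"
    using env_act_single[of "[]" v 1] v by (simp add: one_eq_word del: single_one)
  then have "\<phi> (opp_verma_gen \<mu>) = v"
    by (simp add: opp_verma_gen_def one_env_alg \<phi> frag_closed h_X keys_one_subset del: keys_one)
  ultimately show ?thesis unfolding is_opp_verma_def by blast
qed

section \<open>The module structure of \<open>\<Gamma>\<close>\<close>

lemma bp_const_simps:
  "bp_const (c + d) = bp_const c + bp_const d" "bp_const (c * d) = bp_const c * bp_const d"
  "bp_const (- c) = - bp_const c" "bp_const (c - d) = bp_const c - bp_const d"
  "bp_const 0 = 0" "bp_const 1 = 1"
  by (simp_all add: bp_const_def one_pCons)

lemma bp_const_numeral: "bp_const (numeral n) = numeral n"
  by (simp add: bp_const_def numeral_poly)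

lemma poly_bp_const [simp]: "poly (bp_const c) x = [:c:]"
  by (simp add: bp_const_def)

lemma bp_shift_simps [simp]:
  "bp_shift c (p + q) = bp_shift c p + bp_shift c q" "bp_shift c (p * q) = bp_shift c p * bp_shift c q"
  "bp_shift c (- p) = - bp_shift c p"
  "bp_shift c (bp_const d) = bp_const d" "bp_shift c bp_h = bp_h + bp_const c"
  "bp_shift c bp_hbar = bp_hbar"
  by (simp_all add: bp_shift_def pcompose_add pcompose_mult pcompose_uminus bp_const_def bp_h_def bp_hbar_def
      pcompose_pCons)

lemma bp_shift_shift [simp]: "bp_shift c (bp_shift d p) = bp_shift (d + c) p"
  by (simp add: bp_shift_def pcompose_add flip: pcompose_assoc)
    (simp add: bp_h_def bp_const_def pcompose_pCons algebra_simps)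

lemma bp_shift_zero [simp]: "bp_shift 0 p = p"
  by (simp add: bp_shift_def bp_h_def bp_const_def pcompose_idR)

lemma coeff_bp_dbar: "coeff (bp_dbar p) n = pderiv (coeff p n)"
  by (simp add: bp_dbar_def coeff_map_poly)

lemma bp_dbar_simps [simp]:
  "bp_dbar (p + q) = bp_dbar p + bp_dbar q" "bp_dbar (p * q) = bp_dbar p * q + p * bp_dbar q"
  "bp_dbar (- p) = - bp_dbar p" "bp_dbar 0 = 0"
  "bp_dbar (bp_const d) = 0" "bp_dbar bp_h = 0" "bp_dbar bp_hbar = 1"
proof -
  show "bp_dbar (p * q) = bp_dbar p * q + p * bp_dbar q"
  proof (rule poly_eqI)
    fix n
    have "pderiv (\<Sum>i\<le>n. coeff p i * coeff q (n - i)) = (\<Sum>i\<le>n. pderiv (coeff p i * coeff q (n - i)))"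
      using higher_pderiv_sum[of 1] by simp
    then show "coeff (bp_dbar (p * q)) n = coeff (bp_dbar p * q + p * bp_dbar q) n"
      by (auto simp: coeff_bp_dbar coeff_mult pderiv_mult mult.commute[of "coeff q _"] simp flip: sum.distrib
          intro!: sum.cong)
  qed
qed (auto intro!: poly_eqI simp: coeff_bp_dbar pderiv_add pderiv_minus bp_const_def bp_h_def bp_hbar_def
      coeff_pCons pderiv_pCons one_pCons split: nat.split)

lemma bp_shift_simps' [simp]:
  "bp_shift c 0 = 0" "bp_shift c 1 = 1" "bp_shift c (numeral n) = numeral n"
  "bp_shift c (p - q) = bp_shift c p - bp_shift c q"
  using bp_shift_simps(4)[of c 0] bp_shift_simps(4)[of c 1] bp_shift_simps(4)[of c "numeral n"]
    bp_shift_simps(1)[of c "p - q" q]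
  by (simp_all add: bp_const_simps bp_const_numeral)

lemma bp_dbar_simps' [simp]:
  "bp_dbar 1 = 0" "bp_dbar (numeral n) = 0" "bp_dbar (p - q) = bp_dbar p - bp_dbar q"
  using bp_dbar_simps(5)[of 1] bp_dbar_simps(5)[of "numeral n"] bp_dbar_simps(1)[of "p - q" q]
  by (simp_all add: bp_const_simps bp_const_numeral)

lemma bp_pCons: "pCons a p = [:a:] + bp_h * p"
  by (simp add: bp_h_def)

lemma bp_dbar_shift [simp]: "bp_dbar (bp_shift c p) = bp_shift c (bp_dbar p)"
proof (induction p)
  case 0 show ?case by (simp add: bp_shift_def)
next
  case (pCons a p)
  have "bp_shift c [:x:] = [:x:]" "bp_dbar [:x:] = [:pderiv x:]" for x
    by (auto intro!: poly_eqI simp: bp_shift_def coeff_bp_dbar coeff_pCons split: nat.split)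
  then show ?case using pCons by (subst (1 2) bp_pCons) simp
qed

locale Gam_params =
  fixes l a b :: complex
  assumes l: "l \<noteq> 0"
begin

abbreviation "E \<equiv> Gam_e l"
abbreviation "F \<equiv> Gam_f l a b"
abbreviation "Eb \<equiv> Gam_ebar l"
abbreviation "Fb \<equiv> Gam_fbar l a"

lemma Gam_ops_linear:
  "E (p + q) = E p + E q" "E (bp_const c * p) = bp_const c * E p"
  "Eb (p + q) = Eb p + Eb q" "Eb (bp_const c * p) = bp_const c * Eb p"
  "F (p + q) = F p + F q" "F (bp_const c * p) = bp_const c * F p"
  "Fb (p + q) = Fb p + Fb q" "Fb (bp_const c * p) = bp_const c * Fb p"
  by (simp_all add: Gam_e_def Gam_ebar_def Gam_f_def Gam_fbar_def algebra_simps)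

lemma const_mult_const: "bp_const c * (bp_const d * p) = bp_const (c * d) * p"
  by (simp add: bp_const_simps mult.assoc)

text \<open>The operators of \<open>\<Gamma>\<close> without their scalar factors. Their commutators are identities between
  polynomials and derivatives in which \<open>l\<close> does not occur.\<close>

definition "E0 p = bp_dbar (bp_shift (-2) p)"
definition "F0 p = ((bp_h + bp_const 2) * bp_hbar + bp_const b) * bp_shift 2 p
  + (bp_hbar ^ 2 + bp_const a) * bp_dbar (bp_shift 2 p)"
definition "S0 p = bp_shift (-2) p"
definition "T0 p = (bp_hbar ^ 2 + bp_const a) * bp_shift 2 p"

lemma unscaled:
  "E p = bp_const (- 2 * l) * E0 p" "F p = bp_const (- 1 / (2 * l)) * F0 p"
  "Eb p = bp_const l * S0 p" "Fb p = bp_const (- 1 / (4 * l)) * T0 p"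
  by (simp_all add: Gam_e_def Gam_f_def Gam_ebar_def Gam_fbar_def E0_def F0_def S0_def T0_def algebra_simps)

lemma unscaled_linear:
  "E0 (bp_const c * p) = bp_const c * E0 p" "F0 (bp_const c * p) = bp_const c * F0 p"
  "S0 (bp_const c * p) = bp_const c * S0 p" "T0 (bp_const c * p) = bp_const c * T0 p"
  by (simp_all add: E0_def F0_def S0_def T0_def algebra_simps)

lemma unscaled_commutators:
  "E0 (F0 p) = F0 (E0 p) + bp_h * p"
  "E0 (T0 p) = T0 (E0 p) + bp_const 2 * (bp_hbar * p)"
  "S0 (F0 p) = F0 (S0 p) - bp_const 2 * (bp_hbar * p)"
  "S0 (T0 p) = T0 (S0 p)"
  "E0 (S0 p) = S0 (E0 p)"
  "F0 (T0 p) = T0 (F0 p)"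
  "bp_h * E0 p = E0 (bp_h * p) + bp_const 2 * E0 p"
  "bp_h * S0 p = S0 (bp_h * p) + bp_const 2 * S0 p"
  "bp_hbar * E0 p = E0 (bp_hbar * p) - S0 p"
  "bp_hbar * S0 p = S0 (bp_hbar * p)"
  "bp_h * F0 p = F0 (bp_h * p) - bp_const 2 * F0 p"
  "bp_h * T0 p = T0 (bp_h * p) - bp_const 2 * T0 p"
  "bp_hbar * F0 p = F0 (bp_hbar * p) - T0 p"
  "bp_hbar * T0 p = T0 (bp_hbar * p)"
  by (simp_all add: E0_def F0_def S0_def T0_def bp_const_numeral bp_const_simps(3)
      power2_eq_square algebra_simps)

lemma Gam_commutators:
  "E (F p) = F (E p) + bp_h * p"
  "E (Fb p) = Fb (E p) + bp_hbar * p"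
  "Eb (F p) = F (Eb p) + bp_hbar * p"
  "Eb (Fb p) = Fb (Eb p)"
  "E (Eb p) = Eb (E p)"
  "F (Fb p) = Fb (F p)"
  "bp_h * E p = E (bp_h * p) + bp_const 2 * E p"
  "bp_h * Eb p = Eb (bp_h * p) + bp_const 2 * Eb p"
  "bp_hbar * E p = E (bp_hbar * p) + bp_const 2 * Eb p"
  "bp_hbar * Eb p = Eb (bp_hbar * p)"
  "bp_h * F p = F (bp_h * p) - bp_const 2 * F p"
  "bp_h * Fb p = Fb (bp_h * p) - bp_const 2 * Fb p"
  "bp_hbar * F p = F (bp_hbar * p) - bp_const 2 * Fb p"
  "bp_hbar * Fb p = Fb (bp_hbar * p)"
  using l
  by (simp_all add: const_mult_const unscaled unscaled_linear unscaled_commutators ring_distribs bp_const_simps(5,6)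
        mult.left_commute[of bp_h] mult.left_commute[of bp_hbar])
     (simp_all add: bp_const_simps(3,6) mult_ac)

text \<open>Two central elements of \<open>U(g)\<close> act on \<open>\<Gamma>\<close> by scalars, from which \<open>a\<close> and \<open>b\<close> can be read off.
  The orderings of the factors are those for which no term of lower degree is left over.\<close>

lemma Gam_casimirs:
  "bp_hbar * (bp_hbar * p) + bp_const 4 * Fb (Eb p) = bp_const (- a) * p"
  "F (Eb p) + E (Fb p) + bp_const (1/2) * (bp_h * (bp_hbar * p)) = bp_const (- b / 2) * p"
proof -
  have "bp_const 4 * Fb (Eb p) = bp_const (- 1) * T0 (S0 p)"
    using l by (simp add: const_mult_const unscaled unscaled_linear)
  then show "bp_hbar * (bp_hbar * p) + bp_const 4 * Fb (Eb p) = bp_const (- a) * p"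
    by (simp add: T0_def S0_def power2_eq_square algebra_simps bp_const_simps)
  have "F (Eb p) = bp_const (- 1 / 2) * F0 (S0 p)" "E (Fb p) = bp_const (1 / 2) * E0 (T0 p)"
    using l by (simp_all add: const_mult_const unscaled unscaled_linear)
  moreover have "bp_const (- 1 / 2) = - bp_const (1 / 2)"
    using bp_const_simps(3)[of "1 / 2"] by simp
  ultimately have "F (Eb p) + E (Fb p) = - bp_const (1 / 2) * (F0 (S0 p) - E0 (T0 p))"
    by (simp add: ring_distribs)
  also have "F0 (S0 p) - E0 (T0 p) = (bp_h * bp_hbar + bp_const b) * p"
    by (simp add: E0_def F0_def T0_def S0_def power2_eq_square algebra_simps bp_const_numeral
        bp_const_simps(3))
  finally show "F (Eb p) + E (Fb p) + bp_const (1/2) * (bp_h * (bp_hbar * p)) = bp_const (- b / 2) * p"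
    by (simp add: ring_distribs bp_const_simps(3) mult.assoc const_mult_const)
qed

abbreviation "\<Gamma> \<equiv> Gam l a b"

lemma act_Gam:
  "act \<Gamma> x p = bp_const (fst x $ 1 $ 2) * E p + bp_const (fst x $ 1 $ 1) * (bp_h * p)
        + bp_const (fst x $ 2 $ 1) * F p + bp_const (snd x $ 1 $ 2) * Eb p
        + bp_const (snd x $ 1 $ 1) * (bp_hbar * p) + bp_const (snd x $ 2 $ 1) * Fb p"
  by (simp add: Gam_def)

lemma act_Gam_basis:
  "act \<Gamma> tk_h p = bp_h * p" "act \<Gamma> tk_hbar p = bp_hbar * p"
  "act \<Gamma> tk_e p = E p" "act \<Gamma> tk_ebar p = Eb p" "act \<Gamma> tk_f p = F p" "act \<Gamma> tk_fbar p = Fb p"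
  by (simp_all add: act_Gam tk_h_def tk_hbar_def tk_e_def tk_ebar_def tk_f_def tk_fbar_def bp_const_simps)

lemma act_Gam_linear:
  "act \<Gamma> x (p + q) = act \<Gamma> x p + act \<Gamma> x q"
  "act \<Gamma> x (bp_const c * p) = bp_const c * act \<Gamma> x p"
  unfolding act_Gam Gam_ops_linear by (simp_all add: algebra_simps)

text \<open>Both sides are bilinear in \<open>x\<close> and \<open>y\<close>, so the commutators of the six basis elements decide.\<close>

lemma act_Gam_bracket:
  assumes "x \<in> takiff" "y \<in> takiff"
  shows "act \<Gamma> (takiff_bracket x y) p = act \<Gamma> x (act \<Gamma> y p) - act \<Gamma> y (act \<Gamma> x p)"
proof -
  obtain A B C D where xy: "x = (A, B)" "y = (C, D)" by (cases x, cases y)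
  have tr: "A $ 2 $ 2 = - A $ 1 $ 1" "B $ 2 $ 2 = - B $ 1 $ 1" "C $ 2 $ 2 = - C $ 1 $ 1" "D $ 2 $ 2 = - D $ 1 $ 1"
    using assms unfolding xy takiff_def by (auto simp: trace_def UNIV_2 eq_neg_iff_add_eq_0 add.commute)
  have br: "comm_bracket X Y $ i $ j = X $ i $ 1 * Y $ 1 $ j + X $ i $ 2 * Y $ 2 $ j
      - (Y $ i $ 1 * X $ 1 $ j + Y $ i $ 2 * X $ 2 $ j)" for X Y i j
    by (simp add: comm_bracket_def matrix_matrix_mult_def UNIV_2)
  \<comment> \<open>the coordinates of \<open>x\<close> and \<open>y\<close> and the two multiplications are made opaque, so that after
    expansion every term is a product of two coordinates and one composite of operators at \<open>p\<close>\<close>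
  define a1 where "a1 = bp_const (A $ 1 $ 2)"
  define a2 where "a2 = bp_const (A $ 1 $ 1)"
  define a3 where "a3 = bp_const (A $ 2 $ 1)"
  define a4 where "a4 = bp_const (B $ 1 $ 2)"
  define a5 where "a5 = bp_const (B $ 1 $ 1)"
  define a6 where "a6 = bp_const (B $ 2 $ 1)"
  define c1 where "c1 = bp_const (C $ 1 $ 2)"
  define c2 where "c2 = bp_const (C $ 1 $ 1)"
  define c3 where "c3 = bp_const (C $ 2 $ 1)"
  define c4 where "c4 = bp_const (D $ 1 $ 2)"
  define c5 where "c5 = bp_const (D $ 1 $ 1)"
  define c6 where "c6 = bp_const (D $ 2 $ 1)"
  note defs = a1_def a2_def a3_def a4_def a5_def a6_def c1_def c2_def c3_def c4_def c5_def c6_def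
  define H where "H = (*) bp_h"
  define Hb where "Hb = (*) bp_hbar"
  have H_lin: "H (u + v) = H u + H v" "Hb (u + v) = Hb u + Hb v" for u v
    by (simp_all add: H_def Hb_def ring_distribs)
  let ?z = "takiff_bracket x y"
  have coeffs: "bp_const (fst ?z $ 1 $ 2) = 2 * (a2 * c1 - c2 * a1)"
    "bp_const (fst ?z $ 1 $ 1) = a1 * c3 - c1 * a3"
    "bp_const (fst ?z $ 2 $ 1) = 2 * (a3 * c2 - c3 * a2)"
    "bp_const (snd ?z $ 1 $ 2) = 2 * ((a2 * c4 - c5 * a1) + (a5 * c1 - c2 * a4))"
    "bp_const (snd ?z $ 1 $ 1) = (a1 * c6 - c4 * a3) + (a4 * c3 - c1 * a6)"
    "bp_const (snd ?z $ 2 $ 1) = 2 * ((a3 * c5 - c6 * a2) + (a6 * c2 - c3 * a5))"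
    unfolding defs bp_const_simps[symmetric] bp_const_numeral[symmetric]
    by (simp_all add: takiff_bracket_def xy br tr algebra_simps)
  have L: "act \<Gamma> ?z p =
      2 * (a2 * c1 - c2 * a1) * E p + (a1 * c3 - c1 * a3) * H p + 2 * (a3 * c2 - c3 * a2) * F p
      + 2 * ((a2 * c4 - c5 * a1) + (a5 * c1 - c2 * a4)) * Eb p
      + ((a1 * c6 - c4 * a3) + (a4 * c3 - c1 * a6)) * Hb p
      + 2 * ((a3 * c5 - c6 * a2) + (a6 * c2 - c3 * a5)) * Fb p"
    unfolding act_Gam coeffs H_def Hb_def ..
  have X: "act \<Gamma> x q = a1 * E q + a2 * H q + a3 * F q + a4 * Eb q + a5 * Hb q + a6 * Fb q" for q
    by (simp add: act_Gam xy defs H_def Hb_def)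
  have Y: "act \<Gamma> y q = c1 * E q + c2 * H q + c3 * F q + c4 * Eb q + c5 * Hb q + c6 * Fb q" for q
    by (simp add: act_Gam xy defs H_def Hb_def)
  have in_range: "u \<in> range bp_const" if "u \<in> {a1, a2, a3, a4, a5, a6, c1, c2, c3, c4, c5, c6}" for u
    using that by (auto simp: defs)
  have scale: "E (u * q) = u * E q" "F (u * q) = u * F q" "Eb (u * q) = u * Eb q"
    "Fb (u * q) = u * Fb q" "H (u * q) = u * H q" "Hb (u * q) = u * Hb q"
    if "u \<in> {a1, a2, a3, a4, a5, a6, c1, c2, c3, c4, c5, c6}" for u q
    using in_range[OF that] by (auto simp: Gam_ops_linear H_def Hb_def)
  have comm: "E (F p) = F (E p) + H p" "E (Fb p) = Fb (E p) + Hb p" "Eb (F p) = F (Eb p) + Hb p"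
    "Eb (Fb p) = Fb (Eb p)" "E (Eb p) = Eb (E p)" "F (Fb p) = Fb (F p)"
    "H (E p) = E (H p) + 2 * E p" "H (Eb p) = Eb (H p) + 2 * Eb p"
    "Hb (E p) = E (Hb p) + 2 * Eb p" "Hb (Eb p) = Eb (Hb p)"
    "H (F p) = F (H p) - 2 * F p" "H (Fb p) = Fb (H p) - 2 * Fb p"
    "Hb (F p) = F (Hb p) - 2 * Fb p" "Hb (Fb p) = Fb (Hb p)" "H (Hb p) = Hb (H p)"
    using Gam_commutators[of p] by (simp_all add: H_def Hb_def bp_const_numeral)
  show ?thesis
    unfolding L X Y Gam_ops_linear(1,3,5,7) H_lin
    by (simp only: scale insert_iff simp_thms comm) (simp add: algebra_simps)
qed

end

section \<open>The functionals \<open>\<eta>\<close>\<close>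

text \<open>The coefficient functional of a Taylor expansion in \<open>hbar\<close>, not divided by the factorial.
  Derivatives are counted from 0, so that the index \<open>s\<close> of \<open>\<eta>\<close> corresponds to \<open>i = s - 1\<close>.\<close>

definition jet :: "complex \<Rightarrow> complex \<Rightarrow> nat \<Rightarrow> bipoly \<Rightarrow> complex" where
  "jet c \<beta> i p = poly ((pderiv ^^ i) (poly p [:c:])) \<beta>"

lemma jet_add [simp]: "jet c \<beta> i (p + q) = jet c \<beta> i p + jet c \<beta> i q"
  by (simp add: jet_def higher_pderiv_add)

lemma jet_diff [simp]: "jet c \<beta> i (p - q) = jet c \<beta> i p - jet c \<beta> i q"
  using jet_add[of c \<beta> i "p - q" q] by simp

lemma jet_const [simp]: "jet c \<beta> i (bp_const z * p) = z * jet c \<beta> i p"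
  by (simp add: jet_def higher_pderiv_smult)

lemma jet_h [simp]: "jet c \<beta> i (bp_h * p) = c * jet c \<beta> i p"
  by (simp add: jet_def bp_h_def higher_pderiv_smult)

lemma higher_pderiv_linear_mult:
  "(pderiv ^^ i) ([:0, 1:] * p) = [:0, 1:] * (pderiv ^^ i) p + Polynomial.smult (of_nat i) ((pderiv ^^ (i - 1)) (p :: complex poly))"
proof (induction i)
  case (Suc i)
  then show ?case
    by (cases i) (simp_all add: pderiv_add pderiv_mult pderiv_pCons pderiv_smult smult_add_left numeral_poly algebra_simps)
qed simp

lemma jet_hbar [simp]: "jet c \<beta> i (bp_hbar * p) = \<beta> * jet c \<beta> i p + of_nat i * jet c \<beta> (i - 1) p"
proof -
  have "poly (bp_hbar * p) [:c:] = [:0, 1:] * poly p [:c:]" by (simp add: bp_hbar_def)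
  then show ?thesis unfolding jet_def by (simp only: higher_pderiv_linear_mult) simp
qed

lemma jet_shift [simp]: "jet c \<beta> i (bp_shift d p) = jet (c + d) \<beta> i p"
  by (simp add: jet_def bp_shift_def poly_pcompose bp_h_def)

lemma poly_bp_dbar: "poly (bp_dbar p) [:c:] = pderiv (poly p [:c:])"
proof (induction p)
  case (pCons x p)
  have "bp_dbar (pCons x p) = pCons (pderiv x) (bp_dbar p)"
    by (rule poly_eqI) (auto simp: coeff_bp_dbar coeff_pCons split: nat.split)
  then show ?case using pCons.IH by (simp add: pderiv_add pderiv_mult pderiv_smult pderiv_pCons)
qed simp

lemma jet_dbar [simp]: "jet c \<beta> i (bp_dbar p) = jet c \<beta> (Suc i) p"
  by (simp add: jet_def poly_bp_dbar funpow_Suc_right del: funpow.simps)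

lemma jet_basis:
  "jet c \<beta> i ((bp_h - bp_const c) ^ m * (bp_hbar - bp_const \<beta>) ^ j) = (if m = 0 \<and> j = i then fact i else 0)"
proof (cases m)
  case 0
  have d: "jet c \<beta> i ((bp_hbar - bp_const \<beta>) * q) = of_nat i * jet c \<beta> (i - 1) q" for q i
    by (simp add: left_diff_distrib)
  have "jet c \<beta> i ((bp_hbar - bp_const \<beta>) ^ j) = (if j = i then fact i else 0)"
  proof (induction j arbitrary: i)
    case 0
    show ?case by (cases i) (simp_all add: jet_def funpow_Suc_right higher_pderiv_0 del: funpow.simps)
  next
    case (Suc j)
    then show ?case by (cases i) (simp_all add: d)
  qed
  then show ?thesis using 0 by simp
next
  case (Suc m')
  have "jet c \<beta> i ((bp_h - bp_const c) * q) = 0" for q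
    by (simp add: left_diff_distrib)
  then show ?thesis using Suc by (simp add: mult.assoc)
qed

lemma bipoly_induct [case_names const add h hbar]:
  fixes P :: "bipoly \<Rightarrow> bool"
  assumes "\<And>c. P (bp_const c)" "\<And>p q. P p \<Longrightarrow> P q \<Longrightarrow> P (p + q)"
    and "\<And>p. P p \<Longrightarrow> P (bp_h * p)" "\<And>p. P p \<Longrightarrow> P (bp_hbar * p)"
  shows "P p"
proof (induction p)
  case 0 show ?case using assms(1)[of 0] by (simp add: bp_const_simps)
next
  case (pCons x p)
  have "P [:x:]"
  proof (induction x)
    case 0 show ?case using assms(1)[of 0] by (simp add: bp_const_simps)
  next
    case (pCons y x)
    have "P (bp_const y + bp_hbar * [:x:])" by (intro assms pCons.IH)
    also have "bp_const y + bp_hbar * [:x:] = [:pCons y x:]" by (simp add: bp_const_def bp_hbar_def)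
    finally show ?case .
  qed
  then show ?case using assms pCons by (subst bp_pCons) simp
qed

text \<open>The description of \<open>\<eta>\<close> on the products of powers of \<open>h - \<alpha>\<^sub>k\<close> and \<open>hbar - \<beta>\<close> determines it
  because these products span all polynomials: their span contains 1 and is stable under
  multiplication by \<open>h\<close> and \<open>hbar\<close>.\<close>

lemma eta_eq_jet: "s \<ge> 1 \<Longrightarrow> eta \<alpha> \<beta> k s = jet (alpha_at \<alpha> k) \<beta> (s - 1)"
  unfolding eta_def
proof (rule the_equality)
  let ?c = "alpha_at \<alpha> k"
  let ?X = "bp_h - bp_const ?c" and ?Y = "bp_hbar - bp_const \<beta>"
  fix \<phi> :: "bipoly \<Rightarrow> complex"
  assume \<phi>: "(\<forall>p q. \<phi> (p + q) = \<phi> p + \<phi> q) \<and> (\<forall>c p. \<phi> (bp_const c * p) = c * \<phi> p) \<and>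
     (\<forall>i j. \<phi> (?X ^ i * ?Y ^ j) = (if i = 0 \<and> j = s - 1 then fact (s - 1) else 0))"
  then have plus: "\<phi> (p + q) = \<phi> p + \<phi> q" and times: "\<phi> (bp_const z * p) = z * \<phi> p"
    and basis: "\<phi> (?X ^ i * ?Y ^ j) = jet ?c \<beta> (s - 1) (?X ^ i * ?Y ^ j)" for p q z i j
    by (auto simp: jet_basis)
  have "\<forall>i j. \<phi> (?X ^ i * ?Y ^ j * p) = jet ?c \<beta> (s - 1) (?X ^ i * ?Y ^ j * p)" for p
  proof (induction p rule: bipoly_induct)
    case (const c)
    show ?case by (simp only: mult.commute[of _ "bp_const c"] times jet_const basis) simp
  next
    case (add p q)
    then show ?case by (simp only: distrib_left plus jet_add) simp
  next
    case (h p)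
    have "?X ^ i * ?Y ^ j * (bp_h * p) = ?X ^ Suc i * ?Y ^ j * p + bp_const ?c * (?X ^ i * ?Y ^ j * p)" for i j
      by (simp add: algebra_simps)
    then show ?case by (simp only: plus times jet_add jet_const h[rule_format]) simp
  next
    case (hbar p)
    have "?X ^ i * ?Y ^ j * (bp_hbar * p) = ?X ^ i * ?Y ^ Suc j * p + bp_const \<beta> * (?X ^ i * ?Y ^ j * p)" for i j
      by (simp add: algebra_simps)
    then show ?case by (simp only: plus times jet_add jet_const hbar[rule_format]) simp
  qed
  then have "\<phi> (?X ^ 0 * ?Y ^ 0 * p) = jet ?c \<beta> (s - 1) (?X ^ 0 * ?Y ^ 0 * p)" for p by blast
  then show "\<phi> = jet ?c \<beta> (s - 1)" by auto
qed (simp add: jet_basis)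

section \<open>The dual of \<open>\<Gamma>\<close>\<close>

context Gam_params
begin

abbreviation "D \<equiv> dual_rep \<Gamma>"

lemma carrier_D:
  "\<phi> \<in> carrier D \<longleftrightarrow> (\<forall>p q. \<phi> (p + q) = \<phi> p + \<phi> q) \<and> (\<forall>c p. \<phi> (bp_const c * p) = c * \<phi> p)"
  by (simp add: dual_rep_def Gam_def)

lemma D_simps [simp]:
  "\<phi> \<oplus>\<^bsub>D\<^esub> \<psi> = (\<lambda>p. \<phi> p + \<psi> p)" "c \<odot>\<^bsub>D\<^esub> \<phi> = (\<lambda>p. c * \<phi> p)" "\<zero>\<^bsub>D\<^esub> = (\<lambda>p. 0)"
  "act D x \<phi> = (\<lambda>p. - \<phi> (act \<Gamma> x p))"
  by (simp_all add: dual_rep_def Gam_def restrict_def)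

lemma abelian_group_D: "abelian_group D"
proof (rule abelian_groupI)
  fix \<phi> assume "\<phi> \<in> carrier D"
  then show "\<exists>\<psi>\<in>carrier D. \<psi> \<oplus>\<^bsub>D\<^esub> \<phi> = \<zero>\<^bsub>D\<^esub>"
    by (intro bexI[of _ "\<lambda>p. - \<phi> p"]) (auto simp: carrier_D)
qed (simp_all add: carrier_D ring_distribs add_ac)

lemma uminus_D: "\<phi> \<in> carrier D \<Longrightarrow> \<ominus>\<^bsub>D\<^esub> \<phi> = (\<lambda>p. - \<phi> p)"
  by (rule abelian_group.minus_equality[OF abelian_group_D]) (auto simp: carrier_D)

lemma minus_D: "\<psi> \<in> carrier D \<Longrightarrow> \<phi> \<ominus>\<^bsub>D\<^esub> \<psi> = (\<lambda>p. \<phi> p - \<psi> p)"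
  by (simp add: a_minus_def uminus_D)

lemma act_D_closed: "\<phi> \<in> carrier D \<Longrightarrow> act D x \<phi> \<in> carrier D"
  by (simp add: carrier_D act_Gam_linear)

lemma D_diff: "\<phi> \<in> carrier D \<Longrightarrow> \<phi> (p - q) = \<phi> p - \<phi> q"
  unfolding carrier_D by (metis add_diff_cancel_right' diff_add_cancel)

text \<open>Passing to the dual reverses products, hence the order of the factors compared with \<open>\<Gamma>\<close>.\<close>

lemma casimirs_D:
  assumes "\<phi> \<in> carrier D"
  shows "act D tk_hbar (act D tk_hbar \<phi>) p + 4 * act D tk_ebar (act D tk_fbar \<phi>) p = - a * \<phi> p"
    "act D tk_ebar (act D tk_f \<phi>) p + act D tk_fbar (act D tk_e \<phi>) p
      + 1 / 2 * act D tk_hbar (act D tk_h \<phi>) p = - b / 2 * \<phi> p"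
proof -
  have lin: "\<phi> (p + q) = \<phi> p + \<phi> q" "\<phi> (bp_const c * p) = c * \<phi> p" for p q c
    using assms by (auto simp: carrier_D)
  show "act D tk_hbar (act D tk_hbar \<phi>) p + 4 * act D tk_ebar (act D tk_fbar \<phi>) p = - a * \<phi> p"
    using arg_cong[OF Gam_casimirs(1)[of p], of \<phi>] unfolding lin by (simp add: act_Gam_basis)
  show "act D tk_ebar (act D tk_f \<phi>) p + act D tk_fbar (act D tk_e \<phi>) p
      + 1 / 2 * act D tk_hbar (act D tk_h \<phi>) p = - b / 2 * \<phi> p"
    using arg_cong[OF Gam_casimirs(2)[of p], of \<phi>] unfolding lin by (simp add: act_Gam_basis)
qed

lemma takiff_module_D: "takiff_module D"
proof (rule takiff_module.intro)
  show "module complex_field D"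
  proof (rule moduleI[OF cring_complex_field abelian_group_D])
    fix c :: complex and \<phi> assume "\<phi> \<in> carrier D"
    then have "\<phi> (p + q) = \<phi> p + \<phi> q" "\<phi> (bp_const d * p) = d * \<phi> p" for p q d
      unfolding carrier_D by blast+
    then show "c \<odot>\<^bsub>D\<^esub> \<phi> \<in> carrier D"
      by (simp only: carrier_D D_simps distrib_left mult.left_commute) blast
  qed (simp_all add: ring_distribs mult.assoc)
  have scale: "act \<Gamma> (takiff_scale c x) p = bp_const c * act \<Gamma> x p" for c x p
    by (simp add: act_Gam takiff_scale_def bp_const_simps ring_distribs mult.assoc)
  have add: "act \<Gamma> (x + y) p = act \<Gamma> x p + act \<Gamma> y p" for x y p
    by (simp add: act_Gam bp_const_simps ring_distribs)
  have bracket: "act D (takiff_bracket x y) \<phi> = act D x (act D y \<phi>) \<ominus>\<^bsub>D\<^esub> act D y (act D x \<phi>)"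
    if "x \<in> takiff" "y \<in> takiff" "\<phi> \<in> carrier D" for x y \<phi>
    unfolding minus_D[OF act_D_closed[OF act_D_closed[OF that(3)]]]
    using that by (simp add: act_Gam_bracket D_diff)
  show "takiff_module_axioms D"
    unfolding takiff_module_axioms_def
    using bracket act_D_closed by (auto simp: scale add) (simp_all add: carrier_D)
qed

end

section \<open>The module \<open>M\<close>\<close>

lemma alpha_at_shift: "alpha_at \<alpha> k + 2 = alpha_at \<alpha> (k + 1)" "alpha_at \<alpha> k - 2 = alpha_at \<alpha> (k - 1)"
  by (simp_all add: alpha_at_def)

lemma alpha_at_eq_iff [simp]: "alpha_at \<alpha> k = alpha_at \<alpha> j \<longleftrightarrow> k = j"
  by (simp add: alpha_at_def)

locale jet_module = Gam_params l a b for l a b :: complex +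
  fixes \<alpha> \<beta> :: complex
begin

abbreviation V :: "int \<Rightarrow> nat \<Rightarrow> bipoly \<Rightarrow> complex" where
  "V k i \<equiv> jet (alpha_at \<alpha> k) \<beta> i"

lemma V_in_D [simp]: "V k i \<in> carrier D"
  by (simp add: carrier_D)

lemma jet_square:
  "jet c \<beta> i ((bp_hbar ^ 2 + bp_const a) * q) =
    (\<beta>\<^sup>2 + a) * jet c \<beta> i q + 2 * of_nat i * \<beta> * jet c \<beta> (i - 1) q + of_nat i * of_nat (i - 1) * jet c \<beta> (i - 2) q"
  by (simp add: distrib_right power2_eq_square mult.assoc numeral_2_eq_2)
     (simp add: algebra_simps)

text \<open>Transposes of the operators of \<open>\<Gamma>\<close>, by the Leibniz rule for derivatives in \<open>hbar\<close>. The truncated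
  differences \<open>i - 1\<close> and \<open>i - 2\<close> are harmless, as their terms have coefficient 0 when they are
  truncated.\<close>

lemma act_V:
  "act D tk_h (V k i) = (\<lambda>p. - alpha_at \<alpha> k * V k i p)"
  "act D tk_hbar (V k i) = (\<lambda>p. - \<beta> * V k i p - of_nat i * V k (i - 1) p)"
  "act D tk_e (V k i) = (\<lambda>p. 2 * l * V (k - 1) (i + 1) p)"
  "act D tk_ebar (V k i) = (\<lambda>p. - l * V (k - 1) i p)"
  "act D tk_fbar (V k i) = (\<lambda>p. 1 / (4 * l) * ((\<beta>\<^sup>2 + a) * V (k + 1) i p
      + 2 * of_nat i * \<beta> * V (k + 1) (i - 1) p + of_nat i * of_nat (i - 1) * V (k + 1) (i - 2) p))"
  "act D tk_f (V k i) = (\<lambda>p. 1 / (2 * l) * ((\<beta>\<^sup>2 + a) * V (k + 1) (i + 1) p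
      + ((alpha_at \<alpha> k + 2 * of_nat (i + 1)) * \<beta> + b) * V (k + 1) i p
      + of_nat i * (alpha_at \<alpha> k + of_nat i + 1) * V (k + 1) (i - 1) p))"
proof -
  show "act D tk_h (V k i) = (\<lambda>p. - alpha_at \<alpha> k * V k i p)"
    "act D tk_hbar (V k i) = (\<lambda>p. - \<beta> * V k i p - of_nat i * V k (i - 1) p)"
    by (simp_all add: act_Gam_basis)
  show "act D tk_e (V k i) = (\<lambda>p. 2 * l * V (k - 1) (i + 1) p)"
    "act D tk_ebar (V k i) = (\<lambda>p. - l * V (k - 1) i p)"
    by (simp_all add: act_Gam_basis Gam_e_def Gam_ebar_def alpha_at_shift del: bp_dbar_shift)
  show "act D tk_fbar (V k i) = (\<lambda>p. 1 / (4 * l) * ((\<beta>\<^sup>2 + a) * V (k + 1) i p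
      + 2 * of_nat i * \<beta> * V (k + 1) (i - 1) p + of_nat i * of_nat (i - 1) * V (k + 1) (i - 2) p))"
    by (simp add: act_Gam_basis Gam_fbar_def mult.assoc jet_square alpha_at_shift)
  have F: "Gam_f l a b p = bp_const (- 1 / (2 * l)) * (bp_h * (bp_hbar * bp_shift 2 p)
      + bp_const 2 * (bp_hbar * bp_shift 2 p) + bp_const b * bp_shift 2 p
      + (bp_hbar ^ 2 + bp_const a) * bp_dbar (bp_shift 2 p))" for p
    by (simp add: Gam_f_def algebra_simps)
  show "act D tk_f (V k i) = (\<lambda>p. 1 / (2 * l) * ((\<beta>\<^sup>2 + a) * V (k + 1) (i + 1) p
      + ((alpha_at \<alpha> k + 2 * of_nat (i + 1)) * \<beta> + b) * V (k + 1) i p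
      + of_nat i * (alpha_at \<alpha> k + of_nat i + 1) * V (k + 1) (i - 1) p))"
  proof (cases i)
    case 0
    then show ?thesis
      by (simp add: act_Gam_basis F jet_square alpha_at_shift del: bp_dbar_shift)
         (simp add: alpha_at_def algebra_simps)
  next
    case (Suc j)
    then show ?thesis
      by (cases j; simp add: act_Gam_basis F jet_square alpha_at_def mult.assoc del: bp_dbar_shift;
          simp add: algebra_simps)
  qed
qed

lemma act_D_basis:
  assumes "\<phi> \<in> carrier D"
  shows "act D x \<phi> = (\<lambda>p. fst x $ 1 $ 2 * act D tk_e \<phi> p + fst x $ 1 $ 1 * act D tk_h \<phi> p
    + fst x $ 2 $ 1 * act D tk_f \<phi> p + snd x $ 1 $ 2 * act D tk_ebar \<phi> p
    + snd x $ 1 $ 1 * act D tk_hbar \<phi> p + snd x $ 2 $ 1 * act D tk_fbar \<phi> p)"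
proof -
  have "\<phi> (p + q) = \<phi> p + \<phi> q" "\<phi> (bp_const c * p) = c * \<phi> p" for p q c
    using assms by (auto simp: carrier_D)
  then show ?thesis by (simp add: act_Gam_basis act_Gam[of x])
qed

text \<open>Coordinates on \<open>M\<close>: \<open>J\<close> turns finitely supported coefficients into a functional.\<close>

definition J :: "(int \<times> nat \<Rightarrow>\<^sub>0 complex) \<Rightarrow> bipoly \<Rightarrow> complex" where
  "J c p = (\<Sum>x\<in>keys c. lookup c x * V (fst x) (snd x) p)"

lemma J_superset:
  "finite A \<Longrightarrow> keys c \<subseteq> A \<Longrightarrow> J c p = (\<Sum>x\<in>A. lookup c x * V (fst x) (snd x) p)"
  unfolding J_def by (rule sum.mono_neutral_left) (auto simp: in_keys_iff)

lemma J_add: "J (c + d) p = J c p + J d p"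
  using keys_add[of c d]
  by (subst (1 2 3) J_superset[of "keys c \<union> keys d"])
     (auto simp: lookup_add ring_distribs sum.distrib)

lemma J_single [simp]: "J (Poly_Mapping.single x z) p = z * V (fst x) (snd x) p"
  by (subst J_superset[of "{x}"]) auto

lemma J_zero [simp]: "J 0 p = 0"
  by (simp add: J_def)

lemma J_diff: "J (c - d) p = J c p - J d p"
  using J_add[of "c - d" d p] by simp

lemma J_in_D: "J c \<in> carrier D"
  unfolding carrier_D J_def by (simp add: sum.distrib ring_distribs sum_distrib_left mult.left_commute)

text \<open>The linear span of the \<open>V k i\<close> with \<open>(k, i)\<close> in \<open>S\<close>.\<close>

definition SV :: "(int \<times> nat) set \<Rightarrow> (bipoly \<Rightarrow> complex) set" where
  "SV S = {J c | c. keys c \<subseteq> S}"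

lemma SV_least:
  assumes "(\<lambda>p. 0) \<in> H" "\<And>\<phi> \<psi>. \<phi> \<in> H \<Longrightarrow> \<psi> \<in> H \<Longrightarrow> (\<lambda>p. \<phi> p + \<psi> p) \<in> H"
    and "\<And>c \<phi>. \<phi> \<in> H \<Longrightarrow> (\<lambda>p. c * \<phi> p) \<in> H" "\<And>k i. (k, i) \<in> S \<Longrightarrow> V k i \<in> H"
  shows "SV S \<subseteq> H"
proof -
  have "J c \<in> H" if "keys c \<subseteq> S" for c
    using that
  proof (induction c rule: free_elt_induct)
    case zero
    have "J 0 = (\<lambda>p. 0)" by auto
    then show ?case using assms(1) by simp
  next
    case (single w c)
    have "J (Poly_Mapping.single w c) = (\<lambda>p. c * V (fst w) (snd w) p)" by auto
    then show ?case using assms(3)[OF assms(4), of "fst w" "snd w" c] single by simp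
  next
    case (add c d)
    have "J (c + d) = (\<lambda>p. J c p + J d p)" by (auto simp: J_add)
    then show ?case using assms(2) add by simp
  qed
  then show ?thesis by (auto simp: SV_def)
qed

lemma SV_zero: "(\<lambda>p. 0) \<in> SV S"
proof -
  have "J 0 = (\<lambda>p. 0)" by auto
  then show ?thesis unfolding SV_def by (auto intro!: exI[of _ 0])
qed

lemma SV_add: "\<phi> \<in> SV S \<Longrightarrow> \<psi> \<in> SV S \<Longrightarrow> (\<lambda>p. \<phi> p + \<psi> p) \<in> SV S"
proof -
  assume "\<phi> \<in> SV S" "\<psi> \<in> SV S"
  then obtain c d where "\<phi> = J c" "keys c \<subseteq> S" "\<psi> = J d" "keys d \<subseteq> S"
    by (auto simp: SV_def)
  then have "(\<lambda>p. \<phi> p + \<psi> p) = J (c + d)" "keys (c + d) \<subseteq> S"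
    by (auto simp: J_add intro: subsetD[OF keys_add_subset])
  then show ?thesis unfolding SV_def by blast
qed

lemma SV_single: "(k, i) \<in> S \<Longrightarrow> (\<lambda>p. c * V k i p) \<in> SV S"
proof -
  assume "(k, i) \<in> S"
  then have "(\<lambda>p. c * V k i p) = J (Poly_Mapping.single (k, i) c)"
     "keys (Poly_Mapping.single (k, i) c) \<subseteq> S" by auto
  then show ?thesis unfolding SV_def by blast
qed

lemma SV_V: "(k, i) \<in> S \<Longrightarrow> V k i \<in> SV S"
  using SV_single[of k i S 1] by simp

lemma SV_scale: "\<phi> \<in> SV S \<Longrightarrow> (\<lambda>p. c * \<phi> p) \<in> SV S"
proof -
  have "(\<lambda>p. c * J e p) \<in> SV S" if "keys e \<subseteq> S" for e
    using that
  proof (induction e rule: free_elt_induct)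
    case (single w z)
    then show ?case using SV_single[of "fst w" "snd w" S "c * z"] by (simp add: mult.assoc)
  next
    case (add d e)
    then show ?case using SV_add[OF add.IH] by (simp add: J_add distrib_left)
  qed (simp add: SV_zero)
  then show "\<phi> \<in> SV S \<Longrightarrow> (\<lambda>p. c * \<phi> p) \<in> SV S" by (auto simp: SV_def)
qed

lemma SV_subset_D: "SV S \<subseteq> carrier D"
  by (auto simp: SV_def J_in_D)

lemma SV_submodule:
  assumes "\<And>k i x. (k, i) \<in> S \<Longrightarrow> x \<in> {tk_e, tk_h, tk_f, tk_ebar, tk_hbar, tk_fbar} \<Longrightarrow> act D x (V k i) \<in> SV S"
  shows "takiff_submodule (SV S) D"
proof (rule takiff_module.takiff_submoduleI[OF takiff_module_D])
  fix x \<phi> assume "x \<in> takiff" "\<phi> \<in> SV S"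
  have "SV S \<subseteq> {\<phi> \<in> carrier D. act D x \<phi> \<in> SV S}"
  proof (rule SV_least)
    show "(\<lambda>p. 0) \<in> {\<phi> \<in> carrier D. act D x \<phi> \<in> SV S}"
      using SV_zero by (simp add: carrier_D)
  next
    fix \<phi> \<psi> assume *: "\<phi> \<in> {\<phi> \<in> carrier D. act D x \<phi> \<in> SV S}" "\<psi> \<in> {\<phi> \<in> carrier D. act D x \<phi> \<in> SV S}"
    then have "(\<lambda>p. act D x \<phi> p + act D x \<psi> p) \<in> SV S" by (intro SV_add) auto
    then show "(\<lambda>p. \<phi> p + \<psi> p) \<in> {\<phi> \<in> carrier D. act D x \<phi> \<in> SV S}"
      using * by (simp add: carrier_D ring_distribs)
  next
    fix c \<phi> assume *: "\<phi> \<in> {\<phi> \<in> carrier D. act D x \<phi> \<in> SV S}"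
    then have "(\<lambda>p. c * act D x \<phi> p) \<in> SV S" by (intro SV_scale) auto
    then show "(\<lambda>p. c * \<phi> p) \<in> {\<phi> \<in> carrier D. act D x \<phi> \<in> SV S}"
      using * by (simp add: carrier_D ring_distribs mult.left_commute)
  next
    fix k i assume k: "(k, i) \<in> S"
    have "act D x (V k i) \<in> SV S"
      unfolding act_D_basis[OF V_in_D, of x] by (intro SV_add SV_scale assms[OF k]) auto
    then show "V k i \<in> {\<phi> \<in> carrier D. act D x \<phi> \<in> SV S}" by simp
  qed
  then show "act D x \<phi> \<in> SV S" using \<open>\<phi> \<in> SV S\<close> by auto
qed (auto simp: SV_zero SV_add SV_scale SV_subset_D[THEN subsetD])

lemma SV_diff: "\<phi> \<in> SV S \<Longrightarrow> \<psi> \<in> SV S \<Longrightarrow> (\<lambda>p. \<phi> p - \<psi> p) \<in> SV S"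
  using SV_add[OF _ SV_scale[of \<psi> S "-1"], of \<phi>] by simp

lemma SV_UNIV_submodule: "takiff_submodule (SV UNIV) D"
proof (rule SV_submodule)
  fix k i x assume "x \<in> {tk_e, tk_h, tk_f, tk_ebar, tk_hbar, tk_fbar}"
  then consider "x = tk_e" | "x = tk_h" | "x = tk_f" | "x = tk_ebar" | "x = tk_hbar" | "x = tk_fbar" by blast
  then show "act D x (V k i) \<in> SV UNIV"
    by cases (simp_all only: act_V, (intro SV_diff SV_add SV_scale SV_V UNIV_I)+)
qed

lemma carrier_M: "carrier (M_rep l \<alpha> \<beta> a b) = SV UNIV"
proof -
  interpret D: takiff_module D by (rule takiff_module_D)
  have eta: "{eta \<alpha> \<beta> k s | k s. s \<ge> 1} = {V k i | k i. True}" (is "?L = ?R")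
  proof
    show "?L \<subseteq> ?R" using eta_eq_jet by blast
    have "V k i \<in> ?L" for k i
      using eta_eq_jet[of "Suc i" \<alpha> \<beta> k] by (auto intro!: exI[of _ k] exI[of _ "Suc i"])
    then show "?R \<subseteq> ?L" by blast
  qed
  have "lin_span D {V k i | k i. True} = SV UNIV"
  proof
    have "submodule (SV UNIV) complex_field D" "{V k i | k i. True} \<subseteq> SV UNIV"
      using SV_UNIV_submodule by (auto simp: takiff_submodule_def SV_V)
    then show "lin_span D {V k i | k i. True} \<subseteq> SV UNIV" unfolding lin_span_def by blast
    have "SV UNIV \<subseteq> H" if H: "submodule H complex_field D" "{V k i | k i. True} \<subseteq> H" for H
    proof (rule SV_least)
      interpret S: submodule H complex_field D by (rule H)
      note HE = D.submoduleE[OF H(1)]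
      show "(\<lambda>p. 0) \<in> H" using S.one_closed by simp
      show "(\<lambda>p. \<phi> p + \<psi> p) \<in> H" if "\<phi> \<in> H" "\<psi> \<in> H" for \<phi> \<psi> using HE(5)[OF that] by simp
      show "(\<lambda>p. c * \<phi> p) \<in> H" if "\<phi> \<in> H" for c \<phi> using HE(4)[of c, OF _ that] by simp
      show "V k i \<in> H" for k i using H(2) by blast
    qed
    then show "SV UNIV \<subseteq> lin_span D {V k i | k i. True}" unfolding lin_span_def by blast
  qed
  then show ?thesis by (simp only: M_rep_def eta restrict_rep_simps)
qed

abbreviation "M \<equiv> M_rep l \<alpha> \<beta> a b"

lemma M_eq: "M = restrict_rep D (SV UNIV)"
  using carrier_M by (simp add: M_rep_def)

lemma takiff_module_M: "takiff_module M"
  unfolding M_eq by (rule takiff_module_restrict[OF takiff_module_D SV_UNIV_submodule])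

lemma M_simps:
  "\<phi> \<oplus>\<^bsub>M\<^esub> \<psi> = (\<lambda>p. \<phi> p + \<psi> p)" "c \<odot>\<^bsub>M\<^esub> \<phi> = (\<lambda>p. c * \<phi> p)" "\<zero>\<^bsub>M\<^esub> = (\<lambda>p. 0)" "act M = act D"
  by (simp_all add: M_eq)

lemma minus_M: "\<phi> \<in> SV UNIV \<Longrightarrow> \<psi> \<in> SV UNIV \<Longrightarrow> \<phi> \<ominus>\<^bsub>M\<^esub> \<psi> = (\<lambda>p. \<phi> p - \<psi> p)"
  unfolding M_eq
  by (subst a_minus_restrict[OF takiff_module_D SV_UNIV_submodule])
     (auto simp: minus_D SV_subset_D[THEN subsetD])

lemma submodule_SV:
  assumes "takiff_submodule H M" "\<And>k i. (k, i) \<in> S \<Longrightarrow> V k i \<in> H"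
  shows "SV S \<subseteq> H"
proof -
  interpret M: takiff_module M by (rule takiff_module_M)
  note HD = M.takiff_submoduleD[OF assms(1), unfolded M_simps]
  show ?thesis by (rule SV_least) (use HD(2,3,4) assms(2) in auto)
qed

section \<open>Coordinates\<close>

text \<open>\<open>Hop \<mu>\<close> and \<open>Bop \<mu>\<close> are \<open>h - \<mu>\<close> and \<open>hbar - \<mu>\<close> in coordinates.\<close>

definition Hop :: "complex \<Rightarrow> (int \<times> nat \<Rightarrow>\<^sub>0 complex) \<Rightarrow> (int \<times> nat \<Rightarrow>\<^sub>0 complex)" where
  "Hop \<mu> c = Poly_Mapping.mapp (\<lambda>x z. (- alpha_at \<alpha> (fst x) - \<mu>) * z) c"

definition Bop :: "complex \<Rightarrow> (int \<times> nat \<Rightarrow>\<^sub>0 complex) \<Rightarrow> (int \<times> nat \<Rightarrow>\<^sub>0 complex)" where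
  "Bop \<mu> c = Poly_Mapping.mapp (\<lambda>x z. (- \<beta> - \<mu>) * z) c
    - Poly_Mapping.mapp (\<lambda>x z. of_nat (snd x + 1) * z) (Poly_Mapping.map_key (\<lambda>(k, i). (k, Suc i)) c)"

lemma lookup_Hop: "lookup (Hop \<mu> c) (k, i) = (- alpha_at \<alpha> k - \<mu>) * lookup c (k, i)"
  by (simp add: Hop_def lookup_mapp when_def in_keys_iff)

lemma lookup_Bop:
  "lookup (Bop \<mu> c) (k, i) =
    (- \<beta> - \<mu>) * lookup c (k, i) - of_nat (i + 1) * lookup c (k, i + 1)"
proof -
  have "inj (\<lambda>(k :: int, i). (k, Suc i))" by (auto simp: inj_on_def)
  then have "lookup (Poly_Mapping.map_key (\<lambda>(k, i). (k, Suc i)) c) (k, i) = lookup c (k, Suc i)"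
    by (simp add: map_key.rep_eq)
  then show ?thesis
    by (simp add: Bop_def lookup_minus lookup_mapp when_def in_keys_iff)
qed

lemma J_Hop: "J (Hop \<mu> c) p = act D tk_h (J c) p - \<mu> * J c p"
proof -
  have "keys c \<subseteq> UNIV" by simp
  then show ?thesis
  proof (induction c rule: free_elt_induct)
    case zero
    have "Hop \<mu> 0 = 0" by (rule poly_mapping_eqI) (auto simp: lookup_Hop)
    then show ?case by simp
  next
    case (single x z)
    have "Hop \<mu> (Poly_Mapping.single x z) = Poly_Mapping.single x ((- alpha_at \<alpha> (fst x) - \<mu>) * z)"
      by (rule poly_mapping_eqI) (auto simp: lookup_Hop lookup_single when_def)
    then show ?case by (simp add: act_Gam_basis algebra_simps)
  next
    case (add c d)
    have "Hop \<mu> (c + d) = Hop \<mu> c + Hop \<mu> d"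
      by (rule poly_mapping_eqI) (auto simp: lookup_Hop lookup_add ring_distribs)
    then show ?case using add by (simp add: J_add ring_distribs)
  qed
qed

lemma J_Bop: "J (Bop \<mu> c) p = act D tk_hbar (J c) p - \<mu> * J c p"
proof -
  have "keys c \<subseteq> UNIV" by simp
  then show ?thesis
  proof (induction c rule: free_elt_induct)
    case zero
    have "Bop \<mu> 0 = 0" by (rule poly_mapping_eqI) (auto simp: lookup_Bop)
    then show ?case by simp
  next
    case (single x z)
    have "Bop \<mu> (Poly_Mapping.single x z) = Poly_Mapping.single x ((- \<beta> - \<mu>) * z)
        + Poly_Mapping.single (fst x, snd x - 1) (- of_nat (snd x) * z)"
    proof (rule poly_mapping_eqI)
      fix y :: "int \<times> nat"
      show "lookup (Bop \<mu> (Poly_Mapping.single x z)) y =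
        lookup (Poly_Mapping.single x ((- \<beta> - \<mu>) * z)
        + Poly_Mapping.single (fst x, snd x - 1) (- of_nat (snd x) * z)) y"
        by (cases x; cases y; cases "snd x")
           (auto simp: lookup_Bop lookup_single lookup_add when_def algebra_simps)
    qed
    then show ?case by (simp add: act_Gam_basis J_add algebra_simps)
  next
    case (add c d)
    have "Bop \<mu> (c + d) = Bop \<mu> c + Bop \<mu> d"
      by (rule poly_mapping_eqI) (auto simp: lookup_Bop lookup_add ring_distribs)
    then show ?case using add by (simp add: J_add ring_distribs)
  qed
qed

text \<open>Take a nonzero element of \<open>P\<close> that is minimal for a weighted count of its nonzero coordinates.
  If \<open>(k, i)\<close> is one of them, \<open>h + \<alpha>\<^sub>k\<close> removes it and creates none, while \<open>hbar + \<beta>\<close> shifts all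
  coordinates down by one in \<open>i\<close>. Both results are smaller, hence zero; so all coordinates have the
  same \<open>k\<close>, and \<open>i = 0\<close>.\<close>

lemma lowest_coordinate:
  assumes "c \<in> P" "c \<noteq> 0" and P: "\<And>\<mu> c. c \<in> P \<Longrightarrow> Hop \<mu> c \<in> P" "\<And>\<mu> c. c \<in> P \<Longrightarrow> Bop \<mu> c \<in> P"
  obtains k z where "z \<noteq> 0" "Poly_Mapping.single (k, 0) z \<in> P"
proof -
  \<comment> \<open>the summand 1 counts the coordinates with \<open>i = 0\<close>, which \<open>hbar + \<beta>\<close> kills\<close>
  define m :: "(int \<times> nat \<Rightarrow>\<^sub>0 complex) \<Rightarrow> nat" where "m c = (\<Sum>x\<in>keys c. snd x + 1)" for c
  have "\<exists>c. (c \<in> P \<and> c \<noteq> 0) \<and> (\<forall>d. d \<in> P \<and> d \<noteq> 0 \<longrightarrow> m c \<le> m d)"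
    by (rule ex_has_least_nat[of _ c]) (use assms(1,2) in blast)
  then obtain c where c: "c \<in> P" "c \<noteq> 0" and min: "\<And>d. d \<in> P \<Longrightarrow> d \<noteq> 0 \<Longrightarrow> m c \<le> m d"
    by blast
  have H: "k = k0" if k0: "(k0, i0) \<in> keys c" and k: "(k, i) \<in> keys c" for k0 i0 k i
  proof -
    let ?d = "Hop (- alpha_at \<alpha> k0) c"
    have "keys ?d \<subseteq> keys c - {(k0, i0)}"
      by (auto simp: in_keys_iff lookup_Hop)
    then have "m ?d \<le> (\<Sum>x\<in>keys c - {(k0, i0)}. snd x + 1)"
      unfolding m_def by (intro sum_mono2) auto
    also have "\<dots> < m c"
      unfolding m_def using k0 by (intro sum_strict_mono2[where b = "(k0, i0)"]) auto
    finally have "?d = 0" using min[of ?d] P(1)[OF c(1)] by fastforce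
    then have "lookup ?d (k, i) = 0" by simp
    then show ?thesis using k by (auto simp: lookup_Hop in_keys_iff)
  qed
  have B: "i = 0" if k: "(k, i) \<in> keys c" for k i
  proof -
    let ?d = "Bop (- \<beta>) c" and ?s = "\<lambda>(k :: int, i). (k, Suc i)"
    have keys: "?s ` keys ?d \<subseteq> keys c"
      by (auto simp: in_keys_iff lookup_Bop)
    have "m ?d = (\<Sum>x\<in>?s ` keys ?d. snd x)"
      unfolding m_def by (subst sum.reindex) (auto simp: inj_on_def intro!: sum.cong)
    also have "\<dots> \<le> (\<Sum>x\<in>keys c. snd x)" using keys by (intro sum_mono2) auto
    also have "\<dots> < m c" unfolding m_def using k by (intro sum_strict_mono) auto
    finally have "?d = 0" using min[of ?d] P(2)[OF c(1)] by fastforce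
    then have "lookup ?d (k, i - 1) = 0" by simp
    moreover have "1 + complex_of_nat n \<noteq> 0" for n using of_nat_neq_0[of n, where ?'a = complex] by simp
    ultimately show ?thesis using k by (cases i) (auto simp: lookup_Bop in_keys_iff)
  qed
  obtain k i where "(k, i) \<in> keys c"
    using c(2) by (metis all_not_in_conv keys_eq_empty surj_pair)
  then have k: "(k, 0) \<in> keys c" using B by auto
  have "c = Poly_Mapping.single (k, 0) (lookup c (k, 0))"
  proof (rule poly_mapping_eqI)
    fix x :: "int \<times> nat"
    show "lookup c x = lookup (Poly_Mapping.single (k, 0) (lookup c (k, 0))) x"
      using H[OF k, of "fst x" "snd x"] B[of "fst x" "snd x"]
      by (cases x) (auto simp: lookup_single when_def in_keys_iff)
  qed
  then show ?thesis using that[of "lookup c (k, 0)" k] k c(1) by (simp add: in_keys_iff)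
qed

text \<open>The kernel of \<open>J\<close> is stable under \<open>h\<close> and \<open>hbar\<close>, so if it were nonzero it would contain the
  coefficients of a multiple of some \<open>V k 0\<close>.\<close>

lemma J_eq_zeroD:
  assumes "J c = (\<lambda>p. 0)"
  shows "c = 0"
proof (rule ccontr)
  assume "c \<noteq> 0"
  let ?P = "{c. J c = (\<lambda>p. 0)}"
  have c: "c \<in> ?P" using assms by simp
  have "Hop \<mu> c \<in> ?P" "Bop \<mu> c \<in> ?P" if "c \<in> ?P" for \<mu> c
    using that by (auto simp: J_Hop J_Bop fun_eq_iff)
  then obtain k z where "z \<noteq> 0" "Poly_Mapping.single (k, 0) z \<in> ?P"
    by (rule lowest_coordinate[OF c \<open>c \<noteq> 0\<close>])
  then have "z * V k 0 (bp_const 1) = 0" by (auto simp: fun_eq_iff)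
  then show False using \<open>z \<noteq> 0\<close> by (simp add: jet_def)
qed

lemma J_inject: "J c = J d \<longleftrightarrow> c = d"
  using J_eq_zeroD[of "c - d"] by (auto simp: fun_eq_iff J_diff)

end

section \<open>Simplicity\<close>

context jet_module
begin

lemma V_nonzero: "V k 0 \<noteq> (\<lambda>p. 0)"
proof
  assume "V k 0 = (\<lambda>p. 0)"
  then have "V k 0 (bp_const 1) = 0" by simp
  then show False by (simp add: jet_def)
qed

lemma submodule_M_closed:
  assumes "takiff_submodule H M"
  shows "(\<lambda>p. 0) \<in> H" "\<phi> \<in> H \<Longrightarrow> \<psi> \<in> H \<Longrightarrow> (\<lambda>p. \<phi> p + \<psi> p) \<in> H"
    "\<phi> \<in> H \<Longrightarrow> (\<lambda>p. c * \<phi> p) \<in> H" "x \<in> takiff \<Longrightarrow> \<phi> \<in> H \<Longrightarrow> act D x \<phi> \<in> H" "H \<subseteq> SV UNIV"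
proof -
  interpret M: takiff_module M by (rule takiff_module_M)
  note HD = M.takiff_submoduleD[OF assms, unfolded M_simps carrier_M]
  show "(\<lambda>p. 0) \<in> H" "\<phi> \<in> H \<Longrightarrow> \<psi> \<in> H \<Longrightarrow> (\<lambda>p. \<phi> p + \<psi> p) \<in> H"
    "\<phi> \<in> H \<Longrightarrow> (\<lambda>p. c * \<phi> p) \<in> H" "x \<in> takiff \<Longrightarrow> \<phi> \<in> H \<Longrightarrow> act D x \<phi> \<in> H" "H \<subseteq> SV UNIV"
    by (fact HD)+
qed

lemma submodule_cancel:
  assumes "takiff_submodule H M" "(\<lambda>p. z * \<phi> p) \<in> H" "z \<noteq> 0"
  shows "\<phi> \<in> H"
  using submodule_M_closed(3)[OF assms(1,2), of "1 / z"] assms(3) by simp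

text \<open>Apply \<open>ebar\<close> until the first index is \<open>j + i\<close>, and then \<open>e\<close> \<open>i\<close> times.\<close>

lemma submodule_down:
  assumes H: "takiff_submodule H M" and k: "V k 0 \<in> H" and "j + int i \<le> k"
  shows "V j i \<in> H"
proof -
  have ebar: "V (m - 1) 0 \<in> H" if "V m 0 \<in> H" for m
    using submodule_M_closed(4)[OF H tk_in_takiff(4) that] submodule_cancel[OF H, of "- l" "V (m - 1) 0"] l
    unfolding act_V by simp
  have e: "V (m - 1) (n + 1) \<in> H" if "V m n \<in> H" for m n
    using submodule_M_closed(4)[OF H tk_in_takiff(1) that] submodule_cancel[OF H, of "2 * l"] l
    unfolding act_V by simp
  have "V (k - int n) 0 \<in> H" for n
  proof (induction n)
    case (Suc n) then show ?case using ebar[OF Suc] by (simp add: algebra_simps)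
  qed (use k in simp)
  from this[of "nat (k - (j + int i))"] have "V (j + int i) 0 \<in> H" using assms(3) by simp
  then have "V (j + int i - int n) n \<in> H" for n
  proof (induction n)
    case (Suc n) then show ?case using e[OF Suc.IH] by (simp add: algebra_simps)
  qed simp
  from this[of i] show ?thesis by simp
qed

text \<open>On \<open>V k 0\<close> the operator \<open>fbar\<close> has only its leading term, with coefficient \<open>\<beta>\<^sup>2 + a\<close> up to
  scaling. When this is zero, so is the coefficient of \<open>V (k + 1) 1\<close> in \<open>f (V k 0)\<close>, which is
  therefore a multiple of \<open>V (k + 1) 0\<close> as well.\<close>

lemma submodule_up:
  assumes H: "takiff_submodule H M" and k: "V k 0 \<in> H"
    and ne: "\<beta>\<^sup>2 + a \<noteq> 0 \<or> (alpha_at \<alpha> k + 2) * \<beta> + b \<noteq> 0"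
  shows "V (k + 1) 0 \<in> H"
proof (cases "\<beta>\<^sup>2 + a = 0")
  case False
  have "act D tk_fbar (V k 0) = (\<lambda>p. 1 / (4 * l) * (\<beta>\<^sup>2 + a) * V (k + 1) 0 p)"
    unfolding act_V by simp
  with submodule_M_closed(4)[OF H tk_in_takiff(5) k]
  show ?thesis using submodule_cancel[OF H, of "1 / (4 * l) * (\<beta>\<^sup>2 + a)"] l False by simp
next
  case True
  have "act D tk_f (V k 0) = (\<lambda>p. 1 / (2 * l) * ((alpha_at \<alpha> k + 2) * \<beta> + b) * V (k + 1) 0 p)"
    unfolding act_V using True by simp
  with submodule_M_closed(4)[OF H tk_in_takiff(2) k]
  show ?thesis using submodule_cancel[OF H, of "1 / (2 * l) * ((alpha_at \<alpha> k + 2) * \<beta> + b)"] l ne True by simp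
qed

text \<open>A submodule is stable under \<open>h\<close> and \<open>hbar\<close>, so its coordinates are subject to
  \<open>lowest_coordinate\<close>.\<close>

lemma submodule_V:
  assumes H: "takiff_submodule H M" and "H \<noteq> {\<lambda>p. 0}"
  obtains k where "V k 0 \<in> H"
proof -
  note HC = submodule_M_closed[OF H]
  obtain \<phi> where "\<phi> \<in> H" "\<phi> \<noteq> (\<lambda>p. 0)" using assms(2) HC(1) by blast
  moreover then obtain c where "\<phi> = J c" using HC(5) by (auto simp: SV_def)
  ultimately have c: "c \<in> {c. J c \<in> H}" "c \<noteq> 0" by (auto simp: fun_eq_iff)
  have "J (Hop \<mu> c) \<in> H" "J (Bop \<mu> c) \<in> H" if "J c \<in> H" for \<mu> c
  proof -
    have "J (Hop \<mu> c) = (\<lambda>p. act D tk_h (J c) p + (- \<mu>) * J c p)"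
      "J (Bop \<mu> c) = (\<lambda>p. act D tk_hbar (J c) p + (- \<mu>) * J c p)"
      by (auto simp: J_Hop J_Bop)
    then show "J (Hop \<mu> c) \<in> H" "J (Bop \<mu> c) \<in> H"
      using HC(2)[OF HC(4)[OF _ that] HC(3)[OF that]] by (metis tk_in_takiff(3), metis tk_in_takiff(6))
  qed
  then obtain k z where kz: "z \<noteq> 0" "Poly_Mapping.single (k, 0) z \<in> {c. J c \<in> H}"
    by (rule lowest_coordinate[OF c, simplified]) auto
  have "J (Poly_Mapping.single (k, 0) z) = (\<lambda>p. z * V k 0 p)" by auto
  then have "V k 0 \<in> H" using submodule_cancel[OF H] kz by auto
  then show ?thesis by (rule that)
qed

lemma simple_M:
  assumes "\<And>k. \<beta>\<^sup>2 + a \<noteq> 0 \<or> (alpha_at \<alpha> k + 2) * \<beta> + b \<noteq> 0"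
  shows "simple_module M"
  unfolding simple_module_def
proof (intro conjI allI impI)
  show "takiff_module M" by (rule takiff_module_M)
  show "carrier M \<noteq> {\<zero>\<^bsub>M\<^esub>}"
    unfolding carrier_M M_simps using SV_V[of 0 0 UNIV] V_nonzero[of 0] by auto
  fix H assume H: "takiff_submodule H M"
  show "H = {\<zero>\<^bsub>M\<^esub>} \<or> H = carrier M"
  proof (cases "H = {\<lambda>p. 0}")
    case True then show ?thesis by (simp add: M_simps)
  next
    case False
    then obtain k where k: "V k 0 \<in> H" using submodule_V[OF H] by blast
    have up: "V (k + int n) 0 \<in> H" for n
    proof (induction n)
      case (Suc n) then show ?case using submodule_up[OF H Suc assms] by (simp add: algebra_simps)
    qed (use k in simp)
    have "V j i \<in> H" for j i
      by (rule submodule_down[OF H up[of "nat (j + int i - k)"]]) simp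
    then have "SV UNIV \<subseteq> H" by (intro submodule_SV[OF H])
    then show ?thesis using submodule_M_closed(5)[OF H] carrier_M by auto
  qed
qed

section \<open>The Verma submodules\<close>

text \<open>The span of the vectors that \<open>submodule_down\<close> reaches from \<open>V K 0\<close>.\<close>

definition W :: "int \<Rightarrow> (bipoly \<Rightarrow> complex) set" where
  "W K = SV {(k, i). k + int i \<le> K}"

lemma J_in_SV: "J c \<in> SV S \<longleftrightarrow> keys c \<subseteq> S"
  unfolding SV_def using J_inject by auto

lemma V_in_W: "V k i \<in> W K \<longleftrightarrow> k + int i \<le> K"
proof -
  have "V k i = J (Poly_Mapping.single (k, i) 1)" by auto
  then show ?thesis by (simp add: W_def J_in_SV)
qed

lemma W_subset: "W K \<subseteq> SV UNIV"
  by (auto simp: W_def SV_def)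

end

text \<open>The coefficients with which \<open>fbar\<close> and \<open>f\<close> lead out of \<open>W K\<close> vanish.\<close>

locale lowest_weight_jet = jet_module +
  fixes K :: int
  assumes \<beta>: "\<beta>\<^sup>2 + a = 0" and K: "(alpha_at \<alpha> K + 2) * \<beta> + b = 0"
begin

lemma W_submodule_D: "takiff_submodule (W K) D"
  unfolding W_def
proof (rule SV_submodule)
  let ?S = "{(k, i). k + int i \<le> K}"
  fix k i x assume k: "(k, i) \<in> ?S" and "x \<in> {tk_e, tk_h, tk_f, tk_ebar, tk_hbar, tk_fbar}"
  \<comment> \<open>raising \<open>k\<close> and lowering \<open>i\<close> keeps \<open>k + i\<close>; only the middle term \<open>f1\<close> of \<open>f\<close> can lead out\<close>
  have lower: "(\<lambda>p. c * V (k + 1) (i - 1) p) \<in> SV ?S" "(\<lambda>p. c * V k (i - 1) p) \<in> SV ?S" if "i > 0" for c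
    using k that by (auto intro!: SV_scale SV_V)
  have hb: "(\<lambda>p. of_nat i * V k (i - 1) p) \<in> SV ?S"
    using lower(2) by (cases i) (auto simp: SV_zero)
  have fb1: "(\<lambda>p. 2 * of_nat i * \<beta> * V (k + 1) (i - 1) p) \<in> SV ?S"
    using lower(1) by (cases i) (auto simp: SV_zero)
  have fb2: "(\<lambda>p. of_nat i * of_nat (i - 1) * V (k + 1) (i - 2) p) \<in> SV ?S"
  proof (cases "i \<ge> 2")
    case True
    then show ?thesis using k by (intro SV_scale SV_V) auto
  next
    case False
    then have "i = 0 \<or> i = 1" by auto
    then show ?thesis using SV_zero by auto
  qed
  have f2: "(\<lambda>p. of_nat i * (alpha_at \<alpha> k + of_nat i + 1) * V (k + 1) (i - 1) p) \<in> SV ?S"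
    using lower(1) by (cases i) (auto simp: SV_zero)
  have f1: "(\<lambda>p. ((alpha_at \<alpha> k + 2 * of_nat (i + 1)) * \<beta> + b) * V (k + 1) i p) \<in> SV ?S"
  proof (cases "k + int i = K")
    case True
    have "alpha_at \<alpha> k + 2 * of_nat (i + 1) = alpha_at \<alpha> K + 2"
      by (simp add: alpha_at_def flip: True)
    then have "(alpha_at \<alpha> k + 2 * of_nat (i + 1)) * \<beta> + b = 0" using K by (simp only:)
    then show ?thesis using SV_zero by (simp only: mult_zero_left)
  next
    case False
    then show ?thesis using k by (intro SV_scale SV_V) auto
  qed
  from \<open>x \<in> _\<close> consider "x = tk_e" | "x = tk_h" | "x = tk_f" | "x = tk_ebar" | "x = tk_hbar" | "x = tk_fbar" by blast
  then show "act D x (V k i) \<in> SV ?S"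
  proof cases
    case 1 show ?thesis unfolding 1 act_V by (intro SV_scale SV_V) (use k in auto)
  next
    case 2 show ?thesis unfolding 2 act_V by (intro SV_scale SV_V) (use k in auto)
  next
    case 3 show ?thesis unfolding 3 act_V using SV_add[OF f1 f2]
      by (intro SV_scale) (simp add: \<beta> del: of_nat_add)
  next
    case 4 show ?thesis unfolding 4 act_V by (intro SV_scale SV_V) (use k in auto)
  next
    case 5 show ?thesis unfolding 5 act_V by (intro SV_diff SV_scale SV_V hb) (use k in auto)
  next
    case 6 show ?thesis unfolding 6 act_V using SV_add[OF fb1 fb2] by (intro SV_scale) (simp add: \<beta>)
  qed
qed

lemma W_submodule: "takiff_submodule (W K) M"
proof -
  note WD = takiff_module.takiff_submoduleD[OF takiff_module_D W_submodule_D]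
  show ?thesis
    using WD(2-6) W_subset
    by (intro takiff_module.takiff_submoduleI[OF takiff_module_M]) (auto simp: M_simps carrier_M)
qed

lemma not_simple_M: "\<not> simple_module M"
proof
  assume "simple_module M"
  then have "W K = {\<zero>\<^bsub>M\<^esub>} \<or> W K = SV UNIV"
    using W_submodule by (auto simp: simple_module_def carrier_M)
  moreover have "V K 0 \<in> W K" "V (K + 1) 0 \<notin> W K" "V (K + 1) 0 \<in> SV UNIV"
    by (auto simp: V_in_W SV_V)
  ultimately show False using V_nonzero[of K] by (auto simp: M_simps)
qed

lemma env_orbit_eq_W:
  assumes "k \<le> K" "V K 0 \<in> env_orbit M (V k 0)"
  shows "env_orbit M (V k 0) = W K"
proof
  interpret M: takiff_module M by (rule takiff_module_M)
  show "env_orbit M (V k 0) \<subseteq> W K"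
    by (rule M.env_orbit_least[OF W_submodule]) (simp add: V_in_W assms)
  have H: "takiff_submodule (env_orbit M (V k 0)) M"
    by (rule M.env_orbit_submodule) (simp add: carrier_M SV_V)
  show "W K \<subseteq> env_orbit M (V k 0)"
    unfolding W_def by (rule submodule_SV[OF H]) (auto intro: submodule_down[OF H assms(2)])
qed

lemma word_V:
  "foldr (act D) (replicate i tk_e @ replicate j tk_ebar) (V K 0) =
    (\<lambda>p. (2 * l) ^ i * (- l) ^ j * V (K - int (i + j)) i p)"
proof -
  have scale: "act D x (\<lambda>p. z * \<phi> p) = (\<lambda>p. z * act D x \<phi> p)" for x z \<phi> by simp
  have "foldr (act D) (replicate j tk_ebar) (V K 0) = (\<lambda>p. (- l) ^ j * V (K - int j) 0 p)"
  proof (induction j)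
    case (Suc j)
    have "foldr (act D) (replicate (Suc j) tk_ebar) (V K 0) = act D tk_ebar (\<lambda>p. (- l) ^ j * V (K - int j) 0 p)"
      by (simp only: replicate_Suc foldr.simps o_apply Suc)
    also have "\<dots> = (\<lambda>p. (- l) ^ Suc j * V (K - int (Suc j)) 0 p)"
      unfolding scale act_V by (simp add: algebra_simps)
    finally show ?case .
  qed simp
  then show ?thesis
  proof (induction i)
    case (Suc i)
    have "foldr (act D) (replicate (Suc i) tk_e @ replicate j tk_ebar) (V K 0)
      = act D tk_e (\<lambda>p. (2 * l) ^ i * (- l) ^ j * V (K - int (i + j)) i p)"
      using Suc by (simp only: replicate_Suc append_Cons foldr.simps o_apply)
    also have "\<dots> = (\<lambda>p. (2 * l) ^ Suc i * (- l) ^ j * V (K - int (Suc i + j)) (Suc i) p)"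
      unfolding scale act_V by (simp add: algebra_simps)
    finally show ?case .
  qed simp
qed

lemma finsum_pointwise:
  fixes N :: "('a \<Rightarrow> complex) rep"
  assumes "abelian_monoid N" "\<zero>\<^bsub>N\<^esub> = (\<lambda>p. 0)" "\<And>\<phi> \<psi>. \<phi> \<oplus>\<^bsub>N\<^esub> \<psi> = (\<lambda>p. \<phi> p + \<psi> p)"
    and "finite A" "f \<in> A \<rightarrow> carrier N"
  shows "finsum N f A = (\<lambda>p. \<Sum>x\<in>A. f x p)"
proof -
  interpret abelian_monoid N by (rule assms(1))
  show ?thesis using assms(4,5)
    by (induction A) (auto simp: assms(2,3) Pi_def)
qed

text \<open>The index of the image of \<open>V K 0\<close> under a normal word determines the word (\<open>word_V\<close>), so linear
  independence of the \<open>V k i\<close> gives that of the images.\<close>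

lemma opp_verma_W: "is_opp_verma (restrict_rep M (W K)) (V K 0)" (is "is_opp_verma ?N ?v")
proof (rule is_opp_vermaI)
  interpret M: takiff_module M by (rule takiff_module_M)
  show N: "takiff_module ?N" by (rule takiff_module_restrict[OF takiff_module_M W_submodule])
  interpret N: takiff_module ?N by (rule N)
  show v: "?v \<in> carrier ?N" by (simp add: V_in_W)
  show "act ?N x ?v = borel_weight (- alpha_at \<alpha> K, - \<beta>) x \<odot>\<^bsub>?N\<^esub> ?v" if "x \<in> borel_minus" for x
  proof -
    have "act D tk_f ?v = (\<lambda>p. 0)" "act D tk_fbar ?v = (\<lambda>p. 0)"
      unfolding act_V using \<beta> K by simp_all
    moreover have "fst x $ 1 $ 2 = 0" "snd x $ 1 $ 2 = 0" using that by (auto simp: borel_minus_def)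
    ultimately show ?thesis
      unfolding restrict_rep_simps M_simps act_D_basis[OF V_in_D, of x] act_V(1,2)
      by (simp add: borel_weight_def algebra_simps del: D_simps)
  qed
  show "carrier ?N \<subseteq> env_orbit ?N ?v"
  proof -
    note O = N.takiff_submoduleD[OF N.env_orbit_submodule(1)[OF v]]
    have "env_orbit ?N ?v \<subseteq> carrier M"
      using O(1) W_subset[of K] unfolding carrier_M restrict_rep_simps by (rule subset_trans)
    then have "takiff_submodule (env_orbit ?N ?v) M"
      using O(2,3,4,6) unfolding restrict_rep_simps by (rule M.takiff_submoduleI)
    note S = this
    have "SV {(k, i). k + int i \<le> K} \<subseteq> env_orbit ?N ?v"
      by (rule submodule_SV[OF S]) (use submodule_down[OF S N.env_orbit_submodule(2)[OF v]] in auto)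
    then show ?thesis unfolding restrict_rep_simps by (subst (1) W_def)
  qed
  fix n assume n: "keys n \<subseteq> normal_words" "env_act ?N n ?v = \<zero>\<^bsub>?N\<^esub>"
  \<comment> \<open>a normal word takes \<open>V K 0\<close> to \<open>r w\<close> times the basis vector with index \<open>g w\<close>\<close>
  define g where "g w = (K - int (length w), length (filter (\<lambda>x. x = tk_e) w))" for w
  define r where "r w = (2 * l) ^ length (filter (\<lambda>x. x = tk_e) w) * (- l) ^ length (filter (\<lambda>x. x \<noteq> tk_e) w)" for w
  have ne: "tk_ebar \<noteq> tk_e"
    using mat_basis_entries(2) by (metis tk_e_def tk_ebar_def fst_conv zero_index zero_neq_one)
  have word: "foldr (act D) w ?v = (\<lambda>p. r w * V (fst (g w)) (snd (g w)) p)" if nw: "w \<in> normal_words" for w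
  proof -
    obtain i j where w: "w = replicate i tk_e @ replicate j tk_ebar"
      using nw by (auto simp: normal_words_def)
    have "g w = (K - int (i + j), i)" "r w = (2 * l) ^ i * (- l) ^ j"
      using ne by (simp_all add: g_def r_def w)
    then show ?thesis using word_V[of i j] by (simp only: fst_conv snd_conv w[symmetric])
  qed
  have inj: "inj_on g normal_words"
  proof (rule inj_onI)
    fix w w' assume "w \<in> normal_words" "w' \<in> normal_words" "g w = g w'"
    then show "w = w'" using ne by (auto simp: normal_words_def g_def)
  qed
  have r: "r w \<noteq> 0" for w using l by (simp add: r_def)
  let ?c = "\<Sum>w\<in>keys n. Poly_Mapping.single (g w) (lookup n w * r w)"
  have J_sum: "J (sum f A) p = (\<Sum>x\<in>A. J (f x) p)" for f p and A :: "takiff_elt list set"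
    by (induction A rule: infinite_finite_induct) (auto simp: J_add)
  have "env_act ?N n ?v = (\<lambda>p. \<Sum>w\<in>keys n. (lookup n w \<odot>\<^bsub>?N\<^esub> foldr (act ?N) w ?v) p)"
    unfolding env_act_def
  proof (rule finsum_pointwise[OF N.abelian_monoid_axioms])
    show "(\<lambda>w. lookup n w \<odot>\<^bsub>?N\<^esub> foldr (act ?N) w ?v) \<in> keys n \<rightarrow> carrier ?N"
      using n(1) normal_words_subset v by (intro Pi_I N.smult_closed' N.word_closed) blast+
  qed (simp_all add: M_simps)
  also have "\<dots> = J ?c"
    using n(1) by (intro ext) (auto simp: J_sum M_simps word mult.assoc simp del: D_simps(4) intro!: sum.cong)
  finally have "J ?c = (\<lambda>p. 0)" using n(2) by (simp add: M_simps)
  then have c: "?c = 0" by (rule J_eq_zeroD)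
  have "lookup n w = 0" if w: "w \<in> keys n" for w
  proof -
    have "lookup ?c (g w) = (\<Sum>w'\<in>keys n. if w' = w then lookup n w * r w else 0)"
      unfolding lookup_sum lookup_single when_def
      using inj n(1) w by (intro sum.cong) (auto simp: inj_on_def)
    then have "lookup n w * r w = 0" using c w by simp
    then show ?thesis using r by simp
  qed
  then show "n = 0" by (intro poly_mapping_eqI) (auto simp: in_keys_iff)
qed

end

context jet_module
begin

lemma lookup_Hop_funpow:
  "lookup ((Hop \<mu> ^^ n) c) (k, i) = (- alpha_at \<alpha> k - \<mu>) ^ n * lookup c (k, i)"
  by (induction n) (simp_all add: lookup_Hop)

text \<open>Modulo terms with smaller second index, \<open>hbar\<close> is the scalar \<open>- \<beta>\<close>; so the largest second
  index \<open>j\<close> occurring with \<open>k\<close> sees no other coordinate.\<close>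

lemma lookup_Bop_funpow_top:
  assumes "(k, i) \<in> keys c"
  obtains j where "j \<ge> i" "(k, j) \<in> keys c"
    "\<And>\<mu> n. lookup ((Bop \<mu> ^^ n) c) (k, j) = (- \<beta> - \<mu>) ^ n * lookup c (k, j)"
proof -
  let ?I = "{i. (k, i) \<in> keys c}"
  have "finite (Pair k -` keys c)"
    by (rule finite_vimageI) (auto simp: inj_on_def)
  moreover have "Pair k -` keys c = ?I" by auto
  ultimately have fin: "finite ?I" by simp
  define j where "j = Max ?I"
  have j: "j \<in> ?I" "i \<le> j" using fin assms Max_in[OF fin] by (auto simp: j_def)
  have above: "lookup c (k, m) = 0" if "m > j" for m
    using Max_ge[OF fin, of m] that by (auto simp: j_def in_keys_iff)
  have "lookup ((Bop \<mu> ^^ n) c) (k, m) = (- \<beta> - \<mu>) ^ n * lookup c (k, m)"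
    if "m \<ge> j" for \<mu> n m
    using that
  proof (induction n arbitrary: m)
    case (Suc n)
    then show ?case using above[of "m + 1"] by (simp add: lookup_Bop)
  qed simp
  then show ?thesis using that[OF j(2)] j(1) by auto
qed

lemma Bop_funpow_zero:
  "(\<And>x. x \<in> keys c \<Longrightarrow> snd x < n) \<Longrightarrow> (Bop (- \<beta>) ^^ n) c = 0"
proof (induction n arbitrary: c)
  case 0
  then have "keys c = {}" by fastforce
  then show ?case by simp
next
  case (Suc n)
  have "snd x < n" if "x \<in> keys (Bop (- \<beta>) c)" for x
    using that Suc.prems[of "(fst x, snd x + 1)"]
    by (cases x) (auto simp: in_keys_iff lookup_Bop)
  then show ?case using Suc.IH[of "Bop (- \<beta>) c"] by (simp add: funpow_swap1)
qed

end

section \<open>The quotient\<close>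

context lowest_weight_jet
begin

lemma J_in_W: "J c \<in> W K \<longleftrightarrow> (\<forall>k i. (k, i) \<in> keys c \<longrightarrow> k + int i \<le> K)"
  by (auto simp: W_def J_in_SV)

abbreviation "Q \<equiv> quotient_rep M (W K)"
abbreviation coset :: "(int \<times> nat \<Rightarrow>\<^sub>0 complex) \<Rightarrow> (bipoly \<Rightarrow> complex) set" where
  "coset c \<equiv> W K +>\<^bsub>M\<^esub> J c"

lemma takiff_quotient_W: "takiff_quotient M (W K)"
  by (rule takiff_quotient.intro[OF takiff_module_M]) (rule takiff_quotient_axioms.intro, rule W_submodule)

lemma J_in_M: "J c \<in> carrier M"
  by (simp add: carrier_M J_in_SV)

lemma coset_eq_iff: "coset c = coset d \<longleftrightarrow> J (c - d) \<in> W K"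
proof -
  interpret Q: takiff_quotient M "W K" by (rule takiff_quotient_W)
  have "J c \<ominus>\<^bsub>M\<^esub> J d = J (c - d)"
    by (subst minus_M) (auto simp: J_in_SV J_diff)
  then show ?thesis using Q.coset_eq_iff[OF J_in_M J_in_M, of c d] by simp
qed

lemma coset_eq_zero_iff: "coset c = \<zero>\<^bsub>Q\<^esub> \<longleftrightarrow> J c \<in> W K"
proof -
  interpret Q: takiff_quotient M "W K" by (rule takiff_quotient_W)
  have "J 0 = \<zero>\<^bsub>M\<^esub>" by (auto simp: M_simps)
  then show ?thesis using coset_eq_iff[of c 0] Q.quotient_zero by simp
qed

lemma carrier_Q: "X \<in> carrier Q \<longleftrightarrow> (\<exists>c. X = coset c)"
proof -
  interpret Q: takiff_quotient M "W K" by (rule takiff_quotient_W)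
  show ?thesis unfolding Q.quotient_carrier carrier_M by (auto simp: SV_def)
qed

lemma coset_add: "coset c \<oplus>\<^bsub>Q\<^esub> coset d = coset (c + d)"
proof -
  interpret Q: takiff_quotient M "W K" by (rule takiff_quotient_W)
  have "J c \<oplus>\<^bsub>M\<^esub> J d = J (c + d)" by (auto simp: M_simps J_add)
  then show ?thesis using Q.quotient_add[OF J_in_M J_in_M] by (simp del: quotient_rep_simps)
qed

lemma coset_Hop: "act Q tk_h (coset c) \<ominus>\<^bsub>Q\<^esub> \<mu> \<odot>\<^bsub>Q\<^esub> coset c = coset (Hop \<mu> c)"
  and coset_Bop: "act Q tk_hbar (coset c) \<ominus>\<^bsub>Q\<^esub> \<mu> \<odot>\<^bsub>Q\<^esub> coset c = coset (Bop \<mu> c)"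
proof -
  interpret Q: takiff_quotient M "W K" by (rule takiff_quotient_W)
  have eq: "act M tk_h (J c) \<ominus>\<^bsub>M\<^esub> \<mu> \<odot>\<^bsub>M\<^esub> J c = J (Hop \<mu> c)"
    "act M tk_hbar (J c) \<ominus>\<^bsub>M\<^esub> \<mu> \<odot>\<^bsub>M\<^esub> J c = J (Bop \<mu> c)"
    using Q.act_closed[OF _ J_in_M[of c]] Q.smult_closed'[OF J_in_M[of c], of \<mu>]
    by (subst minus_M; simp add: carrier_M M_simps fun_eq_iff J_Hop J_Bop del: D_simps(4))+
  show "act Q tk_h (coset c) \<ominus>\<^bsub>Q\<^esub> \<mu> \<odot>\<^bsub>Q\<^esub> coset c = coset (Hop \<mu> c)"
    "act Q tk_hbar (coset c) \<ominus>\<^bsub>Q\<^esub> \<mu> \<odot>\<^bsub>Q\<^esub> coset c = coset (Bop \<mu> c)"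
    by (simp_all add: Q.quotient_act Q.quotient_smult Q.quotient_minus J_in_M Q.act_closed eq
        del: quotient_rep_simps)
qed

lemma gen_weight_space_Q:
  "coset c \<in> gen_weight_space Q \<mu> \<longleftrightarrow>
    (\<exists>m\<ge>1. \<exists>n\<ge>1. J ((Hop (fst \<mu>) ^^ m) c) \<in> W K \<and> J ((Bop (snd \<mu>) ^^ n) c) \<in> W K)"
proof -
  have "((\<lambda>u. act Q tk_h u \<ominus>\<^bsub>Q\<^esub> z \<odot>\<^bsub>Q\<^esub> u) ^^ m) (coset c) = coset ((Hop z ^^ m) c)" for m z
    by (induction m) (simp_all add: coset_Hop del: quotient_rep_simps)
  moreover have "((\<lambda>u. act Q tk_hbar u \<ominus>\<^bsub>Q\<^esub> z \<odot>\<^bsub>Q\<^esub> u) ^^ m) (coset c) = coset ((Bop z ^^ m) c)" for m z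
    by (induction m) (simp_all add: coset_Bop del: quotient_rep_simps)
  moreover have "coset c \<in> carrier Q" by (auto simp: carrier_Q simp del: quotient_rep_simps)
  ultimately show ?thesis
    unfolding gen_weight_space_def mem_Collect_eq by (simp add: coset_eq_zero_iff del: quotient_rep_simps)
qed

lemma coset_V_gen_weight:
  "coset (Poly_Mapping.single (k, i) z) \<in> gen_weight_space Q (- alpha_at \<alpha> k, - \<beta>)"
proof -
  have "(Hop (- alpha_at \<alpha> k) ^^ 1) (Poly_Mapping.single (k, i) z) = 0"
    by (rule poly_mapping_eqI) (auto simp: lookup_Hop lookup_single when_def)
  moreover have "(Bop (- \<beta>) ^^ (i + 1)) (Poly_Mapping.single (k, i) z) = 0"
    by (rule Bop_funpow_zero) (auto split: if_splits)
  moreover have "J 0 \<in> W K" by (simp add: J_in_W)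
  ultimately show ?thesis
    unfolding gen_weight_space_Q by (metis fst_conv snd_conv le_add2 order_refl)
qed

text \<open>A coset is nonzero because of a coordinate \<open>(k, i)\<close> outside \<open>W K\<close>. There \<open>h - \<mu>\<close> acts by
  \<open>- \<alpha>\<^sub>k - \<mu>\<close>. For \<open>hbar - \<mu>\<close> pass to the top coordinate with the same \<open>k\<close>, which lies outside
  \<open>W K\<close> as well.\<close>

lemma weight_of_Q:
  assumes "coset c \<in> gen_weight_space Q \<mu>" "coset c \<noteq> \<zero>\<^bsub>Q\<^esub>"
  shows "\<exists>k. \<mu> = (- alpha_at \<alpha> k, - \<beta>)"
proof -
  obtain m n where mn: "J ((Hop (fst \<mu>) ^^ m) c) \<in> W K" "J ((Bop (snd \<mu>) ^^ n) c) \<in> W K" "m \<ge> 1" "n \<ge> 1"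
    using assms(1) unfolding gen_weight_space_Q by blast
  obtain k i where k: "(k, i) \<in> keys c" "k + int i > K"
    using assms(2) unfolding coset_eq_zero_iff J_in_W by force
  obtain j where j: "j \<ge> i" "(k, j) \<in> keys c"
    "lookup ((Bop (snd \<mu>) ^^ n) c) (k, j) = (- \<beta> - snd \<mu>) ^ n * lookup c (k, j)"
    using lookup_Bop_funpow_top[OF k(1)] by metis
  have "lookup ((Hop (fst \<mu>) ^^ m) c) (k, i) = 0"
    using mn(1) k(2) unfolding J_in_W in_keys_iff by force
  then have "fst \<mu> = - alpha_at \<alpha> k" using k(1) by (auto simp: lookup_Hop_funpow in_keys_iff)
  moreover have "lookup ((Bop (snd \<mu>) ^^ n) c) (k, j) = 0"
    using mn(2) k(2) j(1) unfolding J_in_W in_keys_iff by force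
  then have "snd \<mu> = - \<beta>" using j(2) unfolding j(3) by (auto simp: in_keys_iff)
  ultimately show ?thesis by (metis prod.collapse)
qed

lemma submodule_Q:
  assumes "submodule H complex_field Q"
  shows "coset 0 \<in> H" "coset c \<in> H \<Longrightarrow> coset d \<in> H \<Longrightarrow> coset (c + d) \<in> H"
proof -
  interpret Q: takiff_quotient M "W K" by (rule takiff_quotient_W)
  interpret Q': takiff_module Q by (rule Q.takiff_module_quotient)
  interpret H: submodule H complex_field Q by (rule assms)
  have "coset 0 = \<zero>\<^bsub>Q\<^esub>" unfolding coset_eq_zero_iff by (simp add: J_in_W)
  then show "coset 0 \<in> H" using H.one_closed by simp
  show "coset c \<in> H \<Longrightarrow> coset d \<in> H \<Longrightarrow> coset (c + d) \<in> H"
    using Q'.submoduleE(5)[OF assms, of "coset c" "coset d"] by (simp only: coset_add)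
qed

lemma gen_weight_module_Q: "gen_weight_module Q"
  unfolding gen_weight_module_def
proof
  interpret Q: takiff_quotient M "W K" by (rule takiff_quotient_W)
  show "takiff_module Q" by (rule Q.takiff_module_quotient)
  interpret Q': takiff_module Q by (rule Q.takiff_module_quotient)
  show "lin_span Q (\<Union>\<mu>. gen_weight_space Q \<mu>) = carrier Q"
  proof
    show "lin_span Q (\<Union>\<mu>. gen_weight_space Q \<mu>) \<subseteq> carrier Q"
      unfolding lin_span_def using Q'.carrier_is_submodule
      by (intro Inter_lower) (auto simp: gen_weight_space_def simp del: quotient_rep_simps)
    have "carrier Q \<subseteq> H" if H: "submodule H complex_field Q" "(\<Union>\<mu>. gen_weight_space Q \<mu>) \<subseteq> H" for H
    proof
      fix X assume "X \<in> carrier Q"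
      then obtain c where c: "X = coset c" using carrier_Q by blast
      have "keys c \<subseteq> UNIV" by simp
      then have "coset c \<in> H"
      proof (induction c rule: free_elt_induct)
        case (single x z)
        have "coset (Poly_Mapping.single (fst x, snd x) z) \<in> H"
          using H(2) coset_V_gen_weight by blast
        then show ?case by (simp only: prod.collapse)
      next
        case zero
        show ?case by (rule submodule_Q(1)[OF H(1)])
      next
        case (add c d)
        then show ?case by (intro submodule_Q(2)[OF H(1)])
      qed
      then show "X \<in> H" using c by simp
    qed
    then show "carrier Q \<subseteq> lin_span Q (\<Union>\<mu>. gen_weight_space Q \<mu>)"
      unfolding lin_span_def by blast
  qed
qed

text \<open>Finitely many cosets involve only finitely many second indices. A coordinate \<open>(k, n)\<close> beyond
  these and outside \<open>W K\<close> vanishes on their span but not on the coset of \<open>V k n\<close>.\<close>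

lemma not_finite_dim_Q: "\<not> finite_dim Q (gen_weight_space Q (- alpha_at \<alpha> k, - \<beta>))"
proof
  interpret Q: takiff_quotient M "W K" by (rule takiff_quotient_W)
  interpret Q': takiff_module Q by (rule Q.takiff_module_quotient)
  let ?G = "gen_weight_space Q (- alpha_at \<alpha> k, - \<beta>)"
  assume "finite_dim Q ?G"
  then obtain S where S: "finite S" "S \<subseteq> ?G" "?G \<subseteq> lin_span Q S" unfolding finite_dim_def by blast
  have "S \<subseteq> carrier Q" using S(2) by (auto simp: gen_weight_space_def simp del: quotient_rep_simps)
  then have "\<forall>X\<in>S. \<exists>c. X = coset c" using carrier_Q by blast
  then obtain r where r: "\<And>X. X \<in> S \<Longrightarrow> X = coset (r X)" by metis
  define T where "T = (\<Union>X\<in>S. snd ` keys (r X))"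
  have T: "finite T" using S(1) by (simp add: T_def)
  define n where "n = Suc (Max (insert (nat (K - k)) T))"
  have n: "k + int n > K" "\<And>i. i \<in> T \<Longrightarrow> i < n"
  proof -
    have "nat (K - k) \<le> Max (insert (nat (K - k)) T)" using T by (intro Max_ge) auto
    then show "k + int n > K" unfolding n_def by linarith
    show "i < n" if "i \<in> T" for i
      unfolding n_def using T that by (intro le_imp_less_Suc Max_ge) auto
  qed
  define H where "H = {coset c | c. lookup c (k, n) = 0}"
  have HI: "coset c \<in> H" if "lookup c (k, n) = 0" for c using that by (auto simp: H_def)
  have "submodule H complex_field Q"
  proof (rule Q'.submoduleI)
    show "H \<subseteq> carrier Q" by (auto simp: H_def carrier_Q simp del: quotient_rep_simps)
    have "coset 0 = \<zero>\<^bsub>Q\<^esub>" unfolding coset_eq_zero_iff by (simp add: J_in_W)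
    then show "\<zero>\<^bsub>Q\<^esub> \<in> H" using HI[of 0] by simp
    show add: "X \<oplus>\<^bsub>Q\<^esub> Y \<in> H" if XY: "X \<in> H" "Y \<in> H" for X Y
    proof -
      obtain c d where "X = coset c" "Y = coset d"
        "lookup c (k, n) = 0" "lookup d (k, n) = 0"
        using XY unfolding H_def by blast
      then show ?thesis by (simp only: coset_add) (rule HI, simp add: lookup_add)
    qed
    show sm: "z \<odot>\<^bsub>Q\<^esub> X \<in> H" if X: "X \<in> H" for z X
    proof -
      obtain c where c: "X = coset c" "lookup c (k, n) = 0" using X unfolding H_def by blast
      obtain d where d: "\<And>x. lookup d x = z * lookup c x"
        using lookup_mapp[of "\<lambda>x. (*) z" c] by (metis in_keys_iff mult_zero_right when_def)
      have "keys d \<subseteq> keys c" by (auto simp: in_keys_iff d)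
      then have "z \<odot>\<^bsub>M\<^esub> J c = J d"
        by (auto simp: M_simps J_superset[of "keys c"] J_def[of c] d sum_distrib_left mult.assoc)
      then have "z \<odot>\<^bsub>Q\<^esub> X = coset d" using c(1) Q.quotient_smult[OF J_in_M] by simp
      then show ?thesis using HI d c(2) by simp
    qed
    fix X assume "X \<in> H"
    moreover have "X \<in> carrier Q" using \<open>X \<in> H\<close> by (auto simp: H_def carrier_Q simp del: quotient_rep_simps)
    ultimately show "\<ominus>\<^bsub>Q\<^esub> X \<in> H" using sm[of X "-1"] Q'.smult_minus_one by simp
  qed
  moreover have "S \<subseteq> H"
  proof
    fix X assume X: "X \<in> S"
    have "(k, n) \<notin> keys (r X)" using n(2) X by (force simp: T_def)
    then have "coset (r X) \<in> H" by (intro HI) (simp add: in_keys_iff)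
    then show "X \<in> H" using r[OF X] by simp
  qed
  ultimately have "lin_span Q S \<subseteq> H" unfolding lin_span_def by blast
  then have "coset (Poly_Mapping.single (k, n) 1) \<in> H" using S(3) coset_V_gen_weight by blast
  then obtain c where c: "coset (Poly_Mapping.single (k, n) 1) = coset c" "lookup c (k, n) = 0"
    by (auto simp: H_def)
  have "lookup (Poly_Mapping.single (k, n) 1 - c) (k, n) \<noteq> 0"
    using c(2) by (simp add: lookup_minus)
  then have "(k, n) \<in> keys (Poly_Mapping.single (k, n) 1 - c)" by (simp add: in_keys_iff)
  then show False using c(1) n(1) unfolding coset_eq_iff J_in_W by force
qed

lemma inf_dim_Q: "inf_dim_weight_spaces Q"
  unfolding inf_dim_weight_spaces_def
proof (intro conjI allI impI)
  have "coset (Poly_Mapping.single (K + 1, 0) 1) \<noteq> \<zero>\<^bsub>Q\<^esub>"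
    unfolding coset_eq_zero_iff J_in_W by (auto intro!: exI)
  then show "\<exists>\<mu>. gen_weight_space Q \<mu> \<noteq> {\<zero>\<^bsub>Q\<^esub>}"
    using coset_V_gen_weight[of "K + 1" 0 1] by blast
  fix \<mu>
  assume ne: "gen_weight_space Q \<mu> \<noteq> {\<zero>\<^bsub>Q\<^esub>}"
  have "coset 0 = \<zero>\<^bsub>Q\<^esub>" unfolding coset_eq_zero_iff by (simp add: J_in_W)
  moreover have "(Hop z ^^ n) 0 = 0" "(Bop z ^^ n) 0 = 0" for z n
  proof -
    have "Hop z 0 = 0" "Bop z 0 = 0" by (auto intro!: poly_mapping_eqI simp: lookup_Hop lookup_Bop)
    then show "(Hop z ^^ n) 0 = 0" "(Bop z ^^ n) 0 = 0" by (induction n) auto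
  qed
  ultimately have "\<zero>\<^bsub>Q\<^esub> \<in> gen_weight_space Q \<mu>"
    using gen_weight_space_Q[of 0 \<mu>] by (auto simp: J_in_W intro!: exI[of _ 1])
  then obtain X where X: "X \<in> gen_weight_space Q \<mu>" "X \<noteq> \<zero>\<^bsub>Q\<^esub>" using ne by blast
  then have "X \<in> carrier Q" by (auto simp: gen_weight_space_def simp del: quotient_rep_simps)
  then obtain c where "X = coset c" using carrier_Q by blast
  then obtain k where "\<mu> = (- alpha_at \<alpha> k, - \<beta>)" using weight_of_Q X by blast
  then show "\<not> finite_dim Q (gen_weight_space Q \<mu>)" using not_finite_dim_Q by simp
qed

end

section \<open>Isomorphisms\<close>

lemma rep_isomorphic_refl: "rep_isomorphic N N"
  unfolding rep_isomorphic_def rep_iso_def by (rule exI[of _ "\<lambda>x. x"]) (auto simp: bij_betw_def)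

text \<open>All four invariants are read off at \<open>v\<close>, the image of \<open>V 0 0\<close>: it is an eigenvector of \<open>h\<close>, of
  \<open>hbar\<close> and of the two central elements, with the eigenvalues belonging to the first module.\<close>

lemma M_isomorphic_imp_eq:
  assumes "l \<noteq> 0" "l' \<noteq> 0" "rep_isomorphic (M_rep l \<alpha> \<beta> a b) (M_rep l' \<alpha>' \<beta>' a' b')"
  shows "\<exists>n::int. \<alpha> - \<alpha>' = 2 * of_int n" "\<beta> = \<beta>'" "a = a'" "b = b'"
proof -
  interpret A: jet_module l a b \<alpha> \<beta> by unfold_locales (rule assms)
  interpret B: jet_module l' a' b' \<alpha>' \<beta>' by unfold_locales (rule assms)
  obtain \<Phi> where \<Phi>: "rep_iso \<Phi> A.M B.M" using assms(3) by (auto simp: rep_isomorphic_def)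
  have \<Phi>_in: "\<Phi> \<phi> \<in> B.SV UNIV" if "\<phi> \<in> A.SV UNIV" for \<phi>
    using \<Phi> that unfolding rep_iso_def A.carrier_M B.carrier_M by (auto simp: bij_betw_def)
  have \<Phi>_add: "\<Phi> (\<lambda>p. \<phi> p + \<psi> p) = (\<lambda>p. \<Phi> \<phi> p + \<Phi> \<psi> p)" if "\<phi> \<in> A.SV UNIV" "\<psi> \<in> A.SV UNIV" for \<phi> \<psi>
    using \<Phi> that unfolding rep_iso_def A.carrier_M B.carrier_M A.M_simps B.M_simps by blast
  have \<Phi>_scale: "\<Phi> (\<lambda>p. c * \<phi> p) = (\<lambda>p. c * \<Phi> \<phi> p)" if "\<phi> \<in> A.SV UNIV" for c \<phi>
    using \<Phi> that unfolding rep_iso_def A.carrier_M B.carrier_M A.M_simps B.M_simps by blast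
  have \<Phi>_act: "\<Phi> (act A.D x \<phi>) = act B.D x (\<Phi> \<phi>)" if "\<phi> \<in> A.SV UNIV" "x \<in> takiff" for x \<phi>
    using \<Phi> that unfolding rep_iso_def A.carrier_M B.carrier_M A.M_simps B.M_simps by blast
  have A_act: "act A.D x \<phi> \<in> A.SV UNIV" if "\<phi> \<in> A.SV UNIV" "x \<in> takiff" for x \<phi>
    using that A.SV_UNIV_submodule by (auto simp: takiff_submodule_def simp del: A.D_simps(4))
  define v where "v = \<Phi> (A.V 0 0)"
  have V: "A.V 0 0 \<in> A.SV UNIV" by (simp add: A.SV_V)
  have v: "v \<in> B.SV UNIV" unfolding v_def by (rule \<Phi>_in[OF V])
  have "v \<noteq> (\<lambda>p. 0)"
  proof
    assume "v = (\<lambda>p. 0)"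
    moreover have "\<Phi> (\<lambda>p. 0) = (\<lambda>p. 0)" using \<Phi>_scale[OF A.SV_zero, of 0] by simp
    ultimately have "\<Phi> (A.V 0 0) = \<Phi> (\<lambda>p. 0)" by (simp add: v_def)
    then have "A.V 0 0 = (\<lambda>p. 0)"
      using \<Phi> V A.SV_zero[of UNIV] unfolding rep_iso_def A.carrier_M by (auto simp: bij_betw_def inj_on_def)
    then show False using A.V_nonzero by blast
  qed
  then obtain p where p: "v p \<noteq> 0" by auto
  obtain c where c: "v = B.J c" using v by (auto simp: B.SV_def)
  then have "c \<noteq> 0" using \<open>v \<noteq> (\<lambda>p. 0)\<close> by (auto simp: fun_eq_iff)
  then obtain k i where k: "(k, i) \<in> keys c"
    by (metis all_not_in_conv keys_eq_empty surj_pair)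
  have h: "act B.D tk_h v = (\<lambda>p. - \<alpha> * v p)"
    unfolding v_def \<Phi>_act[OF V tk_in_takiff(3), symmetric] A.act_V
    by (simp only: \<Phi>_scale[OF V]) (simp add: alpha_at_def)
  then have "B.J (B.Hop (- \<alpha>) c) = (\<lambda>p. 0)" by (auto simp: B.J_Hop fun_eq_iff c)
  then have "B.Hop (- \<alpha>) c = 0" by (rule B.J_eq_zeroD)
  then have "lookup (B.Hop (- \<alpha>) c) (k, i) = 0" by simp
  then have "alpha_at \<alpha>' k = \<alpha>" using k by (simp add: B.lookup_Hop in_keys_iff)
  then show "\<exists>n::int. \<alpha> - \<alpha>' = 2 * of_int n" by (auto simp: alpha_at_def)
  have "act A.D tk_hbar (A.V 0 0) = (\<lambda>p. - \<beta> * A.V 0 0 p)"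
    unfolding A.act_V by simp
  then have hb: "act B.D tk_hbar v = (\<lambda>p. - \<beta> * v p)"
    unfolding v_def \<Phi>_act[OF V tk_in_takiff(6), symmetric] by (simp only: \<Phi>_scale[OF V])
  then have "B.J (B.Bop (- \<beta>) c) = (\<lambda>p. 0)" by (auto simp: B.J_Bop fun_eq_iff c)
  then have B0: "B.Bop (- \<beta>) c = 0" by (rule B.J_eq_zeroD)
  obtain j where j: "(k, j) \<in> keys c"
    "lookup ((B.Bop (- \<beta>) ^^ 1) c) (k, j) = (- \<beta>' - (- \<beta>)) ^ 1 * lookup c (k, j)"
    using B.lookup_Bop_funpow_top[OF k] by metis
  then show "\<beta> = \<beta>'" using B0 by (simp add: in_keys_iff)
  note D = subsetD[OF A.SV_subset_D V] subsetD[OF B.SV_subset_D v]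
  have tr: "\<Phi> (act A.D x (act A.D y (A.V 0 0))) = act B.D x (act B.D y v)" if "x \<in> takiff" "y \<in> takiff" for x y
    using \<Phi>_act[OF A_act[OF V that(2)] that(1)] \<Phi>_act[OF V that(2)] by (simp only: v_def)
  note A2 = A_act[OF A_act[OF V]]
  have "(\<lambda>p. - a * v p) = \<Phi> (\<lambda>p. - a * A.V 0 0 p)" by (simp only: \<Phi>_scale[OF V] v_def)
  also have "\<dots> = \<Phi> (\<lambda>p. act A.D tk_hbar (act A.D tk_hbar (A.V 0 0)) p + 4 * act A.D tk_ebar (act A.D tk_fbar (A.V 0 0)) p)"
    by (simp only: A.casimirs_D(1)[OF D(1)])
  also have "\<dots> = (\<lambda>p. act B.D tk_hbar (act B.D tk_hbar v) p + 4 * act B.D tk_ebar (act B.D tk_fbar v) p)"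
    by (subst \<Phi>_add; (intro A2 A.SV_scale tk_in_takiff)?) (subst \<Phi>_scale; (intro A2 tk_in_takiff)?; simp only: tr tk_in_takiff)
  also have "\<dots> = (\<lambda>p. - a' * v p)"
    by (simp only: B.casimirs_D(1)[OF D(2)])
  finally have "- a * v p = - a' * v p" by (rule fun_cong)
  then show "a = a'" using p by simp
  have "(\<lambda>p. - b / 2 * v p) = \<Phi> (\<lambda>p. - b / 2 * A.V 0 0 p)" by (simp only: \<Phi>_scale[OF V] v_def)
  also have "\<dots> = \<Phi> (\<lambda>p. act A.D tk_ebar (act A.D tk_f (A.V 0 0)) p + act A.D tk_fbar (act A.D tk_e (A.V 0 0)) p
      + 1 / 2 * act A.D tk_hbar (act A.D tk_h (A.V 0 0)) p)"
    by (simp only: A.casimirs_D(2)[OF D(1)])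
  also have "\<dots> = (\<lambda>p. act B.D tk_ebar (act B.D tk_f v) p + act B.D tk_fbar (act B.D tk_e v) p
      + 1 / 2 * act B.D tk_hbar (act B.D tk_h v) p)"
    by (subst \<Phi>_add; (intro A2 A.SV_scale A.SV_add tk_in_takiff)?)
       (subst \<Phi>_add; (intro A2 tk_in_takiff)?; subst \<Phi>_scale; (intro A2 tk_in_takiff)?; simp only: tr tk_in_takiff)
  also have "\<dots> = (\<lambda>p. - b' / 2 * v p)"
    by (simp only: B.casimirs_D(2)[OF D(2)])
  finally have "- b / 2 * v p = - b' / 2 * v p" by (rule fun_cong)
  then show "b = b'" using p by simp
qed

lemma M_rep_shift: "\<alpha> - \<alpha>' = 2 * of_int n \<Longrightarrow> M_rep l \<alpha> \<beta> a b = M_rep l \<alpha>' \<beta> a b"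
proof -
  assume n: "\<alpha> - \<alpha>' = 2 * of_int n"
  then have "alpha_at \<alpha> k = alpha_at \<alpha>' (k + n)" for k
    by (simp add: alpha_at_def algebra_simps)
  then have "eta \<alpha> \<beta> k s = eta \<alpha>' \<beta> (k + n) s" for k s by (simp add: eta_def)
  then have "{eta \<alpha> \<beta> k s | k s. s \<ge> 1} = {eta \<alpha>' \<beta> k s | k s. s \<ge> 1}"
    by (auto, metis diff_add_cancel)
  then show ?thesis by (simp only: M_rep_def)
qed

text \<open>As \<open>e\<close> and \<open>ebar\<close> are proportional to \<open>l\<close> and lower \<open>k\<close>, while \<open>f\<close> and \<open>fbar\<close> are proportional
  to \<open>1 / l\<close> and raise it, multiplying \<open>V k i\<close> by \<open>r\<^sup>k\<close> amounts to replacing \<open>l\<close> by \<open>l / r\<close>.\<close>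

lemma M_rep_scaling:
  assumes "l \<noteq> 0" "l' \<noteq> 0"
  shows "rep_isomorphic (M_rep l \<alpha> \<beta> a b) (M_rep l' \<alpha> \<beta> a b)"
proof -
  interpret A: jet_module l a b \<alpha> \<beta> by unfold_locales (rule assms)
  interpret B: jet_module l' a b \<alpha> \<beta> by unfold_locales (rule assms)
  define sc where "sc r c = Poly_Mapping.mapp (\<lambda>x z. r powi (fst x) * z) c" for r :: complex and c :: "int \<times> nat \<Rightarrow>\<^sub>0 complex"
  have sc: "lookup (sc r c) x = r powi (fst x) * lookup c x" for r c x
    by (simp add: sc_def lookup_mapp when_def in_keys_iff)
  define \<Phi> where "\<Phi> r \<phi> = A.J (sc r (inv_into UNIV A.J \<phi>))" for r \<phi>
  have inv_J: "inv_into UNIV A.J (A.J c) = c" for c by (rule inv_f_f) (auto simp: inj_on_def A.J_inject)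
  have \<Phi>: "\<Phi> r (A.J c) = A.J (sc r c)" for r c by (simp add: \<Phi>_def inv_J)
  have JJ: "A.J = B.J" "A.SV = B.SV" by auto
  have \<Phi>_add: "\<Phi> r (\<lambda>p. \<phi> p + \<psi> p) = (\<lambda>p. \<Phi> r \<phi> p + \<Phi> r \<psi> p)" if "\<phi> \<in> A.SV UNIV" "\<psi> \<in> A.SV UNIV" for \<phi> \<psi> r
  proof -
    obtain c d where "\<phi> = A.J c" "\<psi> = A.J d" using \<open>\<phi> \<in> _\<close> \<open>\<psi> \<in> _\<close> by (auto simp: A.SV_def)
    moreover have "(\<lambda>p. A.J c p + A.J d p) = A.J (c + d)" by (auto simp: A.J_add)
    moreover have "sc r (c + d) = sc r c + sc r d" by (rule poly_mapping_eqI) (simp add: sc lookup_add distrib_left)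
    ultimately show ?thesis by (auto simp: \<Phi> A.J_add)
  qed
  have \<Phi>_scale: "\<Phi> r (\<lambda>p. z * \<phi> p) = (\<lambda>p. z * \<Phi> r \<phi> p)" if \<phi>: "\<phi> \<in> A.SV UNIV" for \<phi> r z
  proof -
    obtain c where c: "\<phi> = A.J c" using \<phi> by (auto simp: A.SV_def)
    define m where "m d = Poly_Mapping.mapp (\<lambda>x. (*) z) d" for d :: "int \<times> nat \<Rightarrow>\<^sub>0 complex"
    have m: "lookup (m d) x = z * lookup d x" for d x
      by (simp add: m_def lookup_mapp when_def in_keys_iff)
    have Jm: "A.J (m d) = (\<lambda>p. z * A.J d p)" for d
    proof -
      have "keys (m d) \<subseteq> keys d" by (auto simp: in_keys_iff m)
      then show ?thesis
        by (auto simp: A.J_superset[of "keys d"] A.J_def[of d] m sum_distrib_left mult.assoc)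
    qed
    have sm: "sc r (m c) = m (sc r c)" by (rule poly_mapping_eqI) (simp add: sc m mult.left_commute)
    have "\<Phi> r (A.J (m c)) = (\<lambda>p. z * \<Phi> r (A.J c) p)"
      unfolding \<Phi> sm by (rule Jm)
    then show ?thesis unfolding Jm c .
  qed
  have \<Phi>_V: "\<Phi> r (A.V k i) = (\<lambda>p. r powi k * A.V k i p)" for r k i
  proof -
    have J1: "A.J (Poly_Mapping.single (k, i) z) = (\<lambda>p. z * A.V k i p)" for z by auto
    have s: "sc r (Poly_Mapping.single (k, i) 1) = Poly_Mapping.single (k, i) (r powi k)"
      by (rule poly_mapping_eqI) (auto simp: sc lookup_single when_def)
    have "\<Phi> r (A.J (Poly_Mapping.single (k, i) 1)) = (\<lambda>p. r powi k * A.V k i p)"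
      unfolding \<Phi> s by (rule J1)
    then show ?thesis unfolding J1 by simp
  qed
  define r where "r = l / l'"
  have r: "r \<noteq> 0" "r * l' = l" using assms by (auto simp: r_def)
  have powi: "r powi (k - 1) * l = r powi k * l'" "r powi (k + 1) / l = r powi k / l'" for k
    using assms r(1) by (simp_all add: power_int_diff power_int_add field_simps r_def)
  have \<Phi>_closed: "\<Phi> s \<phi> \<in> A.SV UNIV" for s \<phi> by (auto simp: \<Phi>_def A.SV_def)
  have scale_B: "act B.D x (\<lambda>p. z * \<phi> p) = (\<lambda>p. z * act B.D x \<phi> p)" for x z \<phi> by simp
  note S = A.SV_V A.SV_add A.SV_scale A.SV_diff UNIV_I
  have gen: "\<Phi> r (act A.D x (A.V k i)) = act B.D x (\<Phi> r (A.V k i))"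
    if "x \<in> {tk_e, tk_h, tk_f, tk_ebar, tk_hbar, tk_fbar}" for x k i
  proof -
    have diff: "\<Phi> r (\<lambda>p. \<phi> p - \<psi> p) = (\<lambda>p. \<Phi> r \<phi> p - \<Phi> r \<psi> p)" if "\<phi> \<in> A.SV UNIV" "\<psi> \<in> A.SV UNIV" for \<phi> \<psi>
      using \<Phi>_add[OF that(1) A.SV_scale[OF that(2), of "-1"], of r] \<Phi>_scale[OF that(2), of r "-1"] by simp
    note push = \<Phi>_add \<Phi>_scale diff \<Phi>_V
    from that consider "x = tk_e" | "x = tk_h" | "x = tk_f" | "x = tk_ebar" | "x = tk_hbar" | "x = tk_fbar" by blast
    then show ?thesis
    proof cases
      case 1
      have "2 * l * (r powi (k - 1) * z) = r powi k * (2 * l' * z)" for z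
        using powi(1)[of k] by (simp add: algebra_simps)
      then show ?thesis unfolding 1 \<Phi>_V scale_B A.act_V B.act_V by (simp only: push S)
    next
      case 2
      show ?thesis unfolding 2 \<Phi>_V scale_B A.act_V B.act_V by (simp only: push S mult.left_commute)
    next
      case 3
      have "1 / (2 * l) * (x * (r powi (k + 1) * X) + y * (r powi (k + 1) * Y) + z * (r powi (k + 1) * Z))
          = r powi k * (1 / (2 * l') * (x * X + y * Y + z * Z))" for x y z X Y Z
      proof -
        have "1 / (2 * l) * (x * (r powi (k + 1) * X) + y * (r powi (k + 1) * Y) + z * (r powi (k + 1) * Z))
          = (r powi (k + 1) / l) * (1 / 2 * (x * X + y * Y + z * Z))" by (simp add: algebra_simps add_divide_distrib)
        then show ?thesis unfolding powi(2) by simp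
      qed
      then show ?thesis unfolding 3 \<Phi>_V scale_B A.act_V B.act_V by (simp only: push S)
    next
      case 4
      have "- l * (r powi (k - 1) * z) = r powi k * (- l' * z)" for z
        using powi(1)[of k] by (simp add: algebra_simps)
      then show ?thesis unfolding 4 \<Phi>_V scale_B A.act_V B.act_V by (simp only: push S)
    next
      case 5
      show ?thesis unfolding 5 \<Phi>_V scale_B A.act_V B.act_V
        by (simp only: push S right_diff_distrib mult.left_commute)
    next
      case 6
      have "1 / (4 * l) * (x * (r powi (k + 1) * X) + y * (r powi (k + 1) * Y) + z * (r powi (k + 1) * Z))
          = r powi k * (1 / (4 * l') * (x * X + y * Y + z * Z))" for x y z X Y Z
      proof -
        have "1 / (4 * l) * (x * (r powi (k + 1) * X) + y * (r powi (k + 1) * Y) + z * (r powi (k + 1) * Z))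
          = (r powi (k + 1) / l) * (1 / 4 * (x * X + y * Y + z * Z))" by (simp add: algebra_simps add_divide_distrib)
        then show ?thesis unfolding powi(2) by simp
      qed
      then show ?thesis unfolding 6 \<Phi>_V scale_B A.act_V B.act_V by (simp only: push S)
    qed
  qed
  have act: "\<Phi> r (act A.D x \<phi>) = act B.D x (\<Phi> r \<phi>)" if x: "x \<in> takiff" and \<phi>: "\<phi> \<in> A.SV UNIV" for x \<phi>
  proof -
    have A_act: "act A.D y \<psi> \<in> A.SV UNIV" if "\<psi> \<in> A.SV UNIV" "y \<in> takiff" for y \<psi>
      using that A.SV_UNIV_submodule by (auto simp: takiff_submodule_def simp del: A.D_simps(4))
    have B_add: "act B.D y (\<lambda>p. \<psi> p + \<xi> p) = (\<lambda>p. act B.D y \<psi> p + act B.D y \<xi> p)" for y \<psi> \<xi> by simp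
    have A_add: "act A.D y (\<lambda>p. \<psi> p + \<xi> p) = (\<lambda>p. act A.D y \<psi> p + act A.D y \<xi> p)" for y \<psi> \<xi> by simp
    have A_scale: "act A.D y (\<lambda>p. z * \<psi> p) = (\<lambda>p. z * act A.D y \<psi> p)" for y z \<psi> by simp
    let ?H = "{\<phi> \<in> A.SV UNIV. \<Phi> r (act A.D x \<phi>) = act B.D x (\<Phi> r \<phi>)}"
    have "A.SV UNIV \<subseteq> ?H"
    proof (rule A.SV_least)
      have "\<Phi> r (\<lambda>p. 0) = (\<lambda>p. 0)" using \<Phi>_scale[OF A.SV_zero, of r 0] by simp
      then show "(\<lambda>p. 0) \<in> ?H" by (simp add: A.SV_zero)
    next
      fix \<psi> \<xi> assume "\<psi> \<in> ?H" "\<xi> \<in> ?H"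
      then show "(\<lambda>p. \<psi> p + \<xi> p) \<in> ?H"
        unfolding mem_Collect_eq A_add by (simp only: A.SV_add \<Phi>_add A_act x B_add)
    next
      fix z \<psi> assume "\<psi> \<in> ?H"
      then show "(\<lambda>p. z * \<psi> p) \<in> ?H"
        unfolding mem_Collect_eq A_scale by (simp only: A.SV_scale \<Phi>_scale A_act x scale_B)
    next
      fix k i
      have g: "\<Phi> r (act A.D y (A.V k i)) = act B.D y (\<Phi> r (A.V k i))" "act A.D y (A.V k i) \<in> A.SV UNIV"
        if "y \<in> {tk_e, tk_h, tk_f, tk_ebar, tk_hbar, tk_fbar}" for y
        using gen[OF that] A_act[of "A.V k i" y] that A.SV_V[of k i UNIV] by auto
      have "\<Phi> r (A.V k i) \<in> carrier B.D" using \<Phi>_closed B.SV_subset_D JJ(2) by auto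
      then show "A.V k i \<in> ?H"
        unfolding mem_Collect_eq A.act_D_basis[OF A.V_in_D, of x]
        by (subst B.act_D_basis) (simp_all only: g insertI1 insertI2 A.SV_V UNIV_I A.SV_add A.SV_scale \<Phi>_add \<Phi>_scale)
    qed
    then show ?thesis using \<phi> by blast
  qed
  have inv: "\<Phi> (1 / r) (\<Phi> r \<phi>) = \<phi>" "\<Phi> r (\<Phi> (1 / r) \<phi>) = \<phi>" if \<phi>: "\<phi> \<in> A.SV UNIV" for \<phi>
  proof -
    obtain c where c: "\<phi> = A.J c" using \<phi> by (auto simp: A.SV_def)
    have "sc (1 / r) (sc r c) = c" "sc r (sc (1 / r) c) = c"
      using r(1) by (auto intro!: poly_mapping_eqI simp: sc power_int_divide_distrib)
    then show "\<Phi> (1 / r) (\<Phi> r \<phi>) = \<phi>" "\<Phi> r (\<Phi> (1 / r) \<phi>) = \<phi>" by (simp_all add: c \<Phi>)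
  qed
  have "rep_iso (\<Phi> r) A.M B.M"
    unfolding rep_iso_def A.carrier_M B.carrier_M A.M_simps B.M_simps
  proof (intro conjI ballI allI)
    show "bij_betw (\<Phi> r) (A.SV UNIV) (A.SV UNIV)"
      by (rule bij_betw_byWitness[of _ "\<Phi> (1 / r)"]) (auto simp: inv \<Phi>_closed)
  qed (auto simp only: \<Phi>_add \<Phi>_scale act)
  then show ?thesis unfolding rep_isomorphic_def by blast
qed

lemma M_isomorphic_iff:
  assumes "l \<noteq> 0" "l' \<noteq> 0"
  shows "rep_isomorphic (M_rep l \<alpha> \<beta> a b) (M_rep l' \<alpha>' \<beta>' a' b') \<longleftrightarrow>
    (\<exists>n::int. \<alpha> - \<alpha>' = 2 * of_int n) \<and> \<beta> = \<beta>' \<and> a = a' \<and> b = b'"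
  using M_isomorphic_imp_eq[OF assms] M_rep_scaling[OF assms] M_rep_shift by metis

section \<open>The structure of \<open>M\<close>\<close>

context jet_module
begin

lemma simple_M_iff:
  "simple_module M \<longleftrightarrow> \<beta>\<^sup>2 + a \<noteq> 0 \<or> (\<forall>k. (alpha_at \<alpha> k + 2) * \<beta> + b \<noteq> 0)"
proof
  assume s: "simple_module M"
  show "\<beta>\<^sup>2 + a \<noteq> 0 \<or> (\<forall>k. (alpha_at \<alpha> k + 2) * \<beta> + b \<noteq> 0)"
  proof (rule ccontr)
    assume "\<not> ?thesis"
    then obtain K where "\<beta>\<^sup>2 + a = 0" "(alpha_at \<alpha> K + 2) * \<beta> + b = 0" by blast
    then interpret lowest_weight_jet l a b \<alpha> \<beta> K by unfold_locales
    show False using s not_simple_M by blast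
  qed
qed (blast intro: simple_M)

lemma weight_condition_shift:
  assumes "s \<ge> 1"
  shows "alpha_at \<alpha> k + 2 * of_nat s = alpha_at \<alpha> (k + int (s - 1)) + 2"
  using assms by (simp add: alpha_at_def of_nat_diff)

lemma weight_condition_iff:
  "(\<forall>(k::int) (s::nat). s \<ge> 1 \<longrightarrow> (alpha_at \<alpha> k + 2 * of_nat s) * \<beta> + b \<noteq> 0)
    \<longleftrightarrow> (\<forall>k. (alpha_at \<alpha> k + 2) * \<beta> + b \<noteq> 0)"
proof
  assume "\<forall>(k::int) (s::nat). s \<ge> 1 \<longrightarrow> (alpha_at \<alpha> k + 2 * of_nat s) * \<beta> + b \<noteq> 0"
  from this[rule_format, of 1] show "\<forall>k. (alpha_at \<alpha> k + 2) * \<beta> + b \<noteq> 0" by simp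
qed (metis weight_condition_shift)

text \<open>If \<open>\<beta> = 0\<close>, then \<open>b = 0\<close> and \<open>V k 0\<close> is itself a lowest weight vector. Otherwise
  \<open>(\<alpha>\<^sub>j + 2) \<beta> + b\<close> vanishes for \<open>j = k + s - 1\<close> only, so \<open>f\<close> climbs from \<open>V k 0\<close> up to the lowest
  weight vector \<open>V (k + s - 1) 0\<close>.\<close>

lemma cyclic_submodule:
  assumes \<beta>: "\<beta>\<^sup>2 + a = 0" and s: "s \<ge> 1" and k: "(alpha_at \<alpha> k + 2 * of_nat s) * \<beta> + b = 0"
  obtains j where "j < s" "s = 1 \<or> \<beta> = 0 \<Longrightarrow> j = 0" "lowest_weight_jet l a b \<alpha> \<beta> (k + int j)"
    "env_orbit M (V k 0) = W (k + int j)"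
proof -
  interpret M: takiff_module M by (rule takiff_module_M)
  have V: "V k 0 \<in> carrier M" by (simp add: carrier_M SV_V)
  note O = M.env_orbit_submodule[OF V]
  define j where "j = (if \<beta> = 0 then 0 else s - 1)"
  have "(alpha_at \<alpha> (k + int j) + 2) * \<beta> + b = 0"
    using k weight_condition_shift[OF s, of k] by (auto simp: j_def)
  with \<beta> have L: "lowest_weight_jet l a b \<alpha> \<beta> (k + int j)" by unfold_locales
  have "V (k + int m) 0 \<in> env_orbit M (V k 0)" if "m \<le> j" for m
    using that
  proof (induction m)
    case 0 show ?case using O(2) by simp
  next
    case (Suc m)
    have \<beta>0: "\<beta> \<noteq> 0" and m: "m + 1 < s" using Suc.prems by (auto simp: j_def split: if_splits)
    define d :: complex where "d = of_nat s - of_nat (m + 1)"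
    have "d \<noteq> 0" using m unfolding d_def by (metis eq_iff_diff_eq_0 nat_neq_iff of_nat_eq_iff)
    have "(alpha_at \<alpha> (k + int m) + 2) * \<beta> + b
        = ((alpha_at \<alpha> k + 2 * of_nat s) * \<beta> + b) - 2 * d * \<beta>"
      by (simp add: alpha_at_def d_def algebra_simps)
    then have "(alpha_at \<alpha> (k + int m) + 2) * \<beta> + b \<noteq> 0" using k \<beta>0 \<open>d \<noteq> 0\<close> by simp
    then show ?case using submodule_up[OF O(1) Suc.IH] Suc.prems by (simp add: algebra_simps)
  qed
  from this[of j] have W: "env_orbit M (V k 0) = W (k + int j)"
    by (intro lowest_weight_jet.env_orbit_eq_W[OF L]) auto
  show ?thesis by (rule that[OF _ _ L W]) (use s in \<open>auto simp: j_def\<close>)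
qed

end

theorem theorem1p3:
  fixes l \<alpha> \<beta> a b :: complex
  assumes "l \<noteq> 0"
  shows
    "(simple_module (M_rep l \<alpha> \<beta> a b) \<longleftrightarrow>
        \<beta>\<^sup>2 + a \<noteq> 0 \<or>
        (\<beta>\<^sup>2 + a = 0 \<and>
         (\<forall>(k::int) (s::nat). s \<ge> 1 \<longrightarrow> (alpha_at \<alpha> k + 2 * of_nat s) * \<beta> + b \<noteq> 0)))
     \<and>
     (\<not> simple_module (M_rep l \<alpha> \<beta> a b) \<longrightarrow>
        (\<exists>k::int. (alpha_at \<alpha> k + 2 * of_nat 1) * \<beta> + b = 0) \<and>
        (\<forall>(k::int) (s::nat). s \<ge> 1 \<and> (alpha_at \<alpha> k + 2 * of_nat s) * \<beta> + b = 0 \<longrightarrow>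
           (let Mks = env_orbit (M_rep l \<alpha> \<beta> a b) (eta \<alpha> \<beta> k 1) in
              takiff_submodule Mks (M_rep l \<alpha> \<beta> a b) \<and>
              (s = 1 \<or> \<beta> = 0 \<longrightarrow>
                 is_opp_verma (restrict_rep (M_rep l \<alpha> \<beta> a b) Mks) (eta \<alpha> \<beta> k 1)) \<and>
              (\<exists>j<s. is_opp_verma (restrict_rep (M_rep l \<alpha> \<beta> a b) Mks)
                        (eta \<alpha> \<beta> (k + int j) 1)) \<and>
              (\<exists>Nks :: (bipoly \<Rightarrow> complex) set rep.
                 rep_isomorphic (quotient_rep (M_rep l \<alpha> \<beta> a b) Mks) Nks \<and>
                 gen_weight_module Nks \<and> inf_dim_weight_spaces Nks))))
     \<and>
     (\<forall>\<alpha> \<beta> a b l l' :: complex. l \<noteq> 0 \<and> l' \<noteq> 0 \<longrightarrow>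
        rep_isomorphic (M_rep l \<alpha> \<beta> a b) (M_rep l' \<alpha> \<beta> a b))
     \<and>
     (\<forall>\<alpha> \<beta> \<alpha>' \<beta>' a b a' b' l l' :: complex. l \<noteq> 0 \<and> l' \<noteq> 0 \<longrightarrow>
        (rep_isomorphic (M_rep l \<alpha> \<beta> a b) (M_rep l' \<alpha>' \<beta>' a' b') \<longleftrightarrow>
           (\<exists>n::int. \<alpha> - \<alpha>' = 2 * of_int n) \<and> \<beta> = \<beta>' \<and> a = a' \<and> b = b'))"
proof -
  interpret jet_module l a b \<alpha> \<beta> by unfold_locales (rule assms)
  have eta: "eta \<alpha> \<beta> k 1 = V k 0" for k by (simp add: eta_eq_jet)
  show ?thesis
    unfolding weight_condition_iff Let_def eta
  proof (intro conjI impI allI; (elim conjE)?)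
    show "simple_module M \<longleftrightarrow> \<beta>\<^sup>2 + a \<noteq> 0 \<or> (\<beta>\<^sup>2 + a = 0 \<and> (\<forall>k. (alpha_at \<alpha> k + 2) * \<beta> + b \<noteq> 0))"
      using simple_M_iff by blast
  next
    assume "\<not> simple_module M"
    then show "\<exists>k::int. (alpha_at \<alpha> k + 2 * of_nat 1) * \<beta> + b = 0" using simple_M_iff by auto
  next
    fix k s
    let ?O = "env_orbit M (V k 0)"
    assume "\<not> simple_module M" and s: "s \<ge> 1" "(alpha_at \<alpha> k + 2 * of_nat s) * \<beta> + b = 0"
    then have \<beta>: "\<beta>\<^sup>2 + a = 0" using simple_M_iff by blast
    obtain j where j: "j < s" "s = 1 \<or> \<beta> = 0 \<Longrightarrow> j = 0" "lowest_weight_jet l a b \<alpha> \<beta> (k + int j)"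
      "?O = W (k + int j)"
      using cyclic_submodule[OF \<beta> s] by blast
    interpret lowest_weight_jet l a b \<alpha> \<beta> "k + int j" by (rule j(3))
    show "takiff_submodule ?O M" unfolding j(4) by (rule W_submodule)
    have verma: "is_opp_verma (restrict_rep M ?O) (V (k + int j) 0)"
      unfolding j(4) by (rule opp_verma_W)
    then show "\<exists>j<s. is_opp_verma (restrict_rep M ?O) (V (k + int j) 0)" using j(1) by blast
    show "is_opp_verma (restrict_rep M ?O) (V k 0)" if "s = 1 \<or> \<beta> = 0"
      using verma j(2)[OF that] by simp
    show "\<exists>Nks :: (bipoly \<Rightarrow> complex) set rep.
        rep_isomorphic (quotient_rep M ?O) Nks \<and> gen_weight_module Nks \<and> inf_dim_weight_spaces Nks"
      unfolding j(4) using rep_isomorphic_refl gen_weight_module_Q inf_dim_Q by blast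
  qed (use M_isomorphic_iff M_rep_scaling in auto)
qed

end
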